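(* The cut locus from the identity for the $\mathbf{k}\oplus\mathbf{p}$ sub-Riemannian problem on $SL(2)=SL(2,\mathbb{R})$ is a stratification $$K_{\mathrm{Id}}=K_{\mathrm{Id}}^{sym}\cup K_{\mathrm{Id}}^{loc}$$ with $$K_{\mathrm{Id}}^{sym}=e^{2\pi k}e^{\mathbf{p}}=\{g\in SL(2)\mid g=g^T,\ \mathrm{Tr}(g)<0\},$$ $$K_{\mathrm{Id}}^{loc}=e^{\mathbf{k}}\setminus\{\mathrm{Id}\}=\left\{\begin{pmatrix}\cos\alpha&-\sin\alpha\\\sin\alpha&\cos\alpha\end{pmatrix}\ \Big|\ \alpha\in\mathbb{R}/2\pi,\ \alpha\neq0\right\}.$$
   Context: In $sl(2)$ let $p_1=\frac12\begin{pmatrix}1&0\\0&-1\end{pmatrix}$, $p_2=\frac12\begin{pmatrix}0&1\\1&0\end{pmatrix}$, $k=\frac12\begin{pmatrix}0&-1\\1&0\end{pmatrix}$, $\mathbf{k}=\mathrm{span}\{k\}$, $\mathbf{p}=\mathrm{span}\{p_1,p_2\}$; $e^{\mathbf{k}}$, $e^{\mathbf{p}}$ are the images of $\mathbf{k}$, $\mathbf{p}$ under the matrix exponential. The $\mathbf{k}\oplus\mathbf{p}$ sub-Riemannian structure on $SL(2)$ is the left-invariant one with distribution $\Delta(g)=g\mathbf{p}$ and metric $\mathbf{g}_g(v_1,v_2)=\langle g^{-1}v_1,g^{-1}v_2\rangle$, where $\langle\cdot,\cdot\rangle$ is the inner product on $\mathbf{p}$ with $\{p_1,p_2\}$ orthonormal.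 A Lipschitz curve $\gamma:[0,T]\to SL(2)$ is horizontal if $\dot\gamma(t)\in\Delta(\gamma(t))$ for a.e. $t$; its length is $\int_0^T\sqrt{\mathbf{g}_\gamma(\dot\gamma,\dot\gamma)}\,dt$; $d(q_0,q_1)$ is the infimum of lengths of horizontal curves joining $q_0$ and $q_1$. The geodesics starting from the identity and parametrized by arclength are the curves $t\mapsto\mathrm{Exp}(\theta,c,t)=e^{(\cos\theta\,p_1+\sin\theta\,p_2+ck)t}e^{-ckt}$, $\theta\in\mathbb{R}/2\pi$, $c\in\mathbb{R}$. Such a geodesic is optimal on $[0,t]$ if $d(\mathrm{Id},\mathrm{Exp}(\theta,c,t))=t$. The cut locus $K_{\mathrm{Id}}$ is the set of points $q$ for which there exist $(\theta_1,c_1)\neq(\theta_2,c_2)$ and $t>0$ with $q=\mathrm{Exp}(\theta_1,c_1,t)=\mathrm{Exp}(\theta_2,c_2,t)$ and both $\mathrm{Exp}(\theta_i,c_i,\cdot)$ optimal on $[0,t]$. "Stratification" means that the cut locus is the union of the two indicated sets. *)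

theory Defs
  imports "HOL-Analysis.Analysis" "HOL-Library.Real_Mod"
begin

definition SL2 :: "(real^2^2) set" where
  "SL2 = {g. det g = 1}"

(* Multiplication and exp from the type classes do not apply here: the product of
   real^2^2 is componentwise.  Hence the exponential series is written with matrix powers. *)
definition mexp :: "real^2^2 \<Rightarrow> real^2^2" where
  "mexp A = (\<Sum>n. (1 / fact n) *\<^sub>R (((**) A ^^ n) (mat 1)))"

definition sl2_p1 :: "real^2^2" where
  "sl2_p1 = (1/2) *\<^sub>R vector [vector [1, 0], vector [0, -1]]"

definition sl2_p2 :: "real^2^2" where
  "sl2_p2 = (1/2) *\<^sub>R vector [vector [0, 1], vector [1, 0]]"

definition sl2_k :: "real^2^2" where
  "sl2_k = (1/2) *\<^sub>R vector [vector [0, -1], vector [1, 0]]"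

definition k_space :: "(real^2^2) set" where
  "k_space = span {sl2_k}"

definition p_space :: "(real^2^2) set" where
  "p_space = span {sl2_p1, sl2_p2}"

(* The inner product on p_space making sl2_p1, sl2_p2 orthonormal: the sum of the products
   of the coordinates in that basis.  Only meaningful for arguments in p_space. *)
definition p_inner :: "real^2^2 \<Rightarrow> real^2^2 \<Rightarrow> real" where
  "p_inner X Y = (\<Sum>b\<in>{sl2_p1, sl2_p2}.
     representation {sl2_p1, sl2_p2} X b * representation {sl2_p1, sl2_p2} Y b)"

definition distr :: "real^2^2 \<Rightarrow> (real^2^2) set" where
  "distr g = (\<lambda>X. g ** X) ` p_space"

definition sr_metric :: "real^2^2 \<Rightarrow> real^2^2 \<Rightarrow> real^2^2 \<Rightarrow> real" where
  "sr_metric g v w = p_inner (matrix_inv g ** v) (matrix_inv g ** w)"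

(* Lipschitz refers to the Euclidean norm of the ambient space of matrices.  On compact subsets
   of SL2 this agrees, up to the constant, with any Riemannian distance. *)
definition horizontal :: "real \<Rightarrow> (real \<Rightarrow> real^2^2) \<Rightarrow> bool" where
  "horizontal T \<gamma> \<longleftrightarrow> 0 \<le> T \<and> \<gamma> ` {0..T} \<subseteq> SL2 \<and> (\<exists>L. L-lipschitz_on {0..T} \<gamma>) \<and>
     (AE t in lebesgue_on {0..T}. \<gamma> differentiable (at t within {0..T}) \<and>
        vector_derivative \<gamma> (at t within {0..T}) \<in> distr (\<gamma> t))"

definition sr_length :: "real \<Rightarrow> (real \<Rightarrow> real^2^2) \<Rightarrow> real" where
  "sr_length T \<gamma> = (LINT t|lebesgue_on {0..T}.
     sqrt (sr_metric (\<gamma> t) (vector_derivative \<gamma> (at t within {0..T}))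
                           (vector_derivative \<gamma> (at t within {0..T}))))"

definition sr_dist :: "real^2^2 \<Rightarrow> real^2^2 \<Rightarrow> real" where
  "sr_dist q0 q1 = Inf {sr_length T \<gamma> | T \<gamma>. horizontal T \<gamma> \<and> \<gamma> 0 = q0 \<and> \<gamma> T = q1}"

definition sr_Exp :: "real \<Rightarrow> real \<Rightarrow> real \<Rightarrow> real^2^2" where
  "sr_Exp \<theta> c t =
     mexp (t *\<^sub>R (cos \<theta> *\<^sub>R sl2_p1 + sin \<theta> *\<^sub>R sl2_p2 + c *\<^sub>R sl2_k)) ** mexp ((- (c * t)) *\<^sub>R sl2_k)"

definition optimal_upto :: "real \<Rightarrow> real \<Rightarrow> real \<Rightarrow> bool" where
  "optimal_upto \<theta> c t \<longleftrightarrow> sr_dist (mat 1) (sr_Exp \<theta> c t) = t"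

definition cut_locus :: "(real^2^2) set" where
  "cut_locus = {q. \<exists>\<theta>1 c1 \<theta>2 c2 t. \<not> ([\<theta>1 = \<theta>2] (rmod (2 * pi)) \<and> c1 = c2) \<and> t > 0 \<and>
     q = sr_Exp \<theta>1 c1 t \<and> q = sr_Exp \<theta>2 c2 t \<and> optimal_upto \<theta>1 c1 t \<and> optimal_upto \<theta>2 c2 t}"

definition K_sym :: "(real^2^2) set" where
  "K_sym = (\<lambda>h. mexp ((2 * pi) *\<^sub>R sl2_k) ** h) ` mexp ` p_space"

definition K_loc :: "(real^2^2) set" where
  "K_loc = mexp ` k_space - {mat 1}"

end

theory Submission
  imports Defs
begin

text \<open>
  Write a real \<open>2 \<times> 2\<close> matrix as the map \<open>z \<mapsto> A z + B cnj z\<close> of the complex plane. In these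
  coordinates the determinant is \<open>|A|\<^sup>2 - |B|\<^sup>2\<close> and a horizontal curve with control \<open>u\<close> satisfies
  \<open>A' = B cnj u / 2\<close>, \<open>B' = A u / 2\<close>. Hence for every \<open>c \<ge> 0\<close> the function
  \<open>\<plusminus> 2 c arg A \<plusminus> \<phi>\<^sub>c(|B|)\<close> with \<open>\<phi>\<^sub>c' = 2 sqrt (1 - (c\<^sup>2 - 1) s\<^sup>2) / (1 + s\<^sup>2)\<close> has slope at most one along curves
  of unit speed, as long as \<open>(c\<^sup>2 - 1) |B|\<^sup>2 \<le> 1\<close>. Using \<open>+ \<phi>\<^sub>c\<close> up to the time at which \<open>|B|\<close> is maximal and
  \<open>- \<phi>\<^sub>c\<close> afterwards, a curve from the identity to \<open>q\<close> with \<open>max |B| = S\<close> has length at least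
  \<open>2 c |Arg A(q)| + 2 \<phi>\<^sub>c(S) - \<phi>\<^sub>c(|B(q)|)\<close>.

  Let a geodesic with parameter \<open>e\<close>, at most one period long, end at the same \<open>|B(q)|\<close> and have turned
  \<open>A\<close> by \<open>|Arg A(q)|\<close>. If it is longer than half a period, the bound for \<open>c\<^sup>2 = 1 + 1 / S\<^sup>2\<close> is convex in \<open>c\<close>
  and minimal at \<open>c = e\<close>, where it is the length of the geodesic. If it is shorter, \<open>+ \<phi>\<^sub>e\<close> alone gives its
  length as a bound, unless \<open>S\<close> is too large for \<open>\<phi>\<^sub>e\<close>; then \<open>c < e\<close>, and the first case for the mirror image
  of the geodesic in its period settles the claim. So exactly these
  geodesics minimize. Two of them meet at \<open>q\<close> if \<open>B(q) = 0\<close> (all initial directions \<open>\<theta>\<close> then give the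
  same end point) or if \<open>c\<close> and \<open>-c\<close> lead to the same \<open>A(q)\<close>, which is then a negative real number. A geodesic
  longer than its period is strictly longer than the minimizer with the same end point.
\<close>

section \<open>Integrating right derivatives of Lipschitz functions\<close>

text \<open>Lebesgue measure is complete, so after extension by zero a change on a null set keeps
  measurability. This serves derivatives of Lipschitz curves, which are controlled only almost
  everywhere.\<close>

lemma borel_measurable_lebesgue_on_AE:
  fixes f g :: "'a::euclidean_space \<Rightarrow> 'b::euclidean_space"
  assumes S: "S \<in> sets lebesgue" and f: "f \<in> borel_measurable (lebesgue_on S)"
    and ae: "AE x in lebesgue_on S. f x = g x"
  shows "g \<in> borel_measurable (lebesgue_on S)"
proof -
  have "(\<lambda>x. if x \<in> S then g x else 0) \<in> borel_measurable lebesgue"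
  proof (rule borel_measurable_AE)
    show "(\<lambda>x. if x \<in> S then f x else 0) \<in> borel_measurable lebesgue"
      using f borel_measurable_if[OF S] by blast
    have "AE x in lebesgue. x \<in> S \<longrightarrow> f x = g x"
      using ae S by (simp add: AE_restrict_space_iff)
    then show "AE x in lebesgue. (if x \<in> S then f x else 0) = (if x \<in> S then g x else 0)"
      by eventually_elim auto
  qed
  then show ?thesis using borel_measurable_if[OF S] by blast
qed

text \<open>
  Only a right derivative is assumed: the norm of a differentiable curve need not be differentiable
  where the curve vanishes.
\<close>

lemma lipschitz_integral_right_derivative:
  fixes f f' :: "real \<Rightarrow> real"
  assumes ab: "a \<le> b" and lip: "L-lipschitz_on {a..b} f"
    and der: "AE t in lebesgue_on {a..b}. (f has_real_derivative f' t) (at t within {t..b})"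
  shows "integrable (lebesgue_on {a..b}) f'"
    and "(LINT t|lebesgue_on {a..b}. f' t) = f b - f a"
proof -
  \<comment> \<open>Extending \<open>f\<close> by constants makes forward difference quotients
    meaningful up to the right end point.\<close>
  define g where "g = (\<lambda>t. f (min (max t a) b))"
  have L0: "L \<ge> 0" using lip by (rule lipschitz_on_nonneg)
  have clampin: "min (max t a) b \<in> {a..b}" for t using ab by auto
  have glip: "\<bar>g x - g y\<bar> \<le> L * \<bar>x - y\<bar>" for x y
  proof -
    have "dist (g x) (g y) \<le> L * dist (min (max x a) b) (min (max y a) b)"
      unfolding g_def by (rule lipschitz_onD[OF lip clampin clampin])
    also have "\<dots> \<le> L * dist x y"
      by (rule mult_left_mono) (auto simp: dist_real_def L0)
    finally show ?thesis by (simp add: dist_real_def)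
  qed
  have "L-lipschitz_on UNIV g"
    using glip L0 by (intro lipschitz_onI) (auto simp: dist_real_def)
  then have gcont: "continuous_on X g" for X
    using lipschitz_on_continuous_on continuous_on_subset by blast
  define h where "h = (\<lambda>n::nat. 1 / real (Suc n))"
  have hpos: "h n > 0" and hle: "h n \<le> 1" for n by (auto simp: h_def)
  have hlim: "h \<longlonglongrightarrow> 0" unfolding h_def using LIMSEQ_inverse_real_of_nat by (simp add: inverse_eq_divide)
  \<comment> \<open>The forward quotients are bounded by \<open>L\<close> and tend to
    \<open>f'\<close> almost everywhere, so dominated convergence applies.\<close>
  define q where "q = (\<lambda>n t. (g (t + h n) - g t) / h n)"
  have qcont: "continuous_on X (q n)" for X n
    unfolding q_def using hpos[of n]
    by (intro continuous_intros continuous_on_compose2[OF gcont[of UNIV]]) auto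
  have qmeas: "q n \<in> borel_measurable (lebesgue_on {a..b})" for n
    by (rule continuous_imp_measurable_on_sets_lebesgue[OF qcont]) auto
  have qbound: "norm (q n t) \<le> L" for n t
    using glip[of "t + h n" t] hpos[of n] by (simp add: q_def field_simps)
  \<comment> \<open>At \<open>b\<close> the filter within \<open>{b..b}\<close> is trivial and a
    right derivative there carries no information.\<close>
  have neb: "AE t in lebesgue_on {a..b}. t \<noteq> b"
    by (rule AE_I'[of "{b}"]) (auto simp: null_sets_restrict_space ab)
  have "AE t in lebesgue_on {a..b}. t \<in> {a..b}"
    by (rule AE_I2) auto
  with der neb have qlim: "AE t in lebesgue_on {a..b}. (\<lambda>n. q n t) \<longlonglongrightarrow> f' t"
  proof eventually_elim
    case (elim t)
    then have tb: "t < b" "a \<le> t" by auto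
    have "((\<lambda>y. (f y - f t) / (y - t)) \<longlongrightarrow> f' t) (at t within {t..b})"
      using elim(1) by (simp add: has_field_derivative_iff)
    moreover have "filterlim (\<lambda>n. t + h n) (at t within {t..b}) sequentially"
    proof (rule filterlim_at_withinI)
      show "(\<lambda>n. t + h n) \<longlonglongrightarrow> t"
        using tendsto_add[OF tendsto_const hlim, of t] by simp
      have "\<forall>\<^sub>F n in sequentially. h n < b - t"
        using order_tendstoD(2)[OF hlim] tb by simp
      then show "\<forall>\<^sub>F n in sequentially. t + h n \<in> {t..b} - {t}"
        by eventually_elim (use hpos less_imp_neq in \<open>fastforce simp: less_imp_le\<close>)
    qed
    ultimately have lim: "(\<lambda>n. (f (t + h n) - f t) / (t + h n - t)) \<longlonglongrightarrow> f' t"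
      by (rule filterlim_compose)
    have "\<forall>\<^sub>F n in sequentially. h n < b - t"
      using order_tendstoD(2)[OF hlim] tb by simp
    then have "\<forall>\<^sub>F n in sequentially. (f (t + h n) - f t) / (t + h n - t) = q n t"
    proof eventually_elim
      case (elim n)
      then show ?case using hpos[of n] tb by (simp add: q_def g_def min_def max_def)
    qed
    with lim show ?case by (rule Lim_transform_eventually)
  qed
  have fmeas: "f' \<in> borel_measurable (lebesgue_on {a..b})"
  proof (rule borel_measurable_lebesgue_on_AE)
    show "{a..b} \<in> sets lebesgue" by simp
    show "(\<lambda>t. lim (\<lambda>n. q n t)) \<in> borel_measurable (lebesgue_on {a..b})"
      using qmeas by (rule borel_measurable_lim_metric)
    show "AE t in lebesgue_on {a..b}. lim (\<lambda>n. q n t) = f' t"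
      using qlim by eventually_elim (rule limI)
  qed
  have Lint: "integrable (lebesgue_on {a..b}) (\<lambda>t. L)"
    by (intro finite_measure.integrable_const finite_measure_lebesgue_on) auto
  show "integrable (lebesgue_on {a..b}) f'"
    by (rule integrable_dominated_convergence[OF fmeas qmeas Lint qlim]) (use qbound in auto)
  have conv: "(\<lambda>n. LINT t|lebesgue_on {a..b}. q n t) \<longlonglongrightarrow> (LINT t|lebesgue_on {a..b}. f' t)"
    by (rule integral_dominated_convergence[OF fmeas qmeas Lint qlim]) (use qbound in auto)
  \<comment> \<open>The integral of a quotient telescopes to the average of \<open>g\<close> over
    \<open>{b..b + h n}\<close> minus its average over \<open>{a..a + h n}\<close>.\<close>
  define F where "F = (\<lambda>x. integral {a..x} g)"
  have Fder: "(F has_real_derivative g x) (at x within {a..b+1})" if "x \<in> {a..b+1}" for x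
    unfolding F_def by (rule integral_has_real_derivative[OF gcont that])
  have qint: "(LINT t|lebesgue_on {a..b}. q n t) = (F (b + h n) - F b) / h n - (F (a + h n) - F a) / h n" for n
  proof -
    have G: "((\<lambda>t. F (t + h n) - F t) has_real_derivative (g (t + h n) - g t)) (at t within {a..b})"
      if t: "t \<in> {a..b}" for t
    proof (rule DERIV_diff)
      have "((\<lambda>t. F (t + h n)) has_real_derivative g (t + h n) * 1) (at t within {a..b})"
      proof (rule DERIV_image_chain[where f = F and g = "\<lambda>t. t + h n", unfolded o_def])
        show "(F has_real_derivative g (t + h n)) (at (t + h n) within (\<lambda>t. t + h n) ` {a..b})"
          by (rule DERIV_subset[OF Fder]) (use t hpos[of n] hle[of n] in auto)
        show "((\<lambda>t. t + h n) has_real_derivative 1) (at t within {a..b})"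
          by (auto intro!: derivative_eq_intros)
      qed
      then show "((\<lambda>t. F (t + h n)) has_real_derivative g (t + h n)) (at t within {a..b})" by simp
      show "(F has_real_derivative g t) (at t within {a..b})"
        by (rule DERIV_subset[OF Fder]) (use t in auto)
    qed
    have "((\<lambda>t. g (t + h n) - g t) has_integral (F (b + h n) - F b) - (F (a + h n) - F a)) {a..b}"
      using fundamental_theorem_of_calculus[OF ab, of "\<lambda>t. F (t + h n) - F t" "\<lambda>t. g (t + h n) - g t"] G
      by (simp add: has_real_derivative_iff_has_vector_derivative)
    then have "(q n has_integral ((F (b + h n) - F b) - (F (a + h n) - F a)) / h n) {a..b}"
      unfolding q_def by (rule has_integral_divide)
    then have 1: "integral {a..b} (q n) = ((F (b + h n) - F b) - (F (a + h n) - F a)) / h n"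
      by (rule integral_unique)
    have "q n absolutely_integrable_on {a..b}"
      by (rule absolutely_integrable_continuous_real[OF qcont])
    then have "integrable (lebesgue_on {a..b}) (q n)"
      by (subst integrable_restrict_space) (auto simp: set_integrable_def)
    then have "(LINT t|lebesgue_on {a..b}. q n t) = integral {a..b} (q n)"
      by (rule lebesgue_integral_eq_integral) auto
    with 1 show ?thesis by (simp add: diff_divide_distrib)
  qed
  have Fq: "(\<lambda>n. (F (x + h n) - F x) / h n) \<longlonglongrightarrow> g x" if x: "x \<in> {a..b}" for x
  proof -
    have "((\<lambda>y. (F y - F x) / (y - x)) \<longlongrightarrow> g x) (at x within {a..b+1})"
      using Fder[of x] x by (simp add: has_field_derivative_iff)
    moreover have "filterlim (\<lambda>n. x + h n) (at x within {a..b+1}) sequentially"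
    proof (rule filterlim_at_withinI)
      show "(\<lambda>n. x + h n) \<longlonglongrightarrow> x"
        using tendsto_add[OF tendsto_const hlim, of x] by simp
      show "\<forall>\<^sub>F n in sequentially. x + h n \<in> {a..b+1} - {x}"
      proof (rule always_eventually, rule allI)
        fix n show "x + h n \<in> {a..b+1} - {x}" using x hpos[of n] hle[of n] by auto
      qed
    qed
    ultimately have "(\<lambda>n. (F (x + h n) - F x) / (x + h n - x)) \<longlonglongrightarrow> g x"
      by (rule filterlim_compose)
    then show ?thesis by simp
  qed
  have "(\<lambda>n. LINT t|lebesgue_on {a..b}. q n t) \<longlonglongrightarrow> g b - g a"
    unfolding qint by (intro tendsto_diff Fq) (use ab in auto)
  then have "(LINT t|lebesgue_on {a..b}. f' t) = g b - g a"
    using conv LIMSEQ_unique by blast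
  then show "(LINT t|lebesgue_on {a..b}. f' t) = f b - f a"
    using ab by (simp add: g_def)
qed

section \<open>Complex coordinates on two by two matrices\<close>

text \<open>The matrix \<open>g\<close> acts on the plane as \<open>z \<mapsto> lin_part g * z + conj_part g * cnj z\<close>.\<close>

definition lin_part :: "real^2^2 \<Rightarrow> complex" where
  "lin_part g = Complex ((g$1$1 + g$2$2) / 2) ((g$2$1 - g$1$2) / 2)"

definition conj_part :: "real^2^2 \<Rightarrow> complex" where
  "conj_part g = Complex ((g$1$1 - g$2$2) / 2) ((g$2$1 + g$1$2) / 2)"

lemma mat2_eqI:
  assumes "lin_part g = lin_part h" "conj_part g = conj_part h"
  shows "g = h"
proof -
  have "g$1$1 + g$2$2 = h$1$1 + h$2$2" "g$2$1 - g$1$2 = h$2$1 - h$1$2"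
    "g$1$1 - g$2$2 = h$1$1 - h$2$2" "g$2$1 + g$1$2 = h$2$1 + h$1$2"
    using assms by (auto simp: lin_part_def conj_part_def)
  then show ?thesis by (auto simp: vec_eq_iff forall_2)
qed

text \<open>Composition of the real-linear maps \<open>z \<mapsto> A z + B cnj z\<close>; the
  conjugation turns the inner coefficients into their conjugates.\<close>

lemma lin_part_mult: "lin_part (g ** h) = lin_part g * lin_part h + conj_part g * cnj (conj_part h)"
  and conj_part_mult: "conj_part (g ** h) = lin_part g * conj_part h + conj_part g * cnj (lin_part h)"
  by (auto simp: lin_part_def conj_part_def matrix_matrix_mult_def sum_2 complex_eq_iff field_simps)

lemma linear_lin_part: "linear lin_part" and linear_conj_part: "linear conj_part"
  by (auto intro!: linearI simp: lin_part_def conj_part_def complex_eq_iff field_simps)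

lemma bounded_linear_lin_part: "bounded_linear lin_part"
  and bounded_linear_conj_part: "bounded_linear conj_part"
  using linear_lin_part linear_conj_part linear_conv_bounded_linear by blast+

lemma lin_part_scaleR [simp]: "lin_part (r *\<^sub>R g) = of_real r * lin_part g"
  and conj_part_scaleR [simp]: "conj_part (r *\<^sub>R g) = of_real r * conj_part g"
  and lin_part_add [simp]: "lin_part (g + h) = lin_part g + lin_part h"
  and conj_part_add [simp]: "conj_part (g + h) = conj_part g + conj_part h"
  by (auto simp: lin_part_def conj_part_def complex_eq_iff field_simps)

lemma lin_part_mat_1 [simp]: "lin_part (mat 1) = 1"
  and conj_part_mat_1 [simp]: "conj_part (mat 1) = 0"
  by (auto simp: lin_part_def conj_part_def mat_def complex_eq_iff)

lemma sl2_parts [simp]: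
  "lin_part sl2_p1 = 0" "conj_part sl2_p1 = 1/2"
  "lin_part sl2_p2 = 0" "conj_part sl2_p2 = \<i>/2"
  "lin_part sl2_k = \<i>/2" "conj_part sl2_k = 0"
  by (auto simp: lin_part_def conj_part_def sl2_p1_def sl2_p2_def sl2_k_def complex_eq_iff)

section \<open>The group, the distribution and the metric in complex coordinates\<close>

lemma det_parts: "det g = (cmod (lin_part g))\<^sup>2 - (cmod (conj_part g))\<^sup>2"
  unfolding det_2 lin_part_def conj_part_def cmod_power2 by (simp add: power2_eq_square field_simps)

lemma SL2_parts: "g \<in> SL2 \<longleftrightarrow> (cmod (lin_part g))\<^sup>2 = 1 + (cmod (conj_part g))\<^sup>2"
  by (auto simp: SL2_def det_parts)

text \<open>The symmetric trace-free matrices are exactly the conjugate-linear maps.\<close>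

lemma p_space_iff: "X \<in> p_space \<longleftrightarrow> lin_part X = 0"
proof
  assume "X \<in> p_space"
  then obtain x y where "X = x *\<^sub>R sl2_p1 + y *\<^sub>R sl2_p2"
    unfolding p_space_def by (auto simp: span_insert) (metis add.commute diff_eq_eq)
  then show "lin_part X = 0" by simp
next
  assume 0: "lin_part X = 0"
  have "X = (2 * Re (conj_part X)) *\<^sub>R sl2_p1 + (2 * Im (conj_part X)) *\<^sub>R sl2_p2"
    by (rule mat2_eqI) (auto simp: 0 complex_eq_iff)
  then show "X \<in> p_space"
    unfolding p_space_def by (metis span_add span_scale span_base insertI1 insertI2)
qed

lemma k_space_eq: "k_space = range (\<lambda>r. r *\<^sub>R sl2_k)"
  by (auto simp: k_space_def span_singleton)

text \<open>The factor 2 arises because the orthonormal basis has conjugate parts \<open>1/2\<close>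
  and \<open>\<i>/2\<close>.\<close>

lemma p_inner_self:
  assumes "lin_part X = 0"
  shows "p_inner X X = (2 * cmod (conj_part X))\<^sup>2"
proof -
  have ne: "sl2_p1 \<noteq> sl2_p2"
    using sl2_parts(2,4) by (metis complex_i_not_one divide_cancel_right zero_neq_numeral)
  have indep: "independent {sl2_p1, sl2_p2}"
  proof -
    have "sl2_p2 \<noteq> 0" by (metis sl2_parts(4) conj_part_scaleR complex_i_not_zero divide_eq_0_iff mult_zero_left of_real_0 scaleR_zero_left zero_neq_numeral)
    moreover have "sl2_p1 \<notin> span {sl2_p2}"
    proof
      assume "sl2_p1 \<in> span {sl2_p2}"
      then obtain r where "sl2_p1 = r *\<^sub>R sl2_p2" by (auto simp: span_singleton)
      then have "conj_part sl2_p1 = of_real r * (\<i>/2)" by (metis conj_part_scaleR sl2_parts(4))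
      then show False by (simp add: complex_eq_iff)
    qed
    ultimately show ?thesis using ne by (simp add: independent_insert)
  qed
  have X: "X = (2 * Re (conj_part X)) *\<^sub>R sl2_p1 + (2 * Im (conj_part X)) *\<^sub>R sl2_p2"
    by (rule mat2_eqI) (auto simp: assms complex_eq_iff)
  have sp: "sl2_p1 \<in> span {sl2_p1, sl2_p2}" "sl2_p2 \<in> span {sl2_p1, sl2_p2}"
    by (auto intro: span_base)
  have rep: "representation {sl2_p1, sl2_p2} X = (\<lambda>b. 2 * Re (conj_part X) * (if b = sl2_p1 then 1 else 0)
     + 2 * Im (conj_part X) * (if b = sl2_p2 then 1 else 0))"
    by (subst X) (use sp in \<open>auto simp: representation_add[OF indep] representation_scale[OF indep]
        representation_basis[OF indep] span_scale\<close>)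
  show ?thesis
    using ne ne[symmetric] unfolding p_inner_def rep
    by (simp add: cmod_power2 power_mult_distrib) (simp add: power2_eq_square)
qed

lemma SL2_matrix_inv:
  assumes "g \<in> SL2"
  shows "matrix_inv g ** (g ** X) = X"
proof -
  have "invertible g" using assms by (simp add: SL2_def invertible_det_nz)
  then have "matrix_inv g ** g = mat 1" unfolding matrix_inv_def invertible_def by (rule someI2_ex) simp
  then show ?thesis by (simp add: matrix_mul_assoc)
qed

text \<open>The control \<open>u\<close> is twice the conjugate part of the left translate of
  \<open>V\<close> to the identity. The last identity expresses its modulus through \<open>V\<close>
  alone; it later yields measurability of the speed without a measurable choice of
  \<open>u\<close>.\<close>

lemma in_distr_parts:
  assumes g: "g \<in> SL2" and "V \<in> distr g"
  obtains u where "lin_part V = conj_part g * cnj u / 2" "conj_part V = lin_part g * u / 2"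
    "sqrt (sr_metric g V V) = cmod u" "(cmod u)\<^sup>2 = - 4 * det V"
proof -
  from assms obtain X where X: "X \<in> p_space" "V = g ** X" by (auto simp: distr_def)
  define u where "u = 2 * conj_part X"
  have lX: "lin_part X = 0" and cX: "conj_part X = u / 2" using X by (auto simp: p_space_iff u_def)
  have "sr_metric g V V = (cmod u)\<^sup>2"
    by (simp add: sr_metric_def X(2) SL2_matrix_inv[OF g] p_inner_self[OF lX] u_def norm_mult)
  moreover have "det V = det g * det X" by (simp add: X det_mul)
  moreover have "det g = 1" using g by (simp add: SL2_def)
  moreover have "det X = - (cmod u)\<^sup>2 / 4"
    by (simp add: det_parts lX cX norm_divide power_divide)
  ultimately show ?thesis
    by (intro that[of u]) (auto simp: X(2) lin_part_mult conj_part_mult lX cX)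
qed

section \<open>Lifting the argument of a Lipschitz curve\<close>

text \<open>Steps of length \<open>d / 2\<close> chain the local estimate along the interval, by
  induction on their number.\<close>

lemma lipschitz_on_interval_of_local:
  fixes f :: "real \<Rightarrow> 'a::metric_space"
  assumes d: "d > 0" and K: "K \<ge> 0"
    and loc: "\<And>s t. \<lbrakk>s \<in> {a..b}; t \<in> {a..b}; s \<le> t; t - s < d\<rbrakk> \<Longrightarrow> dist (f s) (f t) \<le> K * (t - s)"
  shows "K-lipschitz_on {a..b} f"
proof (rule lipschitz_on_leI[OF _ K])
  have *: "dist (f s) (f t) \<le> K * (t - s)"
    if "s \<in> {a..b}" "t \<in> {a..b}" "s \<le> t" "t - s < real n * (d / 2)" for n s t
    using that
  proof (induction n arbitrary: s)
    case (Suc n)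
    show ?case
    proof (cases "t - s < d")
      case False
      define r where "r = s + d / 2"
      have r: "r \<in> {a..b}" "r \<le> t" "t - r < real n * (d / 2)" "s \<le> r" "r - s < d"
        using False Suc.prems d by (auto simp: r_def algebra_simps)
      have "dist (f s) (f t) \<le> dist (f s) (f r) + dist (f r) (f t)" by (rule dist_triangle)
      also have "\<dots> \<le> K * (r - s) + K * (t - r)"
        using Suc.IH[of r] loc[of s r] r Suc.prems by (intro add_mono) auto
      finally show ?thesis by (simp add: algebra_simps)
    qed (use loc Suc.prems in auto)
  qed auto
  fix s t assume st: "s \<in> {a..b}" "t \<in> {a..b}" "s \<le> t"
  obtain n where "t - s < real n * (d / 2)"
    using reals_Archimedean3[OF half_gt_zero[OF d]] by blast
  then show "dist (f s) (f t) \<le> K * dist s t"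
    using *[OF st] st by (simp add: dist_real_def)
qed

text \<open>Mean value inequality: on the ball of radius \<open>1/2\<close> around 1 the derivative
  \<open>inverse w\<close> has modulus at most 2.\<close>

lemma norm_Ln_le:
  assumes "cmod (z - 1) < 1/2"
  shows "cmod (Ln z) \<le> 2 * cmod (z - 1)"
proof -
  have *: "Re w > 1/2" if "w \<in> ball 1 (1/2)" for w :: complex
    using that abs_Re_le_cmod[of "1 - w"] by (auto simp: dist_norm)
  have "cmod (Ln z - Ln 1) \<le> 2 * cmod (z - 1)"
  proof (rule field_differentiable_bound)
    show "convex (ball (1::complex) (1/2))" by simp
    show "(Ln has_field_derivative inverse w) (at w within ball 1 (1/2))" if "w \<in> ball 1 (1/2)" for w
    proof (rule has_field_derivative_at_within[OF has_field_derivative_Ln])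
      show "w \<notin> \<real>\<^sub>\<le>\<^sub>0" using *[OF that] by (auto simp: complex_nonpos_Reals_iff)
    qed
    show "cmod (inverse w) \<le> 2" if "w \<in> ball 1 (1/2)" for w
    proof -
      have "cmod w \<ge> 1/2" using *[OF that] complex_Re_le_cmod[of w] by linarith
      then have "inverse (cmod w) \<le> inverse (1/2)" by (intro le_imp_inverse_le) auto
      then show ?thesis by (simp add: norm_inverse)
    qed
  qed (use assms in \<open>auto simp: dist_norm norm_minus_commute\<close>)
  then show ?thesis by simp
qed

text \<open>A continuous logarithm exists because the interval is contractible. Near
  \<open>t\<close> it is \<open>l t\<close> plus the principal logarithm of
  \<open>a s / a t\<close>, which transfers the Lipschitz bound and the derivatives. The set
  \<open>X\<close> is left general to cover one-sided derivatives.\<close>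

lemma lipschitz_logarithm:
  fixes a :: "real \<Rightarrow> complex"
  assumes lip: "L-lipschitz_on {x..y} a" and a1: "\<And>t. t \<in> {x..y} \<Longrightarrow> 1 \<le> cmod (a t)"
  obtains l K where "K-lipschitz_on {x..y} l" "\<And>t. t \<in> {x..y} \<Longrightarrow> a t = exp (l t)"
    "\<And>t X d. \<lbrakk>t \<in> X; X \<subseteq> {x..y}; (a has_vector_derivative d) (at t within X)\<rbrakk>
       \<Longrightarrow> (l has_vector_derivative d / a t) (at t within X)"
proof -
  have L: "L \<ge> 0" using lip by (rule lipschitz_on_nonneg)
  have cont: "continuous_on {x..y} a" using lip by (rule lipschitz_on_continuous_on)
  have nz: "a t \<noteq> 0" if "t \<in> {x..y}" for t using a1[OF that] by auto
  obtain l where l: "continuous_on {x..y} l" "\<And>t. t \<in> {x..y} \<Longrightarrow> a t = exp (l t)"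
    using continuous_logarithm_on_contractible[OF cont convex_imp_contractible nz] by auto
  \<comment> \<open>Within this distance \<open>a s / a t\<close> stays in the ball of radius
    \<open>1/2\<close> around 1, away from the branch cut. The summand 1 keeps \<open>d\<close>
    positive when \<open>L = 0\<close>.\<close>
  define d where "d = 1 / (2 * (L + 1))"
  have d: "d > 0" using L by (simp add: d_def)
  have quot: "cmod (a s / a t - 1) \<le> L * \<bar>s - t\<bar>" "L * \<bar>s - t\<bar> < 1/2"
    if "s \<in> {x..y}" "t \<in> {x..y}" "\<bar>s - t\<bar> < d" for s t
  proof -
    have "cmod (a s / a t - 1) = cmod (a s - a t) / cmod (a t)"
      using nz[OF that(2)] by (simp add: norm_divide[symmetric] diff_divide_distrib)
    also have "\<dots> \<le> cmod (a s - a t)"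
      using a1[OF that(2)] by (simp add: divide_le_eq mult_left_le_one_le mult_ge1_I)
        (metis mult_right_mono norm_ge_zero mult.commute mult.left_neutral)
    also have "\<dots> \<le> L * \<bar>s - t\<bar>"
      using lipschitz_onD[OF lip that(1,2)] by (simp add: dist_norm)
    finally show "cmod (a s / a t - 1) \<le> L * \<bar>s - t\<bar>" .
    have "L * \<bar>s - t\<bar> \<le> L * d" using that L by (intro mult_left_mono) auto
    also have "\<dots> < 1/2" using L by (simp add: d_def field_simps)
    finally show "L * \<bar>s - t\<bar> < 1/2" .
  qed
  have lLn: "l s = l t + Ln (a s / a t)"
    if st: "s \<in> {x..y}" "t \<in> {x..y}" "\<bar>s - t\<bar> < d" for s t
  proof -
    define I where "I = {x..y} \<inter> ball t d"
    \<comment> \<open>The function \<open>h\<close> is continuous on an interval and takes values in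
      the integer multiples of \<open>2 * pi * \<i>\<close>; hence it is constant.\<close>
    define h where "h = (\<lambda>s. l s - l t - Ln (a s / a t))"
    have pos: "Re (a r / a t) > 0" if "r \<in> I" for r
      using quot[of r t] that st abs_Re_le_cmod[of "1 - a r / a t"]
      by (auto simp: I_def dist_real_def norm_minus_commute abs_minus_commute)
    have expn: "\<exists>n::int. h r = of_int (2 * n) * pi * \<i>" if "r \<in> I" for r
    proof -
      have "r \<in> {x..y}" using that by (simp add: I_def)
      then have "exp (l r) = a r" "exp (l t) = a t" using l st by auto
      moreover have "a r / a t \<noteq> 0" using pos[OF that] by (metis less_irrefl zero_complex.simps(1))
      ultimately have "exp (h r) = 1"
        using nz[OF st(2)] nz[OF \<open>r \<in> {x..y}\<close>] by (simp add: h_def exp_diff)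
      then show ?thesis using exp_eq[of "h r" 0] by simp
    qed
    have "h constant_on I"
    proof (rule continuous_discrete_range_constant)
      show "connected I" unfolding I_def
        by (intro convex_connected convex_Int) auto
      have "continuous_on I a" "continuous_on I l"
        using cont l(1) continuous_on_subset by (force simp: I_def)+
      then show "continuous_on I h"
        unfolding h_def by (intro continuous_intros) (use pos nz[OF st(2)] in \<open>force simp: complex_nonpos_Reals_iff\<close>)+
      show "\<exists>e>0. \<forall>v. v \<in> I \<and> h v \<noteq> h u \<longrightarrow> e \<le> norm (h v - h u)" if "u \<in> I" for u
      proof (intro exI[of _ 1] conjI allI impI)
        fix v assume v: "v \<in> I \<and> h v \<noteq> h u"
        obtain m n :: int where mn: "h u = of_int (2 * m) * pi * \<i>" "h v = of_int (2 * n) * pi * \<i>"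
          using expn[of u] expn[of v] v \<open>u \<in> I\<close> by auto
        then have "n \<noteq> m" using v by auto
        have "h v - h u = complex_of_real (2 * real_of_int (n - m) * pi) * \<i>"
          unfolding mn by (simp add: algebra_simps)
        then have "norm (h v - h u) = 2 * \<bar>real_of_int (n - m)\<bar> * pi"
          by (simp only: norm_mult norm_of_real norm_ii abs_mult) simp
        moreover have "\<bar>real_of_int (n - m)\<bar> \<ge> 1" using \<open>n \<noteq> m\<close> by linarith
        ultimately show "1 \<le> norm (h v - h u)"
          using pi_gt3 mult_mono[of 1 "\<bar>real_of_int (n - m)\<bar>" 1 pi] by simp
      qed simp
    qed
    moreover have "s \<in> I" "t \<in> I" using st d by (auto simp: I_def dist_real_def)
    ultimately have "h s = h t" by (metis constant_on_def)
    then show ?thesis using nz[OF st(2)] by (simp add: h_def algebra_simps)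
  qed
  have "(2 * L)-lipschitz_on {x..y} l"
  proof (rule lipschitz_on_interval_of_local[OF d])
    fix s t assume st: "s \<in> {x..y}" "t \<in> {x..y}" "s \<le> t" "t - s < d"
    have "dist (l s) (l t) = cmod (Ln (a t / a s))"
      using lLn[of t s] st by (simp add: dist_norm)
    also have "\<dots> \<le> 2 * cmod (a t / a s - 1)"
      using quot[of t s] st by (intro norm_Ln_le) auto
    also have "\<dots> \<le> 2 * (L * (t - s))"
      using quot[of t s] st by (intro mult_left_mono) auto
    finally show "dist (l s) (l t) \<le> 2 * L * (t - s)" by simp
  qed (use L in auto)
  moreover have "(l has_vector_derivative D / a t) (at t within X)"
    if tX: "t \<in> X" "X \<subseteq> {x..y}" and der: "(a has_vector_derivative D) (at t within X)" for t X D
  proof -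
    have t: "t \<in> {x..y}" using tX by auto
    have "((\<lambda>s. a s / a t) has_vector_derivative D / a t) (at t within X)"
      using has_vector_derivative_mult_left[OF der, of "inverse (a t)"] by (simp add: field_simps)
    moreover have "(Ln has_field_derivative 1) (at (a t / a t) within (\<lambda>s. a s / a t) ` X)"
      using has_field_derivative_at_within[OF has_field_derivative_Ln[of 1]] nz[OF t] by simp
    ultimately have "((Ln \<circ> (\<lambda>s. a s / a t)) has_vector_derivative D / a t * 1) (at t within X)"
      by (rule field_vector_diff_chain_within)
    then have "((\<lambda>s. l t + Ln (a s / a t)) has_vector_derivative D / a t) (at t within X)"
      using has_vector_derivative_add[OF has_vector_derivative_const] by (fastforce simp: o_def)
    then show ?thesis
    proof (rule has_vector_derivative_transform_within[OF _ d tX(1)])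
      fix s assume "s \<in> X" "dist s t < d"
      then show "l t + Ln (a s / a t) = l s" using lLn[of s t] t tX by (auto simp: dist_real_def)
    qed
  qed
  ultimately show ?thesis using l(2) that by blast
qed

text \<open>Among all lifts of an angle the principal argument has the least modulus. So a curve
  whose lifted angle winds around has turned by at least the principal argument of its end
  point.\<close>

lemma abs_Arg_exp_le: "\<bar>Arg (exp w)\<bar> \<le> \<bar>Im w\<bar>"
proof (cases "\<bar>Im w\<bar> < pi")
  case True
  then have "Ln (exp w) = w" by (intro Ln_exp) auto
  then show ?thesis by (simp add: Arg_eq_Im_Ln)
next
  case False
  then show ?thesis using Arg_bounded[of "exp w"] by linarith
qed

text \<open>At a zero of \<open>b\<close> the modulus may have a corner, but to the right its
  difference quotient is the modulus of that of \<open>b\<close>. Elsewhere the norm is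
  differentiable.\<close>

lemma right_derivative_cmod:
  fixes b :: "real \<Rightarrow> complex"
  assumes der: "(b has_vector_derivative D) (at t within {t..y})"
  shows "((\<lambda>s. cmod (b s)) has_real_derivative
    (if b t = 0 then cmod D else Re (D * cnj (b t)) / cmod (b t))) (at t within {t..y})"
proof (cases "b t = 0")
  case True
  have "((\<lambda>s. (1 / norm (s - t)) *\<^sub>R (b s - (b t + (s - t) *\<^sub>R D))) \<longlongrightarrow> 0) (at t within {t..y})"
    using der by (simp add: has_vector_derivative_def has_derivative_within)
  then have "((\<lambda>s. (1 / norm (s - t)) *\<^sub>R (b s - (b t + (s - t) *\<^sub>R D)) + D) \<longlongrightarrow> 0 + D) (at t within {t..y})"
    by (intro tendsto_add tendsto_const)
  then have "((\<lambda>s. (b s - b t) /\<^sub>R (s - t)) \<longlongrightarrow> 0 + D) (at t within {t..y})"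
    by (rule Lim_transform_within[OF _ zero_less_one])
      (auto simp: inverse_eq_divide scaleR_right_diff_distrib scaleR_add_right)
  then have "((\<lambda>s. (b s - b t) /\<^sub>R (s - t)) \<longlongrightarrow> D) (at t within {t..y})" by simp
  then have "((\<lambda>s. cmod ((b s - b t) /\<^sub>R (s - t))) \<longlongrightarrow> cmod D) (at t within {t..y})"
    by (rule tendsto_norm)
  then have "((\<lambda>s. (cmod (b s) - cmod (b t)) / (s - t)) \<longlongrightarrow> cmod D) (at t within {t..y})"
    by (rule Lim_transform_within[OF _ zero_less_one]) (auto simp: True field_simps)
  then show ?thesis using True by (simp add: has_field_derivative_iff)
next
  case False
  have "((\<lambda>s. norm (b s)) has_derivative (\<lambda>h. inner (h *\<^sub>R D) (sgn (b t)))) (at t within {t..y})"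
    using has_derivative_compose[OF der[unfolded has_vector_derivative_def]
        has_derivative_norm[OF False]] by simp
  moreover have "(\<lambda>h. inner (h *\<^sub>R D) (sgn (b t))) = (*) (Re (D * cnj (b t)) / cmod (b t))"
    by (auto simp: inner_complex_def sgn_div_norm fun_eq_iff divide_inverse algebra_simps)
  ultimately show ?thesis using False by (simp add: has_field_derivative_def)
qed

section \<open>Calibrations\<close>

text \<open>The radicand is chosen so that \<open>(c * s)\<^sup>2 + (1 - (c\<^sup>2 - 1) *
  s\<^sup>2) = 1 + s\<^sup>2\<close>, which is the squared modulus of the linear part at radius
  \<open>s\<close>.\<close>

definition radial_slope :: "real \<Rightarrow> real \<Rightarrow> real" where
  "radial_slope c s = 2 * sqrt (1 - (c\<^sup>2 - 1) * s\<^sup>2) / (1 + s\<^sup>2)"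

text \<open>Integrating from \<open>-1\<close> makes the derivative at \<open>0\<close> two-sided.\<close>

definition radial :: "real \<Rightarrow> real \<Rightarrow> real" where
  "radial c s = integral {-1..s} (radial_slope c) - integral {-1..0} (radial_slope c)"

lemma radial_0 [simp]: "radial c 0 = 0"
  by (simp add: radial_def)

text \<open>\<open>sqrt\<close> is a continuous odd function on all reals, so continuity persists
  where the radicand is negative.\<close>

lemma continuous_on_radial_slope: "continuous_on X (radial_slope c)"
  unfolding radial_slope_def by (intro continuous_intros) (auto simp: add_nonneg_eq_0_iff)

lemma DERIV_radial:
  assumes "0 \<le> s"
  shows "(radial c has_real_derivative radial_slope c s) (at s)"
proof -
  have "((\<lambda>x. integral {-1..x} (radial_slope c)) has_real_derivative radial_slope c s) (at s within {-1..s+1})"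
    by (rule integral_has_real_derivative[OF continuous_on_radial_slope]) (use assms in auto)
  then have "((\<lambda>x. integral {-1..x} (radial_slope c)) has_real_derivative radial_slope c s) (at s)"
    using assms by (simp add: at_within_Icc_at)
  then show ?thesis
    unfolding radial_def [abs_def] by (auto intro!: derivative_eq_intros)
qed

lemma radial_slope_bounds:
  assumes "0 \<le> s" "s \<le> S" "(c\<^sup>2 - 1) * S\<^sup>2 \<le> 1"
  shows "0 \<le> radial_slope c s" "radial_slope c s \<le> 2"
proof -
  have "(c\<^sup>2 - 1) * s\<^sup>2 \<le> 1"
  proof (cases "c\<^sup>2 \<le> 1")
    case True
    then show ?thesis using mult_nonpos_nonneg[of "c\<^sup>2 - 1" "s\<^sup>2"] by simp
  next
    case False
    then have "(c\<^sup>2 - 1) * s\<^sup>2 \<le> (c\<^sup>2 - 1) * S\<^sup>2" using assms by (intro mult_left_mono power_mono) auto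
    then show ?thesis using assms by simp
  qed
  then show "0 \<le> radial_slope c s"
    by (simp add: radial_slope_def add_nonneg_pos)
  have "sqrt (1 - (c\<^sup>2 - 1) * s\<^sup>2) \<le> 1 + s\<^sup>2"
  proof (rule real_le_lsqrt)
    have "0 \<le> c\<^sup>2 * s\<^sup>2" "0 \<le> s\<^sup>2" "0 \<le> (s\<^sup>2)\<^sup>2" by auto
    then show "1 - (c\<^sup>2 - 1) * s\<^sup>2 \<le> (1 + s\<^sup>2)\<^sup>2"
      by (simp add: power2_sum algebra_simps)
  qed auto
  then show "radial_slope c s \<le> 2"
    by (simp add: radial_slope_def divide_le_eq add_pos_nonneg)
qed

lemma radial_mono:
  assumes "0 \<le> s" "s \<le> r" "r \<le> S" "(c\<^sup>2 - 1) * S\<^sup>2 \<le> 1"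
  shows "radial c s \<le> radial c r"
  using assms(2)
proof (rule DERIV_nonneg_imp_nondecreasing)
  fix x assume "s \<le> x" "x \<le> r"
  then show "\<exists>y. DERIV (radial c) x :> y \<and> 0 \<le> y"
    using DERIV_radial[of x c] radial_slope_bounds(1)[of x S c] assms by auto
qed

lemma radial_lipschitz:
  assumes "(c\<^sup>2 - 1) * S\<^sup>2 \<le> 1"
  shows "2-lipschitz_on {0..S} (radial c)"
proof (rule lipschitz_onI)
  fix x y assume xy: "x \<in> {0..S}" "y \<in> {0..S}"
  have "norm (radial c x - radial c y) \<le> 2 * norm (x - y)"
  proof (rule field_differentiable_bound[of "{0..S}"])
    show "(radial c has_real_derivative radial_slope c z) (at z within {0..S})" if "z \<in> {0..S}" for z
      using DERIV_radial[of z c] that by (auto intro: has_field_derivative_at_within)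
    show "norm (radial_slope c z) \<le> 2" if "z \<in> {0..S}" for z
      using radial_slope_bounds[of z S c] that assms by auto
  qed (use xy in auto)
  then show "dist (radial c x) (radial c y) \<le> 2 * dist x y" by (simp add: dist_real_def)
qed simp

lemma cauchy_schwarz_2: "a * x + b * y \<le> sqrt (a\<^sup>2 + b\<^sup>2) * sqrt (x\<^sup>2 + y\<^sup>2)" for a b x y :: real
proof -
  have "a * x + b * y \<le> sqrt ((a\<^sup>2 + b\<^sup>2) * (x\<^sup>2 + y\<^sup>2))"
  proof (rule real_le_rsqrt)
    have "0 \<le> (a * y - b * x)\<^sup>2" by simp
    then show "(a * x + b * y)\<^sup>2 \<le> (a\<^sup>2 + b\<^sup>2) * (x\<^sup>2 + y\<^sup>2)"
      by (simp add: power2_eq_square algebra_simps)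
  qed
  then show ?thesis by (simp add: real_sqrt_mult)
qed

text \<open>Put \<open>w = A * u * cnj B\<close> and \<open>s = cmod B > 0\<close>. The argument of
  \<open>A\<close> turns at rate \<open>Im w / (2 * (1 + s\<^sup>2))\<close> up to sign, and the
  radius changes at rate \<open>Re w / (2 * s)\<close>. The claim is then Cauchy-Schwarz for the
  vectors \<open>(c * s, r)\<close> and \<open>(\<bar>Im w\<bar>, \<bar>Re w\<bar>)\<close>, of
  norms \<open>cmod A\<close> and \<open>cmod A * cmod u * s\<close>.\<close>

lemma calibration_bound:
  fixes A B u :: complex
  assumes A: "(cmod A)\<^sup>2 = 1 + (cmod B)\<^sup>2" and c: "0 \<le> c" and S: "(c\<^sup>2 - 1) * (cmod B)\<^sup>2 \<le> 1"
    and N: "N = (if B = 0 then cmod (A * u / 2) else Re (A * u / 2 * cnj B) / cmod B)"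
  shows "2 * c * \<bar>Im (B * cnj u / 2 / A)\<bar> + radial_slope c (cmod B) * \<bar>N\<bar> \<le> cmod u"
proof (cases "B = 0")
  case True
  then have "cmod A = 1" using A by (metis norm_zero zero_power2 add_0_right norm_ge_zero power2_eq_1_iff not_one_le_zero neg_0_le_iff_le)
  then show ?thesis using True by (simp add: N radial_slope_def norm_mult norm_divide)
next
  case False
  define s where "s = cmod B"
  define r where "r = sqrt (1 - (c\<^sup>2 - 1) * s\<^sup>2)"
  define w where "w = A * u * cnj B"
  have s: "s > 0" using False by (simp add: s_def)
  have A2: "(cmod A)\<^sup>2 = 1 + s\<^sup>2" and Apos: "cmod A > 0"
    using A by (auto simp: s_def) (metis add_pos_nonneg norm_zero zero_le_power2 zero_less_norm_iff zero_less_one)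
  have r: "r\<^sup>2 = 1 - (c\<^sup>2 - 1) * s\<^sup>2" "0 \<le> r" using S by (auto simp: r_def s_def)
  have "B * cnj u / 2 / A = cnj w / (2 * (A * cnj A))"
    using Apos by (simp add: w_def field_simps)
  also have "A * cnj A = of_real (1 + s\<^sup>2)"
    using A2 by (simp add: complex_norm_square[symmetric])
  finally have "B * cnj u / 2 / A = cnj w / of_real (2 * (1 + s\<^sup>2))" by simp
  then have im: "\<bar>Im (B * cnj u / 2 / A)\<bar> = \<bar>Im w\<bar> / (2 * (1 + s\<^sup>2))"
    by (simp only: Im_divide_of_real) (simp add: abs_mult)
  have re: "\<bar>N\<bar> = \<bar>Re w\<bar> / (2 * s)"
    using False s by (simp add: N w_def s_def[symmetric] abs_mult field_simps)
  have "(c * s) * \<bar>Im w\<bar> + r * \<bar>Re w\<bar> \<le> sqrt ((c * s)\<^sup>2 + r\<^sup>2) * sqrt (\<bar>Im w\<bar>\<^sup>2 + \<bar>Re w\<bar>\<^sup>2)"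
    by (rule cauchy_schwarz_2)
  also have "(c * s)\<^sup>2 + r\<^sup>2 = (cmod A)\<^sup>2" unfolding r A2 by (simp add: algebra_simps)
  also have "sqrt (\<bar>Im w\<bar>\<^sup>2 + \<bar>Re w\<bar>\<^sup>2) = cmod A * cmod u * s"
    using norm_mult[of "A * u" "cnj B"]
    by (simp add: s_def norm_mult w_def[symmetric]) (simp add: cmod_def add.commute)
  also have "sqrt ((cmod A)\<^sup>2) * (cmod A * cmod u * s) = (1 + s\<^sup>2) * s * cmod u"
    unfolding A2[symmetric] by (simp add: power2_eq_square)
  finally have "(c * s) * \<bar>Im w\<bar> + r * \<bar>Re w\<bar> \<le> (1 + s\<^sup>2) * s * cmod u" .
  then have le: "((c * s) * \<bar>Im w\<bar> + r * \<bar>Re w\<bar>) / ((1 + s\<^sup>2) * s) \<le> cmod u"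
    using s by (simp add: divide_le_eq add_pos_nonneg mult.commute mult.left_commute)
  have "((c * s) * \<bar>Im w\<bar> + r * \<bar>Re w\<bar>) / (P * s)
      = 2 * c * (\<bar>Im w\<bar> / (2 * P)) + 2 * r / P * (\<bar>Re w\<bar> / (2 * s))" if "P > 0" for P
    using s that by (simp add: field_simps)
  moreover have "1 + s\<^sup>2 > 0" by (simp add: add_pos_nonneg)
  ultimately have "((c * s) * \<bar>Im w\<bar> + r * \<bar>Re w\<bar>) / ((1 + s\<^sup>2) * s)
      = 2 * c * (\<bar>Im w\<bar> / (2 * (1 + s\<^sup>2))) + 2 * r / (1 + s\<^sup>2) * (\<bar>Re w\<bar> / (2 * s))"
    by blast
  with le show ?thesis unfolding im re by (simp add: radial_slope_def s_def r_def)
qed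

text \<open>The calibration function \<open>f\<close> grows at most as fast as length. The time
  \<open>m\<close> at which the radial part is reflected is free: the time of maximal radius counts
  the way out and back, and \<open>m = T\<close> leaves the radial part unreflected.\<close>

lemma sr_length_lower_bound:
  assumes hor: "horizontal T \<gamma>" and start: "\<gamma> 0 = mat 1"
    and c: "0 \<le> c" and S: "\<And>t. t \<in> {0..T} \<Longrightarrow> cmod (conj_part (\<gamma> t)) \<le> S" "(c\<^sup>2 - 1) * S\<^sup>2 \<le> 1"
    and m: "m \<in> {0..T}"
  shows "2 * c * \<bar>Arg (lin_part (\<gamma> T))\<bar> + 2 * radial c (cmod (conj_part (\<gamma> m)))
    - radial c (cmod (conj_part (\<gamma> T))) \<le> sr_length T \<gamma>"
proof -
  define a where "a = (\<lambda>t. lin_part (\<gamma> t))"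
  define b where "b = (\<lambda>t. conj_part (\<gamma> t))"
  have T: "0 \<le> T" and sl: "\<And>t. t \<in> {0..T} \<Longrightarrow> \<gamma> t \<in> SL2"
    using hor by (auto simp: horizontal_def)
  obtain L where L: "L-lipschitz_on {0..T} \<gamma>" using hor by (auto simp: horizontal_def)
  obtain La where La: "La-lipschitz_on {0..T} a"
    using bounded_linear.lipschitz_boundE[OF bounded_linear_lin_part] L lipschitz_on_compose2
    unfolding a_def by metis
  obtain Lb where Lb: "Lb-lipschitz_on {0..T} b"
    using bounded_linear.lipschitz_boundE[OF bounded_linear_conj_part] L lipschitz_on_compose2
    unfolding b_def by metis
  have ab: "(cmod (a t))\<^sup>2 = 1 + (cmod (b t))\<^sup>2" if "t \<in> {0..T}" for t
    using sl[OF that] by (simp add: SL2_parts a_def b_def)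
  have a1: "1 \<le> cmod (a t)" if "t \<in> {0..T}" for t
  proof (rule power2_le_imp_le)
    show "1\<^sup>2 \<le> (cmod (a t))\<^sup>2" using ab[OF that] by simp
  qed simp
  have bS: "cmod (b t) \<in> {0..S}" if "t \<in> {0..T}" for t using S(1)[OF that] by (simp add: b_def)
  have S2: "(c\<^sup>2 - 1) * (cmod (b t))\<^sup>2 \<le> 1" if "t \<in> {0..T}" for t
  proof (cases "c\<^sup>2 \<le> 1")
    case True
    then show ?thesis using mult_nonpos_nonneg[of "c\<^sup>2 - 1" "(cmod (b t))\<^sup>2"] by simp
  next
    case False
    then have "(c\<^sup>2 - 1) * (cmod (b t))\<^sup>2 \<le> (c\<^sup>2 - 1) * S\<^sup>2"
      using bS[OF that] by (intro mult_left_mono power_mono) auto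
    then show ?thesis using S(2) by simp
  qed
  obtain l K where l: "K-lipschitz_on {0..T} l" "\<And>t. t \<in> {0..T} \<Longrightarrow> a t = exp (l t)"
    and lder: "\<And>t X d. \<lbrakk>t \<in> X; X \<subseteq> {0..T}; (a has_vector_derivative d) (at t within X)\<rbrakk>
       \<Longrightarrow> (l has_vector_derivative d / a t) (at t within X)"
    using lipschitz_logarithm[OF La a1] by metis
  \<comment> \<open>The sign makes the total turning of the linear part count positively.\<close>
  define \<sigma> :: real where "\<sigma> = (if Im (l T - l 0) \<ge> 0 then 1 else -1)"
  have \<sigma>: "\<sigma> * Im (l T - l 0) = \<bar>Im (l T - l 0)\<bar>" "\<bar>\<sigma>\<bar> = 1" by (auto simp: \<sigma>_def)
  define R where "R = (\<lambda>t. radial c (cmod (b t)))"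
  \<comment> \<open>The second branch continues the first continuously at \<open>m\<close>, with the
    opposite radial slope.\<close>
  define f where "f = (\<lambda>t. \<sigma> * (2 * c * Im (l t)) + (if t \<le> m then R t else 2 * R m - R t))"
  have Rlip: "(2 * Lb)-lipschitz_on {0..T} R"
  proof -
    have "Lb-lipschitz_on {0..T} (\<lambda>t. cmod (b t))"
    proof (rule lipschitz_onI)
      fix x y assume "x \<in> {0..T}" "y \<in> {0..T}"
      then have "dist (b x) (b y) \<le> Lb * dist x y" by (rule lipschitz_onD[OF Lb])
      then show "dist (cmod (b x)) (cmod (b y)) \<le> Lb * dist x y"
        using norm_triangle_ineq3[of "b x" "b y"] by (simp add: dist_norm)
    qed (rule lipschitz_on_nonneg[OF Lb])
    moreover have "2-lipschitz_on ((\<lambda>t. cmod (b t)) ` {0..T}) (radial c)"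
      using radial_lipschitz[OF S(2)] bS by (auto intro: lipschitz_on_subset)
    ultimately show ?thesis unfolding R_def by (rule lipschitz_on_compose2)
  qed
  have flip: "\<exists>Lf. Lf-lipschitz_on {0..T} f"
  proof -
    have "K-lipschitz_on {0..T} (\<lambda>t. Im (l t))"
    proof (rule lipschitz_onI)
      fix x y assume "x \<in> {0..T}" "y \<in> {0..T}"
      then have "dist (l x) (l y) \<le> K * dist x y" by (rule lipschitz_onD[OF l(1)])
      then show "dist (Im (l x)) (Im (l y)) \<le> K * dist x y"
        using abs_Im_le_cmod[of "l x - l y"] by (simp add: dist_norm)
    qed (rule lipschitz_on_nonneg[OF l(1)])
    then have 1: "\<exists>L1. L1-lipschitz_on {0..T} (\<lambda>t. (\<sigma> * (2 * c)) * Im (l t))"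
      using lipschitz_on_cmult_real by blast
    have "(2 * Lb)-lipschitz_on {0..m} R" "(2 * Lb)-lipschitz_on {m..T} R"
      using Rlip m by (auto intro: lipschitz_on_subset)
    moreover have "(2 * Lb)-lipschitz_on {m..T} (\<lambda>t. 2 * R m - R t)"
      using calculation(2) by (simp add: lipschitz_on_def dist_real_def abs_minus_commute)
    ultimately have "(2 * Lb)-lipschitz_on {0..T} (\<lambda>t. if t \<le> m then R t else 2 * R m - R t)"
      using lipschitz_on_concat[of "2 * Lb" 0 m R T "\<lambda>t. 2 * R m - R t"] by simp
    with 1 show ?thesis unfolding f_def using lipschitz_on_add by (fastforce simp: mult.assoc)
  qed
  define D where "D = (\<lambda>t. vector_derivative \<gamma> (at t within {0..T}))"
  define N where "N = (\<lambda>t. if b t = 0 then cmod (conj_part (D t))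
     else Re (conj_part (D t) * cnj (b t)) / cmod (b t))"
  define f' where "f' = (\<lambda>t. \<sigma> * (2 * c * Im (lin_part (D t) / a t))
     + (if t \<le> m then 1 else - 1) * (radial_slope c (cmod (b t)) * N t))"
  define v where "v = (\<lambda>t. sqrt (sr_metric (\<gamma> t) (D t) (D t)))"
  have ae: "AE t in lebesgue_on {0..T}. t \<in> {0..T} \<and> t \<noteq> m \<and>
      (\<gamma> has_vector_derivative D t) (at t within {0..T}) \<and> D t \<in> distr (\<gamma> t)"
  proof -
    have "AE t in lebesgue_on {0..T}. t \<in> {0..T}" by (rule AE_I2) auto
    moreover have "AE t in lebesgue_on {0..T}. t \<noteq> m"
      by (rule AE_I'[of "{m}"]) (use m in \<open>auto simp: null_sets_restrict_space\<close>)
    moreover have "AE t in lebesgue_on {0..T}. \<gamma> differentiable (at t within {0..T}) \<and> D t \<in> distr (\<gamma> t)"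
      using hor by (simp add: horizontal_def D_def)
    ultimately show ?thesis
      by eventually_elim (auto simp: D_def vector_derivative_works)
  qed
  have derab: "(a has_vector_derivative lin_part (D t)) (at t within {t..T})"
    "(b has_vector_derivative conj_part (D t)) (at t within {t..T})"
    if "t \<in> {0..T}" "(\<gamma> has_vector_derivative D t) (at t within {0..T})" for t
  proof -
    have "(\<gamma> has_vector_derivative D t) (at t within {t..T})"
      by (rule has_vector_derivative_within_subset[OF that(2)]) (use that in auto)
    from bounded_linear.has_vector_derivative[OF bounded_linear_lin_part this]
      bounded_linear.has_vector_derivative[OF bounded_linear_conj_part this]
    show "(a has_vector_derivative lin_part (D t)) (at t within {t..T})"
      "(b has_vector_derivative conj_part (D t)) (at t within {t..T})"
      unfolding a_def b_def .
  qed
  have fder: "AE t in lebesgue_on {0..T}. (f has_real_derivative f' t) (at t within {t..T})"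
    using ae
  proof eventually_elim
    case (elim t)
    then have t: "t \<in> {0..T}" "t \<noteq> m" and der: "(\<gamma> has_vector_derivative D t) (at t within {0..T})" by auto
    have sub: "{t..T} \<subseteq> {0..T}" "t \<in> {t..T}" using t by auto
    have "(l has_vector_derivative lin_part (D t) / a t) (at t within {t..T})"
      by (rule lder[OF sub(2,1) derab(1)[OF t(1) der]])
    then have 1: "((\<lambda>t. Im (l t)) has_real_derivative Im (lin_part (D t) / a t)) (at t within {t..T})"
      unfolding has_real_derivative_iff_has_vector_derivative
      by (rule bounded_linear.has_vector_derivative[OF bounded_linear_Im])
    have "((\<lambda>t. cmod (b t)) has_real_derivative N t) (at t within {t..T})"
      unfolding N_def by (rule right_derivative_cmod[OF derab(2)[OF t(1) der]])
    then have 2: "(R has_real_derivative radial_slope c (cmod (b t)) * N t) (at t within {t..T})"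
      unfolding R_def by (intro DERIV_chain2[OF DERIV_radial]) auto
    have e: "\<bar>t - m\<bar> > 0" using t by simp
    show ?case
    proof (cases "t \<le> m")
      case True
      have "((\<lambda>t. \<sigma> * (2 * c * Im (l t)) + R t) has_real_derivative f' t) (at t within {t..T})"
        using DERIV_add[OF DERIV_cmult[OF DERIV_cmult[OF 1, of "2 * c"], of \<sigma>] 2] True by (simp add: f'_def)
      then show ?thesis
        by (rule has_field_derivative_transform_within[OF _ e sub(2)])
          (use True in \<open>auto simp: f_def dist_real_def\<close>)
    next
      case False
      have "((\<lambda>t. \<sigma> * (2 * c * Im (l t)) + (2 * R m - R t)) has_real_derivative f' t) (at t within {t..T})"
        using DERIV_add[OF DERIV_cmult[OF DERIV_cmult[OF 1, of "2 * c"], of \<sigma>]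
            DERIV_diff[OF DERIV_const[of "2 * R m"] 2]] False by (simp add: f'_def)
      then show ?thesis
        by (rule has_field_derivative_transform_within[OF _ e sub(2)])
          (use False in \<open>auto simp: f_def dist_real_def\<close>)
    qed
  qed
  obtain Lf where "Lf-lipschitz_on {0..T} f" using flip by blast
  from lipschitz_integral_right_derivative[OF T this fder]
  have fint: "integrable (lebesgue_on {0..T}) f'" and fval: "(LINT t|lebesgue_on {0..T}. f' t) = f T - f 0"
    by auto
  \<comment> \<open>Integrability of the entries of the velocity supplies both measurability of the
    speed and an integrable majorant for it.\<close>
  have comp: "integrable (lebesgue_on {0..T}) (\<lambda>t. D t $ i $ j)" for i j
  proof (rule lipschitz_integral_right_derivative(1)[OF T])
    show "L-lipschitz_on {0..T} (\<lambda>t. \<gamma> t $ i $ j)"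
    proof (rule lipschitz_onI)
      fix x y assume "x \<in> {0..T}" "y \<in> {0..T}"
      then have "dist (\<gamma> x) (\<gamma> y) \<le> L * dist x y" by (rule lipschitz_onD[OF L])
      moreover have "dist (\<gamma> x $ i $ j) (\<gamma> y $ i $ j) \<le> dist (\<gamma> x) (\<gamma> y)"
        by (meson dist_vec_nth_le order_trans)
      ultimately show "dist (\<gamma> x $ i $ j) (\<gamma> y $ i $ j) \<le> L * dist x y" by linarith
    qed (rule lipschitz_on_nonneg[OF L])
    show "AE t in lebesgue_on {0..T}. ((\<lambda>t. \<gamma> t $ i $ j) has_real_derivative D t $ i $ j) (at t within {t..T})"
      using ae
    proof eventually_elim
      case (elim t)
      then have "(\<gamma> has_vector_derivative D t) (at t within {t..T})"
        by (auto intro: has_vector_derivative_within_subset)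
      then show ?case unfolding has_real_derivative_iff_has_vector_derivative
        by (intro bounded_linear.has_vector_derivative[OF bounded_linear_vec_nth]) 
    qed
  qed
  have vprop: "AE t in lebesgue_on {0..T}. f' t \<le> v t \<and> v t = sqrt (- 4 * det (D t))
      \<and> v t \<le> 2 * (\<bar>D t $ 1 $ 1\<bar> + \<bar>D t $ 2 $ 2\<bar> + \<bar>D t $ 1 $ 2\<bar> + \<bar>D t $ 2 $ 1\<bar>)"
    using ae
  proof eventually_elim
    case (elim t)
    then have t: "t \<in> {0..T}" and dis: "D t \<in> distr (\<gamma> t)" by auto
    obtain u where u: "lin_part (D t) = b t * cnj u / 2" "conj_part (D t) = a t * u / 2"
      "v t = cmod u" "(cmod u)\<^sup>2 = - 4 * det (D t)"
      unfolding a_def b_def v_def using in_distr_parts[OF sl[OF t] dis] by blast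
    have "2 * c * \<bar>Im (b t * cnj u / 2 / a t)\<bar> + radial_slope c (cmod (b t)) * \<bar>N t\<bar> \<le> cmod u"
      by (rule calibration_bound[OF ab[OF t] c S2[OF t]]) (simp add: N_def u(2))
    moreover have "\<sigma> * (2 * c * Im (b t * cnj u / 2 / a t)) \<le> 2 * c * \<bar>Im (b t * cnj u / 2 / a t)\<bar>"
    proof -
      have "\<sigma> * (2 * c * Im (b t * cnj u / 2 / a t)) \<le> \<bar>\<sigma> * (2 * c * Im (b t * cnj u / 2 / a t))\<bar>"
        by (rule abs_ge_self)
      also have "\<dots> = 2 * c * \<bar>Im (b t * cnj u / 2 / a t)\<bar>"
        unfolding abs_mult using c \<sigma>(2) by simp
      finally show ?thesis .
    qed
    moreover have "(if t \<le> m then 1 else - 1) * (radial_slope c (cmod (b t)) * N t)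
        \<le> radial_slope c (cmod (b t)) * \<bar>N t\<bar>"
    proof -
      have "(if t \<le> m then 1 else - 1) * (radial_slope c (cmod (b t)) * N t)
        \<le> \<bar>radial_slope c (cmod (b t)) * N t\<bar>" by auto
      also have "\<dots> = radial_slope c (cmod (b t)) * \<bar>N t\<bar>"
        using radial_slope_bounds(1)[of "cmod (b t)" S c] bS[OF t] S(2) by (simp add: abs_mult)
      finally show ?thesis .
    qed
    ultimately have "f' t \<le> v t" unfolding f'_def u by linarith
    moreover have "v t = sqrt (- 4 * det (D t))" unfolding u(4)[symmetric] using u(3) by simp
    moreover have "v t \<le> 2 * (\<bar>D t $ 1 $ 1\<bar> + \<bar>D t $ 2 $ 2\<bar> + \<bar>D t $ 1 $ 2\<bar> + \<bar>D t $ 2 $ 1\<bar>)"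
    proof -
      have "1 * cmod u \<le> cmod (a t) * cmod u" using a1[OF t] by (rule mult_right_mono) simp
      also have "\<dots> = 2 * cmod (conj_part (D t))" by (simp add: u(2) norm_mult norm_divide)
      also have "cmod (conj_part (D t)) \<le> \<bar>Re (conj_part (D t))\<bar> + \<bar>Im (conj_part (D t))\<bar>"
        by (rule cmod_le)
      finally show ?thesis unfolding u(3) by (simp add: conj_part_def)
    qed
    ultimately show ?case by blast
  qed
  have vmeas: "v \<in> borel_measurable (lebesgue_on {0..T})"
  proof (rule borel_measurable_lebesgue_on_AE)
    show "AE t in lebesgue_on {0..T}. sqrt (- 4 * det (D t)) = v t"
      using vprop by eventually_elim simp
    have [measurable]: "(\<lambda>t. D t $ i $ j) \<in> borel_measurable (lebesgue_on {0..T})" for i j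
      using comp by (rule borel_measurable_integrable)
    show "(\<lambda>t. sqrt (- 4 * det (D t))) \<in> borel_measurable (lebesgue_on {0..T})"
      unfolding det_2 by measurable
  qed auto
  have v0: "AE t in lebesgue_on {0..T}. norm (v t) \<le> norm (2 * (\<bar>D t $ 1 $ 1\<bar> + \<bar>D t $ 2 $ 2\<bar> + \<bar>D t $ 1 $ 2\<bar> + \<bar>D t $ 2 $ 1\<bar>))"
    using vprop ae
  proof eventually_elim
    case (elim t)
    then have "v t \<ge> 0" using in_distr_parts[OF sl] by (metis norm_ge_zero v_def)
    with elim show ?case by simp
  qed
  have vint: "integrable (lebesgue_on {0..T}) v"
    by (rule Bochner_Integration.integrable_bound[OF _ vmeas v0])
      (intro integrable_mult_right Bochner_Integration.integrable_add integrable_abs comp)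
  have "f T - f 0 \<le> (LINT t|lebesgue_on {0..T}. v t)"
    unfolding fval[symmetric] by (rule integral_mono_AE[OF fint vint]) (use vprop in eventually_elim, auto)
  also have "\<dots> = sr_length T \<gamma>" by (simp add: sr_length_def v_def D_def)
  finally have len: "f T - f 0 \<le> sr_length T \<gamma>" .
  have 0: "0 \<in> {0..T}" "T \<in> {0..T}" using T by auto
  have b0: "b 0 = 0" and a0: "a 0 = 1" using start by (auto simp: a_def b_def)
  \<comment> \<open>The curve starts at the identity, so the increment of \<open>l\<close> is itself
    a logarithm of \<open>a T\<close>.\<close>
  have "a T = exp (l T - l 0)" using l(2)[OF 0(1)] l(2)[OF 0(2)] a0 by (simp add: exp_diff)
  then have "\<bar>Arg (a T)\<bar> \<le> \<bar>Im (l T - l 0)\<bar>" by (metis abs_Arg_exp_le)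
  then have "2 * c * \<bar>Arg (a T)\<bar> \<le> 2 * c * \<bar>Im (l T - l 0)\<bar>" using c by (simp add: mult_left_mono)
  also have "\<dots> = \<sigma> * (2 * c * Im (l T)) - \<sigma> * (2 * c * Im (l 0))"
    unfolding \<sigma>(1)[symmetric] by (simp add: algebra_simps)
  finally have "2 * c * \<bar>Arg (a T)\<bar> + (2 * R m - R T) \<le> f T - f 0"
    using m by (auto simp: f_def R_def b0)
  with len show ?thesis by (simp add: a_def b_def R_def)
qed

section \<open>The matrix exponential and the geodesics\<close>

text \<open>
  The entire functions \<open>cosh \<surd>x\<close> and \<open>sinh \<surd>x / \<surd>x\<close>: they treat elliptic, parabolic and hyperbolic
  elements uniformly.
\<close>

definition cosh_sqrt :: "real \<Rightarrow> real" where
  "cosh_sqrt x = (\<Sum>n. inverse (fact (2 * n)) * x ^ n)"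

definition sinhc_sqrt :: "real \<Rightarrow> real" where
  "sinhc_sqrt x = (\<Sum>n. inverse (fact (2 * n + 1)) * x ^ n)"

lemma sums_even_reindex: "(\<lambda>n. f (2 * n)) sums s \<longleftrightarrow> (\<lambda>n. if even n then f n else 0) sums s"
  for f :: "nat \<Rightarrow> 'a::real_normed_vector"
proof -
  have "(if even n then f n else 0) = 0" if "n \<notin> range (\<lambda>n. 2 * n)" for n
    using that by (auto elim!: evenE)
  then have "(\<lambda>n. (\<lambda>n. if even n then f n else 0) (2 * n)) sums s \<longleftrightarrow> (\<lambda>n. if even n then f n else 0) sums s"
    by (intro sums_mono_reindex) (auto simp: strict_mono_def)
  then show ?thesis by simp
qed

lemma sums_odd_reindex: "(\<lambda>n. f (2 * n + 1)) sums s \<longleftrightarrow> (\<lambda>n. if even n then 0 else f n) sums s"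
  for f :: "nat \<Rightarrow> 'a::real_normed_vector"
proof -
  have "(if even n then 0 else f n) = 0" if "n \<notin> range (\<lambda>n. 2 * n + 1)" for n
    using that by (auto elim!: oddE)
  then have "(\<lambda>n. (\<lambda>n. if even n then 0 else f n) (2 * n + 1)) sums s \<longleftrightarrow> (\<lambda>n. if even n then 0 else f n) sums s"
    by (intro sums_mono_reindex) (auto simp: strict_mono_def)
  then show ?thesis by simp
qed

lemma cosh_sqrt_sums_cases:
  fixes w :: real
  shows
  "(\<lambda>n. inverse (fact (2 * n)) * (w\<^sup>2) ^ n) sums cosh w"
  "(\<lambda>n. inverse (fact (2 * n)) * (- (w\<^sup>2)) ^ n) sums cos w"
proof -
  show "(\<lambda>n. inverse (fact (2 * n)) * (w\<^sup>2) ^ n) sums cosh w"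
    using cosh_converges[of w] sums_even_reindex[of "\<lambda>n. w ^ n /\<^sub>R fact n"]
    by (simp add: power_mult[symmetric])
  show "(\<lambda>n. inverse (fact (2 * n)) * (- (w\<^sup>2)) ^ n) sums cos w"
    using cos_paired[of w] by (simp add: power_minus[of "w\<^sup>2"] power_mult[symmetric] divide_inverse mult_ac)
qed

lemma sinhc_sqrt_sums_cases:
  fixes w :: real
  assumes "w \<noteq> 0"
  shows "(\<lambda>n. inverse (fact (2 * n + 1)) * (w\<^sup>2) ^ n) sums (sinh w / w)"
    "(\<lambda>n. inverse (fact (2 * n + 1)) * (- (w\<^sup>2)) ^ n) sums (sin w / w)"
proof -
  have "(\<lambda>n. w ^ (2 * n + 1) /\<^sub>R fact (2 * n + 1)) sums sinh w"
    using sinh_converges[of w] sums_odd_reindex[of "\<lambda>n. w ^ n /\<^sub>R fact n"] by simp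
  from sums_divide[OF this, of w]
  show "(\<lambda>n. inverse (fact (2 * n + 1)) * (w\<^sup>2) ^ n) sums (sinh w / w)"
    using assms by (simp add: power_mult[symmetric] mult_ac)
  have "(- 1) ^ n / fact (2 * n + 1) * w ^ (2 * n + 1) / w = inverse (fact (2 * n + 1)) * (- (w\<^sup>2)) ^ n" for n
    using assms by (simp add: power_minus[of "w\<^sup>2"] power_mult[symmetric] inverse_eq_divide)
  with sums_divide[OF sin_paired, of w w]
  show "(\<lambda>n. inverse (fact (2 * n + 1)) * (- (w\<^sup>2)) ^ n) sums (sin w / w)" by simp
qed

lemma cosh_sqrt_square: "cosh_sqrt (w\<^sup>2) = cosh w" and cosh_sqrt_minus_square: "cosh_sqrt (- (w\<^sup>2)) = cos w"
  unfolding cosh_sqrt_def using cosh_sqrt_sums_cases sums_unique by metis+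

lemma sinhc_sqrt_square: "w \<noteq> 0 \<Longrightarrow> sinhc_sqrt (w\<^sup>2) = sinh w / w"
  and sinhc_sqrt_minus_square: "w \<noteq> 0 \<Longrightarrow> sinhc_sqrt (- (w\<^sup>2)) = sin w / w"
  unfolding sinhc_sqrt_def using sinhc_sqrt_sums_cases sums_unique by metis+

text \<open>Splits statements about \<open>cosh_sqrt\<close> and \<open>sinhc_sqrt\<close> into the
  trivial, hyperbolic and trigonometric cases.\<close>

lemma real_square_cases:
  obtains "x = 0" | w :: real where "w > 0" "x = w\<^sup>2" | w where "w > 0" "x = - (w\<^sup>2)"
proof (cases x "0 :: real" rule: linorder_cases)
  case less
  then show ?thesis using that(3)[of "sqrt (- x)"] by simp
next
  case greater
  then show ?thesis using that(2)[of "sqrt x"] by simp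
qed (rule that(1))

lemma cosh_sqrt_summable: "summable (\<lambda>n. inverse (fact (2 * n)) * x ^ n)" for x :: real
proof (cases x rule: real_square_cases)
  case 1
  show ?thesis using 1 cosh_sqrt_sums_cases(1)[of 0] by (auto simp: sums_iff)
qed (use cosh_sqrt_sums_cases in \<open>auto simp: sums_iff\<close>)

lemma sinhc_sqrt_summable: "summable (\<lambda>n. inverse (fact (2 * n + 1)) * x ^ n)" for x :: real
proof (cases x rule: real_square_cases)
  case 1
  show ?thesis using powser_sums_zero[of "\<lambda>n. inverse (fact (2 * n + 1)) :: real"] 1
    by (auto simp: sums_iff)
qed (use sinhc_sqrt_sums_cases in \<open>fastforce simp: sums_iff\<close>)+

lemma cosh_sqrt_sums: "(\<lambda>n. inverse (fact (2 * n)) * x ^ n) sums cosh_sqrt x"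
  unfolding cosh_sqrt_def using cosh_sqrt_summable by (rule summable_sums)

lemma sinhc_sqrt_sums: "(\<lambda>n. inverse (fact (2 * n + 1)) * x ^ n) sums sinhc_sqrt x"
  unfolding sinhc_sqrt_def using sinhc_sqrt_summable by (rule summable_sums)

lemma isCont_cosh_sqrt: "isCont cosh_sqrt x" and isCont_sinhc_sqrt: "isCont sinhc_sqrt x"
  unfolding cosh_sqrt_def [abs_def] sinhc_sqrt_def [abs_def]
  using isCont_powser_converges_everywhere[OF cosh_sqrt_summable]
    isCont_powser_converges_everywhere[OF sinhc_sqrt_summable] by auto

lemma sinhc_sqrt_0 [simp]: "sinhc_sqrt 0 = 1"
  unfolding sinhc_sqrt_def by (rule sums_unique[symmetric])
    (use powser_sums_zero[of "\<lambda>n. inverse (fact (2 * n + 1)) :: real"] in simp)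

lemma cosh_sqrt_0 [simp]: "cosh_sqrt 0 = 1"
  using cosh_sqrt_square[of 0] by simp

text \<open>Even powers of \<open>X\<close> are scalar and odd powers are multiples of
  \<open>X\<close>, so the exponential series splits into two scalar series.\<close>

lemma mexp_of_square:
  assumes X: "X ** X = x *\<^sub>R mat 1"
  shows "mexp X = cosh_sqrt x *\<^sub>R mat 1 + sinhc_sqrt x *\<^sub>R X"
proof -
  have pow: "((**) X ^^ (2 * n)) (mat 1) = x ^ n *\<^sub>R mat 1" for n
  proof (induction n)
    case (Suc n)
    have "((**) X ^^ (2 * Suc n)) (mat 1) = X ** (X ** (((**) X ^^ (2 * n)) (mat 1)))" by simp
    also have "\<dots> = x ^ n *\<^sub>R (X ** X)"
      unfolding Suc.IH by (rule mat2_eqI) (simp_all add: lin_part_mult conj_part_mult algebra_simps)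
    also have "\<dots> = x ^ Suc n *\<^sub>R mat 1" unfolding X by simp
    finally show ?case .
  qed simp
  have pow1: "((**) X ^^ (2 * n + 1)) (mat 1) = x ^ n *\<^sub>R X" for n
    by (rule mat2_eqI) (simp_all add: pow lin_part_mult conj_part_mult)
  define f where "f = (\<lambda>n. (1 / fact n) *\<^sub>R (((**) X ^^ n) (mat 1)))"
  have "(\<lambda>n. f (2 * n)) sums (cosh_sqrt x *\<^sub>R mat 1)"
    using sums_scaleR_left[OF cosh_sqrt_sums, of x "mat 1"] by (simp add: f_def pow divide_inverse)
  then have e: "(\<lambda>n. if even n then f n else 0) sums (cosh_sqrt x *\<^sub>R mat 1)"
    by (simp add: sums_even_reindex)
  have "(\<lambda>n. f (2 * n + 1)) sums (sinhc_sqrt x *\<^sub>R X)"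
    using sums_scaleR_left[OF sinhc_sqrt_sums, of x X] unfolding f_def pow1 by (simp add: divide_inverse)
  then have o: "(\<lambda>n. if even n then 0 else f n) sums (sinhc_sqrt x *\<^sub>R X)"
    unfolding sums_odd_reindex .
  have "(\<lambda>n. (if even n then f n else 0) + (if even n then 0 else f n)) sums (cosh_sqrt x *\<^sub>R mat 1 + sinhc_sqrt x *\<^sub>R X)"
    using e o by (rule sums_add)
  also have "(\<lambda>n. (if even n then f n else 0) + (if even n then 0 else f n)) = f" by auto
  finally show ?thesis unfolding mexp_def f_def by (rule sums_unique[symmetric])
qed

section \<open>Geodesics in closed form\<close>

definition geo_cos :: "real \<Rightarrow> real \<Rightarrow> real" where
  "geo_cos c t = cosh_sqrt ((1 - c\<^sup>2) * t\<^sup>2 / 4)"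

definition geo_sin :: "real \<Rightarrow> real \<Rightarrow> real" where
  "geo_sin c t = t / 2 * sinhc_sqrt ((1 - c\<^sup>2) * t\<^sup>2 / 4)"

text \<open>For a geodesic the matrix \<open>X = t *\<^sub>R (cos \<theta> *\<^sub>R sl2_p1 + sin
  \<theta> *\<^sub>R sl2_p2 + c *\<^sub>R sl2_k)\<close> squares to
  \<open>(1 - c\<^sup>2) * t\<^sup>2 / 4\<close> times the identity. Then \<open>geo_z\<close> is
  the linear part of \<open>mexp X\<close>, and \<open>geo_sin\<close> is the signed modulus of its
  conjugate part.\<close>

definition geo_z :: "real \<Rightarrow> real \<Rightarrow> complex" where
  "geo_z c t = Complex (geo_cos c t) (c * geo_sin c t)"

lemma geo_elliptic:
  assumes "c\<^sup>2 = 1 + n\<^sup>2" "n \<noteq> 0"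
  shows "geo_cos c t = cos (n * t / 2)" "geo_sin c t = sin (n * t / 2) / n"
proof -
  have e: "(1 - c\<^sup>2) * t\<^sup>2 / 4 = - ((n * t / 2)\<^sup>2)" using assms by (simp add: power2_eq_square)
  show "geo_cos c t = cos (n * t / 2)" unfolding geo_cos_def e by (rule cosh_sqrt_minus_square)
  show "geo_sin c t = sin (n * t / 2) / n"
    using assms sinhc_sqrt_minus_square[of "n * t / 2"] unfolding geo_sin_def e by (cases "t = 0") auto
qed

lemma geo_hyperbolic:
  assumes "c\<^sup>2 = 1 - m\<^sup>2" "m \<noteq> 0"
  shows "geo_cos c t = cosh (m * t / 2)" "geo_sin c t = sinh (m * t / 2) / m"
proof -
  have e: "(1 - c\<^sup>2) * t\<^sup>2 / 4 = (m * t / 2)\<^sup>2" using assms by (simp add: power2_eq_square)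
  show "geo_cos c t = cosh (m * t / 2)" unfolding geo_cos_def e by (rule cosh_sqrt_square)
  show "geo_sin c t = sinh (m * t / 2) / m"
    using assms sinhc_sqrt_square[of "m * t / 2"] unfolding geo_sin_def e by (cases "t = 0") auto
qed

lemma geo_parabolic:
  assumes "c\<^sup>2 = 1"
  shows "geo_cos c t = 1" "geo_sin c t = t / 2"
  using assms by (simp_all add: geo_cos_def geo_sin_def)

lemma curvature_cases:
  obtains "c\<^sup>2 = 1" | n :: real where "n > 0" "c\<^sup>2 = 1 + n\<^sup>2" | m :: real where "m > 0" "c\<^sup>2 = 1 - m\<^sup>2"
  using that by (cases "c\<^sup>2 - 1" rule: real_square_cases) (auto simp: algebra_simps)

text \<open>This is the condition that the exponential has determinant 1, verified in each curvature
  case.\<close>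

lemma geo_pythagoras: "(geo_cos c t)\<^sup>2 + (c\<^sup>2 - 1) * (geo_sin c t)\<^sup>2 = 1"
proof (cases c rule: curvature_cases)
  case 1
  then show ?thesis by (simp add: geo_parabolic)
next
  case (2 n)
  then show ?thesis by (simp add: geo_elliptic[of c n] power_divide)
next
  case (3 m)
  then show ?thesis by (simp add: geo_hyperbolic[of c m] power_divide cosh_square_eq)
qed

lemma DERIV_geo_cos: "(geo_cos c has_real_derivative (1 - c\<^sup>2) / 2 * geo_sin c t) (at t)"
  and DERIV_geo_sin: "(geo_sin c has_real_derivative geo_cos c t / 2) (at t)"
proof -
  have "(geo_cos c has_real_derivative (1 - c\<^sup>2) / 2 * geo_sin c t) (at t) \<and>
    (geo_sin c has_real_derivative geo_cos c t / 2) (at t)"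
  proof (cases c rule: curvature_cases)
    case 1
    then have e: "geo_cos c = (\<lambda>t. 1)" "geo_sin c = (\<lambda>t. t / 2)"
      by (auto simp: geo_parabolic)
    show ?thesis unfolding e using 1 by (auto intro!: derivative_eq_intros)
  next
    case (2 n)
    have e: "geo_cos c = (\<lambda>t. cos (n * t / 2))" "geo_sin c = (\<lambda>t. sin (n * t / 2) / n)"
      using 2 by (auto simp: geo_elliptic[of c n])
    have k: "1 - c\<^sup>2 = - (n\<^sup>2)" using 2 by simp
    show ?thesis unfolding e k using 2(1)
      by (auto intro!: derivative_eq_intros simp: field_simps power2_eq_square)
  next
    case (3 m)
    have e: "geo_cos c = (\<lambda>t. cosh (m * t / 2))" "geo_sin c = (\<lambda>t. sinh (m * t / 2) / m)"
      using 3 by (auto simp: geo_hyperbolic[of c m])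
    have k: "1 - c\<^sup>2 = m\<^sup>2" using 3 by simp
    show ?thesis unfolding e k using 3(1)
      by (auto intro!: derivative_eq_intros simp: field_simps power2_eq_square)
  qed
  then show "(geo_cos c has_real_derivative (1 - c\<^sup>2) / 2 * geo_sin c t) (at t)"
    "(geo_sin c has_real_derivative geo_cos c t / 2) (at t)" by auto
qed

lemma geo_0 [simp]: "geo_cos c 0 = 1" "geo_sin c 0 = 0" "geo_z c 0 = 1"
  by (auto simp: geo_cos_def geo_sin_def geo_z_def complex_eq_iff)

text \<open>By Cayley-Hamilton a trace-free matrix squares to minus its determinant, which is
  \<open>x\<close> here.\<close>

lemma mexp_sl2:
  assumes "Re (lin_part X) = 0"
  defines "x \<equiv> (cmod (conj_part X))\<^sup>2 - (Im (lin_part X))\<^sup>2"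
  shows "lin_part (mexp X) = of_real (cosh_sqrt x) + of_real (sinhc_sqrt x) * lin_part X"
    "conj_part (mexp X) = of_real (sinhc_sqrt x) * conj_part X"
proof -
  have "X ** X = x *\<^sub>R mat 1"
  proof (rule mat2_eqI)
    show "lin_part (X ** X) = lin_part (x *\<^sub>R mat 1)"
      unfolding lin_part_mult x_def using assms(1) cmod_power2[of "conj_part X"]
      by (simp add: complex_eq_iff power2_eq_square)
    show "conj_part (X ** X) = conj_part (x *\<^sub>R mat 1)"
      unfolding conj_part_mult using assms(1) by (simp add: complex_eq_iff)
  qed
  from mexp_of_square[OF this]
  show "lin_part (mexp X) = of_real (cosh_sqrt x) + of_real (sinhc_sqrt x) * lin_part X"
    "conj_part (mexp X) = of_real (sinhc_sqrt x) * conj_part X" by simp_all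
qed

lemma mexp_k: "lin_part (mexp (r *\<^sub>R sl2_k)) = cis (r / 2)" "conj_part (mexp (r *\<^sub>R sl2_k)) = 0"
proof -
  have e: "(cmod (conj_part (r *\<^sub>R sl2_k)))\<^sup>2 - (Im (lin_part (r *\<^sub>R sl2_k)))\<^sup>2 = - ((r / 2)\<^sup>2)"
    by simp
  have "lin_part (mexp (r *\<^sub>R sl2_k)) = of_real (cos (r / 2)) + of_real (sinhc_sqrt (- ((r / 2)\<^sup>2))) * (of_real r * (\<i> / 2))"
    using mexp_sl2(1)[of "r *\<^sub>R sl2_k"] unfolding e cosh_sqrt_minus_square by simp
  then show "lin_part (mexp (r *\<^sub>R sl2_k)) = cis (r / 2)"
    using sinhc_sqrt_minus_square[of "r / 2"] by (cases "r = 0") (auto simp: complex_eq_iff)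
  show "conj_part (mexp (r *\<^sub>R sl2_k)) = 0"
    using mexp_sl2(2)[of "r *\<^sub>R sl2_k"] by simp
qed

text \<open>The right factor is a rotation; it multiplies the linear part by
  \<open>cis (- (c * t / 2))\<close> and the conjugate part by the conjugate of this number.\<close>

lemma sr_Exp_parts:
  "lin_part (sr_Exp \<theta> c t) = geo_z c t * cis (- (c * t / 2))"
  "conj_part (sr_Exp \<theta> c t) = of_real (geo_sin c t) * cis (\<theta> + c * t / 2)"
proof -
  define X where "X = t *\<^sub>R (cos \<theta> *\<^sub>R sl2_p1 + sin \<theta> *\<^sub>R sl2_p2 + c *\<^sub>R sl2_k)"
  have X: "lin_part X = of_real (c * t / 2) * \<i>" "conj_part X = of_real (t / 2) * cis \<theta>"
    by (auto simp: X_def complex_eq_iff)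
  have e: "(cmod (conj_part X))\<^sup>2 - (Im (lin_part X))\<^sup>2 = (1 - c\<^sup>2) * t\<^sup>2 / 4"
    unfolding X by (simp add: norm_mult power2_eq_square field_simps)
  have l: "lin_part (mexp X) = geo_z c t" "conj_part (mexp X) = of_real (geo_sin c t) * cis \<theta>"
    using mexp_sl2[of X] unfolding e
    by (auto simp: X geo_z_def geo_cos_def geo_sin_def complex_eq_iff)
  show "lin_part (sr_Exp \<theta> c t) = geo_z c t * cis (- (c * t / 2))"
    "conj_part (sr_Exp \<theta> c t) = of_real (geo_sin c t) * cis (\<theta> + c * t / 2)"
    unfolding sr_Exp_def X_def[symmetric] lin_part_mult conj_part_mult mexp_k l
    by (simp_all add: cis_cnj cis_mult mult.assoc)
qed

section \<open>Geodesics as horizontal curves of unit speed\<close>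

definition mat_of_parts :: "complex \<Rightarrow> complex \<Rightarrow> real^2^2" where
  "mat_of_parts a b = Re a *\<^sub>R mat 1 + Im a *\<^sub>R (2 *\<^sub>R sl2_k) + Re b *\<^sub>R (2 *\<^sub>R sl2_p1) + Im b *\<^sub>R (2 *\<^sub>R sl2_p2)"

lemma parts_mat_of_parts [simp]: "lin_part (mat_of_parts a b) = a" "conj_part (mat_of_parts a b) = b"
  by (simp_all add: mat_of_parts_def complex_eq_iff)

lemma has_vector_derivative_mat_of_parts:
  assumes "(a has_vector_derivative a') F" "(b has_vector_derivative b') F"
  shows "((\<lambda>t. mat_of_parts (a t) (b t)) has_vector_derivative mat_of_parts a' b') F"
proof -
  have *: "((\<lambda>t. f (h t) *\<^sub>R M) has_vector_derivative f h' *\<^sub>R M) F"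
    if "bounded_linear f" "(h has_vector_derivative h') F"
    for f :: "complex \<Rightarrow> real" and h h' and M :: "real^2^2"
    using bounded_linear.has_vector_derivative[OF bounded_linear_compose[OF bounded_linear_scaleR_left[of M] that(1)] that(2)]
    by simp
  show ?thesis unfolding mat_of_parts_def
    by (intro has_vector_derivative_add * bounded_linear_Re bounded_linear_Im assms)
qed

lemma sr_Exp_SL2: "sr_Exp \<theta> c t \<in> SL2"
proof -
  have "(cmod (geo_z c t))\<^sup>2 = 1 + (geo_sin c t)\<^sup>2"
    using geo_pythagoras[of c t] by (simp add: geo_z_def cmod_power2 algebra_simps)
  then show ?thesis by (simp add: SL2_parts sr_Exp_parts norm_mult power_mult_distrib)
qed

lemma has_vector_derivative_cis:
  assumes "(f has_real_derivative f') (at t within X)"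
  shows "((\<lambda>t. cis (f t)) has_vector_derivative of_real f' * \<i> * cis (f t)) (at t within X)"
  using assms unfolding has_vector_derivative_complex_iff
  by (auto intro!: derivative_eq_intros)

text \<open>The control of the geodesic is \<open>cis (\<theta> + c * t)\<close>: it has modulus 1
  and rotates with angular velocity \<open>c\<close>.\<close>

lemma sr_Exp_has_vector_derivative:
  "((sr_Exp \<theta> c) has_vector_derivative
     sr_Exp \<theta> c t ** mat_of_parts 0 (cis (\<theta> + c * t) / 2)) (at t)"
proof -
  define a where "a = (\<lambda>t. geo_z c t * cis (- (c * t / 2)))"
  define b where "b = (\<lambda>t. complex_of_real (geo_sin c t) * cis (\<theta> + c * t / 2))"
  have E: "sr_Exp \<theta> c = (\<lambda>t. mat_of_parts (a t) (b t))"
    by (rule ext, rule mat2_eqI) (simp_all add: sr_Exp_parts a_def b_def)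
  have z: "(geo_z c has_vector_derivative Complex ((1 - c\<^sup>2) / 2 * geo_sin c t) (c * geo_cos c t / 2)) (at t)"
    unfolding geo_z_def [abs_def] has_vector_derivative_complex_iff
    using DERIV_geo_cos[of c t] DERIV_cmult[OF DERIV_geo_sin[of c t], of c] by simp
  have s: "((\<lambda>t. complex_of_real (geo_sin c t)) has_vector_derivative complex_of_real (geo_cos c t / 2)) (at t)"
    unfolding has_vector_derivative_complex_iff using DERIV_geo_sin[of c t] by simp
  have c1: "((\<lambda>t. cis (- (c * t / 2))) has_vector_derivative of_real (- c / 2) * \<i> * cis (- (c * t / 2))) (at t)"
    by (rule has_vector_derivative_cis) (auto intro!: derivative_eq_intros)
  have c2: "((\<lambda>t. cis (\<theta> + c * t / 2)) has_vector_derivative of_real (c / 2) * \<i> * cis (\<theta> + c * t / 2)) (at t)"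
    by (rule has_vector_derivative_cis) (auto intro!: derivative_eq_intros)
  define u where "u = cis (\<theta> + c * t)"
  have u1: "cis (\<theta> + c * t / 2) * cnj u = cis (- (c * t / 2))"
    by (simp add: u_def cis_cnj cis_mult)
  have u2: "cis (- (c * t / 2)) * u = cis (\<theta> + c * t / 2)"
    by (simp add: u_def cis_mult algebra_simps)
  have "(a has_vector_derivative b t * cnj u / 2) (at t)"
  proof -
    have "(a has_vector_derivative geo_z c t * (of_real (- c / 2) * \<i> * cis (- (c * t / 2)))
        + Complex ((1 - c\<^sup>2) / 2 * geo_sin c t) (c * geo_cos c t / 2) * cis (- (c * t / 2))) (at t)"
      unfolding a_def by (rule has_vector_derivative_mult[OF z c1])
    also have "geo_z c t * (of_real (- c / 2) * \<i> * cis (- (c * t / 2)))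
        + Complex ((1 - c\<^sup>2) / 2 * geo_sin c t) (c * geo_cos c t / 2) * cis (- (c * t / 2))
      = (geo_z c t * (of_real (- c / 2) * \<i>) + Complex ((1 - c\<^sup>2) / 2 * geo_sin c t) (c * geo_cos c t / 2)) * cis (- (c * t / 2))"
      by (simp add: algebra_simps)
    also have "geo_z c t * (of_real (- c / 2) * \<i>) + Complex ((1 - c\<^sup>2) / 2 * geo_sin c t) (c * geo_cos c t / 2) = of_real (geo_sin c t) / 2"
      by (simp add: complex_eq_iff geo_z_def field_simps power2_eq_square)
    also have "of_real (geo_sin c t) / 2 * cis (- (c * t / 2)) = b t * cnj u / 2"
      unfolding b_def u1[symmetric] by simp
    finally show ?thesis .
  qed
  moreover have "(b has_vector_derivative a t * u / 2) (at t)"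
  proof -
    have "(b has_vector_derivative of_real (geo_sin c t) * (of_real (c / 2) * \<i> * cis (\<theta> + c * t / 2))
       + of_real (geo_cos c t / 2) * cis (\<theta> + c * t / 2)) (at t)"
      unfolding b_def by (rule has_vector_derivative_mult[OF s c2])
    also have "of_real (geo_sin c t) * (of_real (c / 2) * \<i> * cis (\<theta> + c * t / 2))
       + of_real (geo_cos c t / 2) * cis (\<theta> + c * t / 2)
      = (of_real (geo_sin c t) * (of_real (c / 2) * \<i>) + of_real (geo_cos c t / 2)) * cis (\<theta> + c * t / 2)"
      by (simp add: algebra_simps)
    also have "of_real (geo_sin c t) * (of_real (c / 2) * \<i>) + of_real (geo_cos c t / 2) = geo_z c t / 2"
      by (simp add: complex_eq_iff geo_z_def field_simps)
    also have "geo_z c t / 2 * cis (\<theta> + c * t / 2) = a t * u / 2"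
      unfolding a_def u2[symmetric] by simp
    finally show ?thesis .
  qed
  ultimately have "((\<lambda>t. mat_of_parts (a t) (b t)) has_vector_derivative
      mat_of_parts (b t * cnj u / 2) (a t * u / 2)) (at t)"
    by (rule has_vector_derivative_mat_of_parts)
  also have "mat_of_parts (b t * cnj u / 2) (a t * u / 2) = sr_Exp \<theta> c t ** mat_of_parts 0 (u / 2)"
    by (rule mat2_eqI) (simp_all add: lin_part_mult conj_part_mult E)
  finally show ?thesis unfolding E u_def .
qed

lemma
  assumes T: "0 \<le> T"
  shows sr_Exp_horizontal: "horizontal T (sr_Exp \<theta> c)"
    and sr_Exp_length: "sr_length T (sr_Exp \<theta> c) = T"
proof -
  define D where "D = (\<lambda>t. sr_Exp \<theta> c t ** mat_of_parts 0 (cis (\<theta> + c * t) / 2))"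
  have der: "((sr_Exp \<theta> c) has_vector_derivative D t) (at t within X)" for t X
    unfolding D_def by (rule has_vector_derivative_at_within[OF sr_Exp_has_vector_derivative])
  have lin: "lin_part (D t) = conj_part (sr_Exp \<theta> c t) * cnj (cis (\<theta> + c * t)) / 2"
    and con: "conj_part (D t) = lin_part (sr_Exp \<theta> c t) * cis (\<theta> + c * t) / 2" for t
    by (simp_all add: D_def lin_part_mult conj_part_mult)
  have "continuous_on {0..T} (sr_Exp \<theta> c)"
    by (meson continuous_on_eq_continuous_within der has_vector_derivative_continuous)
  then have cont: "continuous_on {0..T} (\<lambda>t. lin_part (sr_Exp \<theta> c t))"
    "continuous_on {0..T} (\<lambda>t. conj_part (sr_Exp \<theta> c t))"
    by (intro bounded_linear.continuous_on[OF bounded_linear_lin_part]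
        bounded_linear.continuous_on[OF bounded_linear_conj_part]; assumption)+
  have Dm: "D = (\<lambda>t. mat_of_parts (conj_part (sr_Exp \<theta> c t) * cnj (cis (\<theta> + c * t)) / 2)
      (lin_part (sr_Exp \<theta> c t) * cis (\<theta> + c * t) / 2))"
    by (rule ext, rule mat2_eqI) (simp_all add: lin con)
  have "continuous_on {0..T} D"
    unfolding Dm mat_of_parts_def by (intro continuous_intros cont) auto
  then have "compact (D ` {0..T})" by (intro compact_continuous_image) auto
  then obtain M where M: "\<And>t. t \<in> {0..T} \<Longrightarrow> norm (D t) \<le> M"
    by (metis compact_imp_bounded bounded_iff image_eqI)
  have "norm (D 0) \<le> M" using M T by simp
  then have M0: "0 \<le> M" by (rule order_trans[OF norm_ge_zero])
  have "M-lipschitz_on {0..T} (sr_Exp \<theta> c)"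
  proof (rule bounded_derivative_imp_lipschitz)
    show "(sr_Exp \<theta> c has_derivative (\<lambda>h. h *\<^sub>R D t)) (at t within {0..T})" for t
      using der[of t] by (simp add: has_vector_derivative_def)
    show "onorm (\<lambda>h. h *\<^sub>R D t) \<le> M" if "t \<in> {0..T}" for t
    proof (rule onorm_bound[OF M0])
      fix x :: real
      show "norm (x *\<^sub>R D t) \<le> M * norm x"
        using mult_right_mono[OF M[OF that] norm_ge_zero[of x]] by (simp add: mult.commute)
    qed
  qed (use M0 in auto)
  moreover have ae: "AE t in lebesgue_on {0..T}. t \<in> {0..T} \<and> vector_derivative (sr_Exp \<theta> c) (at t within {0..T}) = D t"
  proof -
    have "AE t in lebesgue_on {0..T}. t \<in> {0..T}" by (rule AE_I2) auto
    \<comment> \<open>Discarding the point 0 also settles \<open>T = 0\<close>, where the derivative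
      within a single point is not determined.\<close>
    moreover have "AE t in lebesgue_on {0..T}. t \<noteq> 0"
      by (rule AE_I'[of "{0}"]) (use T in \<open>auto simp: null_sets_restrict_space\<close>)
    ultimately show ?thesis
    proof eventually_elim
      case (elim t)
      then have "0 < T" by auto
      then show ?case
        using elim vector_derivative_within_cbox[of 0 T t, OF _ _ der] by simp
    qed
  qed
  moreover have dis: "D t \<in> distr (sr_Exp \<theta> c t)" for t
    unfolding distr_def D_def by (intro imageI) (simp add: p_space_iff)
  moreover have "sr_Exp \<theta> c differentiable (at t within {0..T})" for t
    using der by (rule differentiableI_vector)
  ultimately show "horizontal T (sr_Exp \<theta> c)"
    unfolding horizontal_def using T sr_Exp_SL2 by (auto elim: eventually_mono)
  have speed: "sqrt (sr_metric (sr_Exp \<theta> c t) (D t) (D t)) = 1" for t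
  proof -
    have "matrix_inv (sr_Exp \<theta> c t) ** D t = mat_of_parts 0 (cis (\<theta> + c * t) / 2)"
      unfolding D_def by (rule SL2_matrix_inv[OF sr_Exp_SL2])
    then show ?thesis by (simp add: sr_metric_def p_inner_self norm_divide)
  qed
  have "sr_length T (sr_Exp \<theta> c) = (LINT t|lebesgue_on {0..T}. 1)"
    unfolding sr_length_def
  proof (rule integral_cong_AE)
    let ?v = "\<lambda>t. sqrt (sr_metric (sr_Exp \<theta> c t)
       (vector_derivative (sr_Exp \<theta> c) (at t within {0..T})) (vector_derivative (sr_Exp \<theta> c) (at t within {0..T})))"
    show 1: "AE t in lebesgue_on {0..T}. ?v t = 1"
      using ae by eventually_elim (simp only: speed)
    show "(\<lambda>t. 1 :: real) \<in> borel_measurable (lebesgue_on {0..T})" by simp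
    then show "?v \<in> borel_measurable (lebesgue_on {0..T})"
    proof (rule borel_measurable_lebesgue_on_AE[rotated])
      show "AE t in lebesgue_on {0..T}. 1 = ?v t" using 1 by eventually_elim (rule sym)
    qed simp
  qed
  then show "sr_length T (sr_Exp \<theta> c) = T" using T by (simp add: measure_restrict_space)
qed

section \<open>Radius and angle along one period of a geodesic\<close>

text \<open>The argument of \<open>lin_part (sr_Exp \<theta> c t)\<close>, up to sign, followed continuously from \<open>t = 0\<close> over one period.\<close>

definition geo_angle :: "real \<Rightarrow> real \<Rightarrow> real" where
  "geo_angle c t = c * t / 2 - Arg (geo_z c t)"

lemma geo_angle_0 [simp]: "geo_angle c 0 = 0"
  by (simp add: geo_angle_def)

lemma cmod_geo_z: "(cmod (geo_z c t))\<^sup>2 = 1 + (geo_sin c t)\<^sup>2"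
  using geo_pythagoras[of c t] by (simp add: geo_z_def cmod_power2 algebra_simps)

text \<open>The bound on \<open>(c\<^sup>2 - 1) * t\<^sup>2\<close> says that \<open>t\<close> lies
  before the period \<open>2 * pi / sqrt (c\<^sup>2 - 1)\<close> if \<open>c\<^sup>2 > 1\<close>,
  and it holds automatically if \<open>c\<^sup>2 \<le> 1\<close>. With \<open>pi\<^sup>2\<close> on
  the right it refers to half a period.\<close>

lemma geo_sin_pos:
  assumes t: "0 < t" and pre: "(c\<^sup>2 - 1) * t\<^sup>2 < (2 * pi)\<^sup>2"
  shows "0 < geo_sin c t"
proof (cases c rule: curvature_cases)
  case (2 n)
  then have "(n * t)\<^sup>2 < (2 * pi)\<^sup>2" using pre by (simp add: power_mult_distrib)
  then have "n * t < 2 * pi" by (rule power2_less_imp_less) simp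
  then show ?thesis using 2 t by (simp add: geo_elliptic[of c n] sin_gt_zero)
qed (use t in \<open>auto simp: geo_parabolic geo_hyperbolic\<close>)

lemma geo_cos_nonneg:
  assumes t: "0 \<le> t" and pre: "(c\<^sup>2 - 1) * t\<^sup>2 \<le> pi\<^sup>2"
  shows "0 \<le> geo_cos c t"
proof (cases c rule: curvature_cases)
  case (2 n)
  then have "(n * t)\<^sup>2 \<le> pi\<^sup>2" using pre by (simp add: power_mult_distrib)
  then have "n * t \<le> pi" by (rule power2_le_imp_le) simp
  moreover have "0 \<le> n * t" using 2 t by simp
  ultimately show ?thesis using 2 by (simp add: geo_elliptic[of c n] cos_ge_zero)
qed (auto simp: geo_parabolic geo_hyperbolic)

text \<open>The imaginary part \<open>c * geo_sin c t\<close> is positive inside the period, unless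
  \<open>t\<close> or \<open>c\<close> is 0 and the real part is positive. So the principal argument
  does not jump before the period ends.\<close>

lemma geo_z_not_nonpos:
  assumes t: "0 \<le> t" and c: "0 \<le> c" and pre: "(c\<^sup>2 - 1) * t\<^sup>2 < (2 * pi)\<^sup>2"
  shows "geo_z c t \<notin> \<real>\<^sub>\<le>\<^sub>0"
proof (cases "t = 0 \<or> c = 0")
  case True
  then have "geo_cos c t > 0" by (auto simp: geo_hyperbolic[of 0 1])
  then show ?thesis by (auto simp: geo_z_def complex_nonpos_Reals_iff)
next
  case False
  then have "c * geo_sin c t > 0" using geo_sin_pos[OF _ pre] t c by simp
  then show ?thesis by (auto simp: geo_z_def complex_nonpos_Reals_iff)
qed

text \<open>The argument of \<open>geo_z\<close> has derivative
  \<open>Im (z' * cnj z) / (cmod z)\<^sup>2\<close>, whose numerator is the constant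
  \<open>c / 2\<close> by \<open>geo_pythagoras\<close>.\<close>

lemma DERIV_geo_angle:
  assumes t: "0 \<le> t" and c: "0 \<le> c" and pre: "(c\<^sup>2 - 1) * t\<^sup>2 < (2 * pi)\<^sup>2"
  shows "(geo_angle c has_real_derivative c * (geo_sin c t)\<^sup>2 / (2 * (1 + (geo_sin c t)\<^sup>2))) (at t)"
proof -
  define z' where "z' = Complex ((1 - c\<^sup>2) / 2 * geo_sin c t) (c * geo_cos c t / 2)"
  have nz: "geo_z c t \<notin> \<real>\<^sub>\<le>\<^sub>0" by (rule geo_z_not_nonpos[OF assms])
  have z: "(geo_z c has_vector_derivative z') (at t)"
    unfolding z'_def geo_z_def [abs_def] has_vector_derivative_complex_iff
    using DERIV_geo_cos[of c t] DERIV_cmult[OF DERIV_geo_sin[of c t], of c] by simp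
  have "((Ln \<circ> geo_z c) has_vector_derivative z' * inverse (geo_z c t)) (at t)"
    by (rule field_vector_diff_chain_at[OF z has_field_derivative_Ln[OF nz]])
  then have "((\<lambda>t. Im (Ln (geo_z c t))) has_real_derivative Im (z' * inverse (geo_z c t))) (at t)"
    unfolding has_real_derivative_iff_has_vector_derivative o_def
    by (rule bounded_linear.has_vector_derivative[OF bounded_linear_Im])
  moreover have "Im (z' * inverse (geo_z c t)) = c / (2 * (1 + (geo_sin c t)\<^sup>2))"
  proof -
    have "Im (z' * inverse (geo_z c t)) = Im (z' * cnj (geo_z c t)) / (cmod (geo_z c t))\<^sup>2"
      by (simp add: divide_complex_def[symmetric] Im_divide cmod_power2)
    also have "Im (z' * cnj (geo_z c t)) = c / 2 * ((geo_cos c t)\<^sup>2 + (c\<^sup>2 - 1) * (geo_sin c t)\<^sup>2)"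
      by (simp add: z'_def geo_z_def power2_eq_square field_simps)
    finally show ?thesis unfolding geo_pythagoras cmod_geo_z by simp
  qed
  ultimately have "((\<lambda>t. Im (Ln (geo_z c t))) has_real_derivative c / (2 * (1 + (geo_sin c t)\<^sup>2))) (at t)"
    by simp
  from DERIV_diff[OF DERIV_cmult_Id this, of "c / 2"]
  have *: "((\<lambda>t. c / 2 * t - Im (Ln (geo_z c t))) has_real_derivative c / 2 - c / (2 * (1 + (geo_sin c t)\<^sup>2))) (at t)" .
  have "geo_angle c = (\<lambda>t. c / 2 * t - Im (Ln (geo_z c t)))"
  proof
    fix t
    have "geo_z c t \<noteq> 0" using cmod_geo_z[of c t]
      by (metis add_pos_nonneg less_irrefl norm_zero zero_le_power2 zero_less_one zero_power2)
    then show "geo_angle c t = c / 2 * t - Im (Ln (geo_z c t))" by (simp add: geo_angle_def Arg_eq_Im_Ln)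
  qed
  moreover have "c / 2 - c / (2 * (1 + (geo_sin c t)\<^sup>2)) = c * (geo_sin c t)\<^sup>2 / (2 * (1 + (geo_sin c t)\<^sup>2))"
  proof -
    have "c / 2 - c / (2 * P) = c * (P - 1) / (2 * P)" if "P > 0" for P :: real
      using that by (simp add: field_simps)
    from this[of "1 + (geo_sin c t)\<^sup>2"] show ?thesis by (simp add: add_pos_nonneg)
  qed
  ultimately show ?thesis using * by simp
qed

text \<open>The time derivative of the left side is the scalar product of
  \<open>(sqrt (1 - (c\<^sup>2 - 1) * s\<^sup>2), c * s)\<close> and
  \<open>(geo_cos e x, e * s)\<close>, divided by \<open>1 + s\<^sup>2\<close>, where
  \<open>s = geo_sin e x\<close>. Both vectors have squared norm \<open>1 + s\<^sup>2\<close>, so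
  the derivative is at most 1. In the first half of the period \<open>geo_cos\<close> is
  nonnegative; hence for \<open>c = e\<close> the vectors coincide and the derivative is 1.\<close>

lemma
  assumes t: "0 \<le> t" and e: "0 \<le> e" and pre: "(e\<^sup>2 - 1) * t\<^sup>2 \<le> pi\<^sup>2"
  shows radial_geo_le: "(c\<^sup>2 - 1) * (geo_sin e t)\<^sup>2 \<le> 1 \<Longrightarrow> radial c (geo_sin e t) + 2 * c * geo_angle e t \<le> t"
    and radial_geo_eq: "radial e (geo_sin e t) + 2 * e * geo_angle e t = t"
proof -
  have pre': "(e\<^sup>2 - 1) * x\<^sup>2 \<le> pi\<^sup>2" if "x \<in> {0..t}" for x
  proof (cases "e\<^sup>2 \<le> 1")
    case True
    then have "(e\<^sup>2 - 1) * x\<^sup>2 \<le> 0" by (intro mult_nonpos_nonneg) auto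
    then show ?thesis by (meson order_trans zero_le_power2)
  next
    case False
    then have "(e\<^sup>2 - 1) * x\<^sup>2 \<le> (e\<^sup>2 - 1) * t\<^sup>2" using that by (intro mult_left_mono power_mono) auto
    then show ?thesis using pre by linarith
  qed
  have pre2: "(e\<^sup>2 - 1) * x\<^sup>2 < (2 * pi)\<^sup>2" if "x \<in> {0..t}" for x
  proof -
    have "pi\<^sup>2 < (2 * pi)\<^sup>2" using pi_gt_zero by (intro power_strict_mono) auto
    then show ?thesis using pre'[OF that] by linarith
  qed
  have pos: "0 \<le> geo_sin e x" "0 \<le> geo_cos e x" if "x \<in> {0..t}" for x
  proof -
    show "0 \<le> geo_sin e x" using geo_sin_pos[of x e] pre2[OF that] that by (cases "x = 0") auto
    show "0 \<le> geo_cos e x" using geo_cos_nonneg[of x e] pre'[OF that] that by auto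
  qed
  define g where "g = (\<lambda>c x. radial c (geo_sin e x) + 2 * c * geo_angle e x - x)"
  have gder: "(g c has_real_derivative
      (sqrt (1 - (c\<^sup>2 - 1) * (geo_sin e x)\<^sup>2) * geo_cos e x + (c * geo_sin e x) * (e * geo_sin e x)) / (1 + (geo_sin e x)\<^sup>2) - 1) (at x)"
    if x: "x \<in> {0..t}" for c x
  proof -
    have "((\<lambda>x. radial c (geo_sin e x)) has_real_derivative radial_slope c (geo_sin e x) * (geo_cos e x / 2)) (at x)"
      by (rule DERIV_chain2[OF DERIV_radial DERIV_geo_sin]) (rule pos(1)[OF x])
    moreover have "(geo_angle e has_real_derivative e * (geo_sin e x)\<^sup>2 / (2 * (1 + (geo_sin e x)\<^sup>2))) (at x)"
      by (rule DERIV_geo_angle) (use x e pre2[OF x] in auto)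
    ultimately have 1: "(g c has_real_derivative radial_slope c (geo_sin e x) * (geo_cos e x / 2)
        + 2 * c * (e * (geo_sin e x)\<^sup>2 / (2 * (1 + (geo_sin e x)\<^sup>2))) - 1) (at x)"
      unfolding g_def by (intro DERIV_diff DERIV_add DERIV_cmult DERIV_ident)
    have "2 * a / P * (b / 2) + 2 * c * (e * d / (2 * P)) - 1 = (a * b + c * (e * d)) / P - 1"
      if "P > 0" for a b d P :: real using that by (simp add: add_divide_distrib)
    from this[of "1 + (geo_sin e x)\<^sup>2" "sqrt (1 - (c\<^sup>2 - 1) * (geo_sin e x)\<^sup>2)" "geo_cos e x" "(geo_sin e x)\<^sup>2"]
    have "radial_slope c (geo_sin e x) * (geo_cos e x / 2)
        + 2 * c * (e * (geo_sin e x)\<^sup>2 / (2 * (1 + (geo_sin e x)\<^sup>2))) - 1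
      = (sqrt (1 - (c\<^sup>2 - 1) * (geo_sin e x)\<^sup>2) * geo_cos e x + c * (e * (geo_sin e x)\<^sup>2)) / (1 + (geo_sin e x)\<^sup>2) - 1"
      unfolding radial_slope_def using add_pos_nonneg[OF zero_less_one zero_le_power2[of "geo_sin e x"]] by blast
    also have "c * (e * (geo_sin e x)\<^sup>2) = (c * geo_sin e x) * (e * geo_sin e x)"
      by (simp add: power2_eq_square)
    finally show ?thesis using 1 by simp
  qed
  have g0: "g c 0 = 0" for c by (simp add: g_def)
  have mono: "geo_sin e x \<le> geo_sin e t" if "x \<in> {0..t}" for x
  proof (rule DERIV_nonneg_imp_nondecreasing[where f = "geo_sin e"])
    fix y assume "x \<le> y" "y \<le> t"
    then show "\<exists>d. (geo_sin e has_real_derivative d) (at y) \<and> 0 \<le> d"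
      using DERIV_geo_sin[of e y] pos(2)[of y] that by (intro exI[of _ "geo_cos e y / 2"]) auto
  qed (use that in auto)
  show "radial c (geo_sin e t) + 2 * c * geo_angle e t \<le> t" if c: "(c\<^sup>2 - 1) * (geo_sin e t)\<^sup>2 \<le> 1"
  proof -
    have "g c t \<le> g c 0"
    proof (rule DERIV_nonpos_imp_nonincreasing[OF t])
      fix x assume "0 \<le> x" "x \<le> t"
      then have x: "x \<in> {0..t}" by simp
      define s where "s = geo_sin e x"
      have "(c\<^sup>2 - 1) * s\<^sup>2 \<le> 1"
      proof (cases "c\<^sup>2 \<le> 1")
        case True
        then show ?thesis using mult_nonpos_nonneg[of "c\<^sup>2 - 1" "s\<^sup>2"] by simp
      next
        case False
        then have "(c\<^sup>2 - 1) * s\<^sup>2 \<le> (c\<^sup>2 - 1) * (geo_sin e t)\<^sup>2"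
          using mono[OF x] pos[OF x] unfolding s_def by (intro mult_left_mono power_mono) auto
        then show ?thesis using c by simp
      qed
      then have 1: "(sqrt (1 - (c\<^sup>2 - 1) * s\<^sup>2))\<^sup>2 + (c * s)\<^sup>2 = 1 + s\<^sup>2"
        by (simp add: algebra_simps)
      have 2: "(geo_cos e x)\<^sup>2 + (e * s)\<^sup>2 = 1 + s\<^sup>2"
        using geo_pythagoras[of e x] by (simp add: s_def algebra_simps)
      have "sqrt (1 - (c\<^sup>2 - 1) * s\<^sup>2) * geo_cos e x + (c * s) * (e * s) \<le> 1 + s\<^sup>2"
        using cauchy_schwarz_2[of "sqrt (1 - (c\<^sup>2 - 1) * s\<^sup>2)" "geo_cos e x" "c * s" "e * s"]
        unfolding 1 2 by simp
      then have "(sqrt (1 - (c\<^sup>2 - 1) * s\<^sup>2) * geo_cos e x + (c * s) * (e * s)) / (1 + s\<^sup>2) - 1 \<le> 0"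
        by (simp add: divide_le_eq add_pos_nonneg)
      then show "\<exists>d. (g c has_real_derivative d) (at x) \<and> d \<le> 0"
        using gder[OF x, of c] unfolding s_def by blast
    qed
    then show ?thesis by (simp add: g0) (simp add: g_def)
  qed
  have "g e t = g e 0"
  proof -
    have d0: "(g e has_real_derivative 0) (at x)" if x: "x \<in> {0..t}" for x
    proof -
      have "sqrt (1 - (e\<^sup>2 - 1) * (geo_sin e x)\<^sup>2) = geo_cos e x"
        using geo_pythagoras[of e x] pos(2)[OF x] by (intro real_sqrt_unique) (auto simp: algebra_simps)
      then have "sqrt (1 - (e\<^sup>2 - 1) * (geo_sin e x)\<^sup>2) * geo_cos e x + (e * geo_sin e x) * (e * geo_sin e x) = 1 + (geo_sin e x)\<^sup>2"
        using geo_pythagoras[of e x] by (simp add: power2_eq_square algebra_simps)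
      moreover have "1 + (geo_sin e x)\<^sup>2 \<noteq> 0" by (metis add_pos_nonneg less_irrefl zero_le_power2 zero_less_one)
      ultimately show ?thesis using gder[OF x, of e] by simp
    qed
    have "g e t \<le> g e 0"
      by (rule DERIV_nonpos_imp_nonincreasing[OF t]) (use d0 in force)
    moreover have "g e 0 \<le> g e t"
      by (rule DERIV_nonneg_imp_nondecreasing[OF t]) (use d0 in force)
    ultimately show ?thesis by simp
  qed
  then show "radial e (geo_sin e t) + 2 * e * geo_angle e t = t"
    by (simp add: g0) (simp add: g_def)
qed

text \<open>At half a period the radius reaches its maximum \<open>1 / n\<close>. Evaluating
  \<open>radial_geo_eq\<close> there gives \<open>radial c (1 / n)\<close> without computing the
  integral.\<close>

lemma geo_half_period:
  assumes n: "0 < n" and c: "c\<^sup>2 = 1 + n\<^sup>2" "0 \<le> c"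
  shows "geo_sin c (pi / n) = 1 / n" "geo_angle c (pi / n) = (c / n - 1) * pi / 2"
    "radial c (1 / n) = pi * (c - n)"
proof -
  show s: "geo_sin c (pi / n) = 1 / n" using n by (simp add: geo_elliptic[OF c(1)])
  have "c \<noteq> 0" using c(1) by (auto simp: add_nonneg_eq_0_iff)
  then have "0 < c" using c by simp
  have "geo_cos c (pi / n) = 0" using n by (simp add: geo_elliptic[OF c(1)])
  then have "geo_z c (pi / n) = Complex 0 (c / n)" by (simp add: geo_z_def s)
  moreover have "Arg (Complex 0 (c / n)) = pi / 2"
    by (rule Arg_unique[of "c / n"]) (use n \<open>0 < c\<close> in \<open>auto simp: complex_eq_iff Re_exp Im_exp\<close>)
  ultimately show a: "geo_angle c (pi / n) = (c / n - 1) * pi / 2"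
    by (simp add: geo_angle_def algebra_simps)
  have "radial c (geo_sin c (pi / n)) + 2 * c * geo_angle c (pi / n) = pi / n"
    by (rule radial_geo_eq) (use n c in \<open>auto simp: power_divide\<close>)
  then have "radial c (1 / n) = pi / n - c * (c / n - 1) * pi" unfolding s a by simp
  also have "\<dots> = pi * (c - (c\<^sup>2 - 1) / n)" by (simp add: algebra_simps power2_eq_square diff_divide_distrib)
  also have "(c\<^sup>2 - 1) / n = n" using c n by (simp add: power2_eq_square)
  finally show "radial c (1 / n) = pi * (c - n)" .
qed

text \<open>Reflecting time in half a period replaces \<open>geo_z\<close> by
  \<open>- cnj (geo_z c t)\<close>, whose argument is \<open>pi\<close> minus the original
  one.\<close>

lemma geo_reflect:
  assumes n: "0 < n" and c: "c\<^sup>2 = 1 + n\<^sup>2" "0 \<le> c" and t: "0 \<le> t" "t \<le> pi / n"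
  shows "geo_sin c (2 * pi / n - t) = geo_sin c t"
    "geo_angle c (2 * pi / n - t) = (c / n - 1) * pi - geo_angle c t"
proof -
  have e: "n * (2 * pi / n - t) / 2 = pi - n * t / 2" using n by (simp add: field_simps)
  have n0: "n \<noteq> 0" using n by simp
  show s: "geo_sin c (2 * pi / n - t) = geo_sin c t"
    unfolding geo_elliptic[OF c(1) n0] e by (simp add: sin_diff)
  have co: "geo_cos c (2 * pi / n - t) = - geo_cos c t"
    unfolding geo_elliptic[OF c(1) n0] e by (simp add: cos_diff)
  have z: "geo_z c (2 * pi / n - t) = - cnj (geo_z c t)"
    by (simp add: geo_z_def s co complex_eq_iff)
  have nt: "0 \<le> n * t" "n * t \<le> pi" using n t by (auto simp: field_simps)
  then have "(n * t)\<^sup>2 \<le> pi\<^sup>2" by (intro power_mono) auto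
  moreover have "pi\<^sup>2 < (2 * pi)\<^sup>2" using pi_gt_zero by (intro power_strict_mono) auto
  ultimately have "(n * t)\<^sup>2 < (2 * pi)\<^sup>2" by linarith
  then have pre: "(c\<^sup>2 - 1) * t\<^sup>2 < (2 * pi)\<^sup>2" using c by (simp add: power_mult_distrib)
  have nonpos: "geo_z c t \<notin> \<real>\<^sub>\<le>\<^sub>0" by (rule geo_z_not_nonpos[OF t(1) c(2) pre])
  have "0 \<le> geo_sin c t" using geo_sin_pos[OF _ pre] t by (cases "t = 0") auto
  then have im: "0 \<le> Im (geo_z c t)" using c by (simp add: geo_z_def)
  have nz: "geo_z c t \<noteq> 0" using nonpos by auto
  have "0 \<le> Arg (geo_z c t)" using im Arg_neg_iff not_le by blast
  moreover have "Arg (geo_z c t) \<le> pi" using Arg_bounded by blast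
  moreover have "Arg (geo_z c t) \<noteq> pi"
    using nonpos by (auto simp: Arg_eq_pi complex_nonpos_Reals_iff)
  ultimately have ar: "0 \<le> Arg (geo_z c t)" "Arg (geo_z c t) < pi" by auto
  have "Arg (- cnj (geo_z c t)) = pi - Arg (geo_z c t)"
  proof (rule Arg_unique)
    have "cnj (geo_z c t) = of_real (cmod (geo_z c t)) * exp (- (\<i> * of_real (Arg (geo_z c t))))"
      using arg_cong[OF Arg_eq[OF nz], of cnj] by (simp add: exp_cnj)
    moreover have "exp (\<i> * of_real (pi - Arg (geo_z c t))) = - exp (- (\<i> * of_real (Arg (geo_z c t))))"
      by (simp add: right_diff_distrib exp_diff exp_minus divide_inverse)
    ultimately show "of_real (cmod (geo_z c t)) * exp (\<i> * of_real (pi - Arg (geo_z c t))) = - cnj (geo_z c t)"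
      by simp
  qed (use nz ar in auto)
  then show "geo_angle c (2 * pi / n - t) = (c / n - 1) * pi - geo_angle c t"
    unfolding geo_angle_def z using n by (simp add: diff_divide_distrib right_diff_distrib left_diff_distrib mult.commute)
qed

section \<open>Lower bound by the length of a geodesic\<close>

text \<open>Reversed Cauchy-Schwarz for the Lorentz form on one branch of a hyperbola, from the
  identity \<open>(c * e)\<^sup>2 = (1 + n * m)\<^sup>2 + (n - m)\<^sup>2\<close>.\<close>

lemma hyperbola_reversed_cauchy_schwarz:
  fixes n m c e :: real
  assumes "0 \<le> n" "0 \<le> m" "0 \<le> c" "0 \<le> e" "c\<^sup>2 = 1 + n\<^sup>2" "e\<^sup>2 = 1 + m\<^sup>2"
  shows "1 + n * m \<le> c * e" "n \<noteq> m \<Longrightarrow> 1 + n * m < c * e"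
proof -
  have e: "(c * e)\<^sup>2 = (1 + n * m)\<^sup>2 + (n - m)\<^sup>2"
    unfolding power_mult_distrib assms(5,6) by (simp add: power2_eq_square algebra_simps)
  have ce: "0 \<le> c * e" using assms by simp
  have "(1 + n * m)\<^sup>2 \<le> (c * e)\<^sup>2" unfolding e by simp
  then show "1 + n * m \<le> c * e" using ce by (rule power2_le_imp_le)
  assume "n \<noteq> m"
  then have "(1 + n * m)\<^sup>2 < (c * e)\<^sup>2" unfolding e by simp
  then show "1 + n * m < c * e" using ce by (rule power2_less_imp_less)
qed

text \<open>
  The geodesic with parameter \<open>e\<close> is considered at the time \<open>2 pi / m - t\<close> in the second half of its period,
  which mirrors the time \<open>t\<close> in the first half.
\<close>

lemma reflected_calibration:
  assumes n: "0 < n" "c\<^sup>2 = 1 + n\<^sup>2" "0 \<le> c" and m: "0 < m" "e\<^sup>2 = 1 + m\<^sup>2" "0 \<le> e"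
    and t: "0 \<le> t" "t \<le> pi / m" and s: "(c\<^sup>2 - 1) * (geo_sin e t)\<^sup>2 \<le> 1"
  defines "\<alpha> \<equiv> (e / m - 1) * pi - geo_angle e t"
  shows "2 * pi / m - t \<le> 2 * c * \<alpha> + 2 * (pi * (c - n)) - radial c (geo_sin e t)"
    and "n \<noteq> m \<Longrightarrow> 2 * pi / m - t < 2 * c * \<alpha> + 2 * (pi * (c - n)) - radial c (geo_sin e t)"
proof -
  have "m * t \<le> pi" "0 \<le> m * t" using t m by (auto simp: field_simps)
  then have "(m * t)\<^sup>2 \<le> pi\<^sup>2" by (intro power_mono) auto
  then have "(e\<^sup>2 - 1) * t\<^sup>2 \<le> pi\<^sup>2" using m by (simp add: power_mult_distrib)
  from radial_geo_le[OF t(1) m(3) this s]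
  have le: "radial c (geo_sin e t) \<le> t - 2 * c * geo_angle e t" by linarith
  \<comment> \<open>The terms combine to the Lorentz product \<open>c * e - n * m\<close>, which is
    at least 1, with equality only for \<open>n = m\<close>.\<close>
  have eq: "2 * c * \<alpha> + 2 * (pi * (c - n)) = 2 * pi * ((c * e - n * m) / m) - 2 * c * geo_angle e t"
    unfolding \<alpha>_def using m(1) by (simp add: field_simps)
  note cs = hyperbola_reversed_cauchy_schwarz[of n m c e]
  have "1 / m \<le> (c * e - n * m) / m"
    using cs(1) n m by (intro divide_right_mono) auto
  then have "2 * pi * (1 / m) \<le> 2 * pi * ((c * e - n * m) / m)" by (intro mult_left_mono) auto
  then show "2 * pi / m - t \<le> 2 * c * \<alpha> + 2 * (pi * (c - n)) - radial c (geo_sin e t)"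
    using le unfolding eq by simp
  show "2 * pi / m - t < 2 * c * \<alpha> + 2 * (pi * (c - n)) - radial c (geo_sin e t)" if "n \<noteq> m"
  proof -
    have "1 / m < (c * e - n * m) / m"
      using cs(2) n m that by (intro divide_strict_right_mono) auto
    then have "2 * pi * (1 / m) < 2 * pi * ((c * e - n * m) / m)" by (intro mult_strict_left_mono) auto
    then show ?thesis using le unfolding eq by simp
  qed
qed

text \<open>The parameter \<open>c\<close> is the largest for which the calibration is real up to
  the maximal radius \<open>1 / n\<close>; the reflection takes place when that radius is
  attained.\<close>

lemma sr_length_ge_max_radius:
  assumes hor: "horizontal T \<gamma>" and start: "\<gamma> 0 = mat 1"
    and n: "0 < n" "c\<^sup>2 = 1 + n\<^sup>2" "0 \<le> c"
    and S: "\<And>t. t \<in> {0..T} \<Longrightarrow> cmod (conj_part (\<gamma> t)) \<le> 1 / n"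
    and m: "m \<in> {0..T}" "cmod (conj_part (\<gamma> m)) = 1 / n"
  shows "2 * c * \<bar>Arg (lin_part (\<gamma> T))\<bar> + 2 * (pi * (c - n)) - radial c (cmod (conj_part (\<gamma> T)))
    \<le> sr_length T \<gamma>"
proof -
  have "(c\<^sup>2 - 1) * (1 / n)\<^sup>2 \<le> 1" using n by (simp add: power_divide)
  from sr_length_lower_bound[OF hor start n(3) S this m(1)]
  show ?thesis unfolding m(2) geo_half_period(3)[OF n] by simp
qed

text \<open>Here \<open>c\<close> and \<open>n\<close> belong to the maximal radius of the curve,
  \<open>e\<close> and \<open>k\<close> to the geodesic with the same end data. The strict version
  is what later excludes geodesics longer than their period.\<close>

lemma sr_length_ge_after_half_period:
  assumes hor: "horizontal T \<gamma>" and start: "\<gamma> 0 = mat 1"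
    and n: "0 < n" "c\<^sup>2 = 1 + n\<^sup>2" "0 \<le> c"
    and S: "\<And>t. t \<in> {0..T} \<Longrightarrow> cmod (conj_part (\<gamma> t)) \<le> 1 / n"
    and m: "m \<in> {0..T}" "cmod (conj_part (\<gamma> m)) = 1 / n"
    and k: "0 < k" "e\<^sup>2 = 1 + k\<^sup>2" "0 \<le> e" and t: "pi / k \<le> t" "t \<le> 2 * pi / k"
    and B: "cmod (conj_part (\<gamma> T)) = geo_sin e t" and A: "\<bar>Arg (lin_part (\<gamma> T))\<bar> = geo_angle e t"
  shows "t \<le> sr_length T \<gamma>" "n \<noteq> k \<Longrightarrow> t < sr_length T \<gamma>"
proof -
  define r where "r = 2 * pi / k - t"
  have r: "0 \<le> r" "r \<le> pi / k" and tr: "t = 2 * pi / k - r" using t k by (auto simp: r_def field_simps)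
  note refl = geo_reflect[OF k r, folded tr]
  have T: "0 \<le> T" using m by auto
  have "geo_sin e t \<le> 1 / n" "0 \<le> geo_sin e t" using S[of T] T unfolding B[symmetric] by auto
  then have "(geo_sin e r)\<^sup>2 \<le> (1 / n)\<^sup>2" unfolding refl by (intro power_mono)
  then have "(c\<^sup>2 - 1) * (geo_sin e r)\<^sup>2 \<le> (c\<^sup>2 - 1) * (1 / n)\<^sup>2" using n by (intro mult_left_mono) auto
  then have s: "(c\<^sup>2 - 1) * (geo_sin e r)\<^sup>2 \<le> 1" using n by (simp add: power_divide)
  note 1 = reflected_calibration[OF n k r s, folded refl(2) tr]
  note 2 = sr_length_ge_max_radius[OF hor start n S m, unfolded A B refl(1)]
  show "t \<le> sr_length T \<gamma>" using 1(1) 2 refl by simp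
  show "t < sr_length T \<gamma>" if "n \<noteq> k" using 1(2)[OF that] 2 refl by simp
qed

theorem sr_length_ge_geo:
  assumes hor: "horizontal T \<gamma>" and start: "\<gamma> 0 = mat 1"
    and e: "0 \<le> e" and t: "0 < t" and pre: "(e\<^sup>2 - 1) * t\<^sup>2 \<le> (2 * pi)\<^sup>2"
    and B: "cmod (conj_part (\<gamma> T)) = geo_sin e t" and A: "\<bar>Arg (lin_part (\<gamma> T))\<bar> = geo_angle e t"
  shows "t \<le> sr_length T \<gamma>"
proof -
  have T: "0 \<le> T" using hor unfolding horizontal_def by blast
  obtain L where "L-lipschitz_on {0..T} \<gamma>" using hor unfolding horizontal_def by blast
  then have "continuous_on {0..T} \<gamma>" by (rule lipschitz_on_continuous_on)
  then have "continuous_on {0..T} (\<lambda>t. cmod (conj_part (\<gamma> t)))"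
    by (intro continuous_on_norm bounded_linear.continuous_on[OF bounded_linear_conj_part])
  then have "\<exists>m\<in>{0..T}. \<forall>t\<in>{0..T}. cmod (conj_part (\<gamma> t)) \<le> cmod (conj_part (\<gamma> m))"
    by (intro continuous_attains_sup) (use T in auto)
  then obtain m where m: "m \<in> {0..T}"
    and max: "\<And>t. t \<in> {0..T} \<Longrightarrow> cmod (conj_part (\<gamma> t)) \<le> cmod (conj_part (\<gamma> m))"
    by blast
  define S where "S = cmod (conj_part (\<gamma> m))"
  have s0S: "geo_sin e t \<le> S" unfolding B[symmetric] S_def by (rule max) (use T in simp)
  have s0: "0 \<le> geo_sin e t" unfolding B[symmetric] by simp
  have T_in: "T \<in> {0..T}" using T by simp
  show ?thesis
  proof (cases "S = 0")
    case True
    then have "geo_sin e t = 0" using s0 s0S by simp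
    then have "(2 * pi)\<^sup>2 \<le> (e\<^sup>2 - 1) * t\<^sup>2" using geo_sin_pos[OF t, of e] by (metis less_irrefl not_le)
    with pre have eq: "(e\<^sup>2 - 1) * t\<^sup>2 = (2 * pi)\<^sup>2" by (rule antisym)
    have "1 < e\<^sup>2"
    proof (rule ccontr)
      assume "\<not> 1 < e\<^sup>2"
      then have "(e\<^sup>2 - 1) * t\<^sup>2 \<le> 0" by (intro mult_nonpos_nonneg) auto
      then show False unfolding eq by (simp add: mult_le_0_iff)
    qed
    define k where "k = sqrt (e\<^sup>2 - 1)"
    have k: "0 < k" "e\<^sup>2 = 1 + k\<^sup>2" using \<open>1 < e\<^sup>2\<close> by (auto simp: k_def)
    have "(k * t)\<^sup>2 = (2 * pi)\<^sup>2" using eq unfolding k(2) power_mult_distrib by simp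
    then have "k * t = 2 * pi" by (rule power2_eq_imp_eq) (use k(1) t in auto)
    \<comment> \<open>The full period is written as the mirror image of time 0, so that
      \<open>geo_reflect\<close> gives the angle.\<close>
    then have tk: "t = 2 * pi / k - 0" using k(1) by (simp add: eq_divide_eq mult.commute)
    have ang: "geo_angle e t = (e / k - 1) * pi"
      using geo_reflect(2)[OF k e order_refl, folded tk] k(1) by simp
    have "k\<^sup>2 < e\<^sup>2" using k by simp
    then have "k < e" using e by (rule power2_less_imp_less)
    then have apos: "0 < geo_angle e t" unfolding ang using k by simp
    \<comment> \<open>With maximal radius 0 every nonnegative \<open>c\<close> is admissible; this
      one makes the bound \<open>2 * c * geo_angle e t\<close> equal to \<open>t\<close>.\<close>
    define c where "c = t / (2 * geo_angle e t)"
    have c: "0 \<le> c" using t apos by (simp add: c_def)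
    have "cmod (conj_part (\<gamma> x)) \<le> 0" if "x \<in> {0..T}" for x
      using max[OF that] True by (simp add: S_def)
    from sr_length_lower_bound[OF hor start c this _ T_in]
    have "2 * c * geo_angle e t + 2 * radial c 0 - radial c 0 \<le> sr_length T \<gamma>"
      unfolding A B \<open>geo_sin e t = 0\<close> by simp
    then show ?thesis using apos by (simp add: c_def)
  next
    case False
    then have S: "0 < S" by (simp add: S_def)
    \<comment> \<open>The geodesic with this \<open>n\<close> would have the same maximal radius
      \<open>S\<close>.\<close>
    define n where "n = 1 / S"
    define c where "c = sqrt (1 + n\<^sup>2)"
    have n: "0 < n" "c\<^sup>2 = 1 + n\<^sup>2" "0 \<le> c" using S by (auto simp: n_def c_def)
    have Sn: "S = 1 / n" using S by (simp add: n_def)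
    have max': "cmod (conj_part (\<gamma> t)) \<le> 1 / n" if "t \<in> {0..T}" for t
      using max[OF that] by (simp add: Sn[symmetric] S_def)
    have m': "cmod (conj_part (\<gamma> m)) = 1 / n" by (simp add: Sn[symmetric] S_def)
    show ?thesis
    proof (cases "(e\<^sup>2 - 1) * t\<^sup>2 \<le> pi\<^sup>2")
      case True
      note eq = radial_geo_eq[OF less_imp_le[OF t] e True]
      show ?thesis
      \<comment> \<open>If \<open>radial e\<close> is calibrating up to \<open>S\<close>, the choice
        \<open>m = T\<close> gives the length of the geodesic. Otherwise the curve leaves that
        range, and \<open>c \<le> e\<close> follows.\<close>
      proof (cases "(e\<^sup>2 - 1) * S\<^sup>2 \<le> 1")
        case True
        then show ?thesis
          using sr_length_lower_bound[OF hor start e _ True T_in] max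
          by (simp add: A B S_def) (use eq in linarith)
      next
        case False
        have "n\<^sup>2 < e\<^sup>2 - 1"
        proof -
          have "1 * n\<^sup>2 < ((e\<^sup>2 - 1) * S\<^sup>2) * n\<^sup>2" using False n by (intro mult_strict_right_mono) auto
          then show ?thesis using n by (simp add: Sn power_divide)
        qed
        then have "0 < e\<^sup>2 - 1" using zero_le_power2[of n] by linarith
        define k where "k = sqrt (e\<^sup>2 - 1)"
        have k: "0 < k" "e\<^sup>2 = 1 + k\<^sup>2" using \<open>0 < e\<^sup>2 - 1\<close> by (auto simp: k_def)
        have "c\<^sup>2 \<le> e\<^sup>2" using n(2) \<open>n\<^sup>2 < e\<^sup>2 - 1\<close> by linarith
        then have ce: "c \<le> e" using e by (rule power2_le_imp_le)
        have "(k * t)\<^sup>2 \<le> pi\<^sup>2" using True k by (simp add: power_mult_distrib)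
        then have "k * t \<le> pi" by (rule power2_le_imp_le) simp
        then have tk: "t \<le> pi / k" using k by (simp add: field_simps)
        have "(c\<^sup>2 - 1) * (geo_sin e t)\<^sup>2 \<le> (c\<^sup>2 - 1) * (1 / n)\<^sup>2"
          using n s0 s0S by (intro mult_left_mono power_mono) (auto simp: Sn)
        then have s: "(c\<^sup>2 - 1) * (geo_sin e t)\<^sup>2 \<le> 1" using n by (simp add: power_divide)
        \<comment> \<open>This is the angle of the geodesic at the mirror time
          \<open>2 * pi / k - t\<close>.\<close>
        define \<alpha> where "\<alpha> = (e / k - 1) * pi - geo_angle e t"
        have 1: "2 * pi / k - t \<le> 2 * c * \<alpha> + 2 * (pi * (c - n)) - radial c (geo_sin e t)"
          unfolding \<alpha>_def by (rule reflected_calibration(1)[OF n k e less_imp_le[OF t] tk s])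
        have 2: "2 * c * geo_angle e t + 2 * (pi * (c - n)) - radial c (geo_sin e t) \<le> sr_length T \<gamma>"
          using sr_length_ge_max_radius[OF hor start n max' m m'] by (simp add: A B)
        \<comment> \<open>Replacing the mirror angle \<alpha> by the actual one lowers the bound by
          \<open>2 * c * (\<alpha> - geo_angle e t)\<close>; the loss must not exceed
          \<open>2 * pi / k - 2 * t\<close>. For a positive difference of angles,
          \<open>c \<le> e\<close> reduces this to monotonicity of \<open>radial e\<close>.\<close>
        have "t \<le> 2 * pi / k - t - 2 * c * (\<alpha> - geo_angle e t)"
        proof (cases "geo_angle e t \<le> \<alpha>")
          case True
          have "geo_sin e t \<le> 1 / k"
          proof -
            have "geo_sin e t = sin (k * t / 2) / k" using k by (simp add: geo_elliptic)
            also have "\<dots> \<le> 1 / k" using k by (intro divide_right_mono) auto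
            finally show ?thesis .
          qed
          then have "radial e (geo_sin e t) \<le> radial e (1 / k)"
            by (rule radial_mono[OF s0 _ order_refl]) (use k in \<open>simp add: power_divide\<close>)
          then have "t - 2 * e * geo_angle e t \<le> pi * (e - k)"
            using eq geo_half_period(3)[OF k e] by linarith
          moreover have "2 * pi / k - 2 * e * ((e / k - 1) * pi) = 2 * (pi * (e - k))"
          proof -
            have "2 * pi / k - 2 * e * ((e / k - 1) * pi) = 2 * pi * ((1 - e\<^sup>2) / k) + 2 * e * pi"
              using k(1) by (simp add: field_simps power2_eq_square)
            also have "(1 - e\<^sup>2) / k = - k"
              unfolding k(2) using k(1) by (simp add: power2_eq_square)
            finally show ?thesis by (simp add: algebra_simps)
          qed
          ultimately have "2 * t \<le> 2 * pi / k - 2 * e * (\<alpha> - geo_angle e t)"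
            by (simp add: \<alpha>_def algebra_simps)
          moreover have "2 * c * (\<alpha> - geo_angle e t) \<le> 2 * e * (\<alpha> - geo_angle e t)"
            using True ce by (intro mult_right_mono) auto
          ultimately show ?thesis by linarith
        next
          case False
          then have "2 * c * (\<alpha> - geo_angle e t) \<le> 0" using n by (intro mult_nonneg_nonpos) auto
          moreover have "2 * t \<le> 2 * (pi / k)" using tk by simp
          ultimately show ?thesis by linarith
        qed
        with 1 2 show ?thesis by (simp add: algebra_simps)
      qed
    next
      case False
      then have "0 < (e\<^sup>2 - 1) * t\<^sup>2" by (meson le_less_trans not_le zero_le_power2)
      then have "0 < e\<^sup>2 - 1" using t by (simp add: zero_less_mult_iff)
      define k where "k = sqrt (e\<^sup>2 - 1)"
      have k: "0 < k" "e\<^sup>2 = 1 + k\<^sup>2" using \<open>0 < e\<^sup>2 - 1\<close> by (auto simp: k_def)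
      have "pi\<^sup>2 \<le> (k * t)\<^sup>2" "(k * t)\<^sup>2 \<le> (2 * pi)\<^sup>2" using False pre k by (auto simp: power_mult_distrib)
      then have "pi \<le> k * t" "k * t \<le> 2 * pi" using k t by (auto intro: power2_le_imp_le)
      then have "pi / k \<le> t" "t \<le> 2 * pi / k" using k by (auto simp: field_simps)
      from sr_length_ge_after_half_period(1)[OF hor start n max' m m' k e this B A]
      show ?thesis .
    qed
  qed
qed

section \<open>Geodesics to a given point\<close>

text \<open>The numerator \<open>x * cos x - sin x\<close> of the derivative vanishes at 0 and
  decreases up to \<open>pi\<close>.\<close>

lemma sin_over_strict_antimono:
  assumes "0 < b" "b < a" "a \<le> pi"
  shows "sin a / a < sin b / b"
proof (rule DERIV_neg_imp_decreasing_open[OF assms(2)])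
  fix x assume x: "b < x" "x < a"
  have "x * cos x - sin x < 0 * cos 0 - sin 0"
  proof (rule DERIV_neg_imp_decreasing_open[where f = "\<lambda>x. x * cos x - sin x"])
    show "0 < x" using x assms by simp
    fix y assume y: "0 < y" "y < x"
    have "((\<lambda>x. x * cos x - sin x) has_real_derivative - (y * sin y)) (at y)"
      by (auto intro!: derivative_eq_intros)
    moreover have "- (y * sin y) < 0" using y x assms by (simp add: sin_gt_zero)
    ultimately show "\<exists>d. ((\<lambda>x. x * cos x - sin x) has_real_derivative d) (at y) \<and> d < 0" by blast
  qed (intro continuous_intros)
  then have "(x * cos x - sin x) / x\<^sup>2 < 0" using x assms by (simp add: divide_less_0_iff)
  moreover have "((\<lambda>x. sin x / x) has_real_derivative (x * cos x - sin x) / x\<^sup>2) (at x)"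
    using x assms by (auto intro!: derivative_eq_intros simp: power2_eq_square)
  ultimately show "\<exists>d. ((\<lambda>x. sin x / x) has_real_derivative d) (at x) \<and> d < 0" by blast
next
  show "continuous_on {b..a} (\<lambda>x. sin x / x)"
    using assms by (intro continuous_intros) auto
qed

lemma sinhc_sqrt_strict_mono_nonneg:
  assumes "0 \<le> x" "x < y"
  shows "sinhc_sqrt x < sinhc_sqrt y"
proof -
  define f where "f = (\<lambda>n. inverse (fact (2 * n + 1)) * y ^ n - inverse (fact (2 * n + 1)) * x ^ n)"
  have "f sums (sinhc_sqrt y - sinhc_sqrt x)"
    unfolding f_def by (intro sums_diff sinhc_sqrt_sums)
  moreover have "0 \<le> f n" for n
  proof -
    have "x ^ n \<le> y ^ n" using assms by (intro power_mono) auto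
    then have "inverse (fact (2 * n + 1)) * x ^ n \<le> inverse (fact (2 * n + 1)) * y ^ n"
      by (intro mult_left_mono) auto
    then show ?thesis by (simp add: f_def)
  qed
  moreover have "0 < f 1" using assms by (simp add: f_def)
  ultimately have "0 < suminf f" by (intro suminf_pos2) (auto simp: sums_iff)
  with \<open>f sums _\<close> show ?thesis by (simp add: sums_iff)
qed

text \<open>For nonpositive arguments this is the decrease of \<open>sin a / a\<close> up to its
  first zero, at \<open>a = pi\<close>; for nonnegative ones it is read off the power
  series.\<close>

lemma sinhc_sqrt_strict_mono:
  assumes "- (pi\<^sup>2) \<le> x" "x < y"
  shows "sinhc_sqrt x < sinhc_sqrt y"
proof -
  have neg: "sinhc_sqrt x < sinhc_sqrt y" if "- (pi\<^sup>2) \<le> x" "x < y" "y \<le> 0" for x y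
  proof -
    define a where "a = sqrt (- x)"
    define b where "b = sqrt (- y)"
    have x: "x = - (a\<^sup>2)" and y: "y = - (b\<^sup>2)" and ab: "0 \<le> b" "b < a"
      using that by (auto simp: a_def b_def)
    have api: "a \<le> pi" by (rule power2_le_imp_le) (use that x in auto)
    show ?thesis
    proof (cases "b = 0")
      case True
      have "sin a / a < sin (a / 2) / (a / 2)"
        using ab True api by (intro sin_over_strict_antimono) auto
      also have "\<dots> \<le> 1" using ab True sin_x_le_x[of "a / 2"] by (simp add: divide_le_eq)
      finally show ?thesis using True ab unfolding x y by (simp add: sinhc_sqrt_minus_square)
    next
      case False
      then show ?thesis using sin_over_strict_antimono[of b a] ab api unfolding x y
        by (simp add: sinhc_sqrt_minus_square)
    qed
  qed
  show ?thesis
  proof (cases "y \<le> 0 \<or> 0 \<le> x")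
    case True
    then show ?thesis using neg sinhc_sqrt_strict_mono_nonneg assms by auto
  next
    case False
    then have "sinhc_sqrt x < sinhc_sqrt 0" "sinhc_sqrt 0 < sinhc_sqrt y"
      using neg[of x 0] sinhc_sqrt_strict_mono_nonneg[of 0 y] assms by auto
    then show ?thesis by linarith
  qed
qed

text \<open>At a fixed time before the period, the radius is strictly monotone in
  \<open>(1 - c\<^sup>2) * t\<^sup>2 / 4\<close>. So time and end point determine \<open>c\<close>
  up to sign.\<close>

lemma geo_sin_inj:
  assumes t: "0 < t" and pre: "(c\<^sup>2 - 1) * t\<^sup>2 < (2 * pi)\<^sup>2" "(e\<^sup>2 - 1) * t\<^sup>2 < (2 * pi)\<^sup>2"
    and eq: "geo_sin c t = geo_sin e t"
  shows "c\<^sup>2 = e\<^sup>2"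
proof -
  define x where "x = (1 - c\<^sup>2) * t\<^sup>2 / 4"
  define y where "y = (1 - e\<^sup>2) * t\<^sup>2 / 4"
  have "- (pi\<^sup>2) \<le> x" "- (pi\<^sup>2) \<le> y"
    using pre by (auto simp: x_def y_def power_mult_distrib algebra_simps)
  moreover have "sinhc_sqrt x = sinhc_sqrt y" using eq t by (simp add: geo_sin_def x_def y_def)
  ultimately have "x = y" using sinhc_sqrt_strict_mono[of x y] sinhc_sqrt_strict_mono[of y x]
    by (metis less_irrefl linorder_neqE)
  then show ?thesis using t by (simp add: x_def y_def)
qed

text \<open>In the first half of the period \<open>sinhc_sqrt\<close> is at least its value
  \<open>2 / pi\<close> at \<open>- ((pi / 2)\<^sup>2)\<close>; in the elliptic case this is
  Jordan's inequality.\<close>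

lemma le_pi_geo_sin:
  assumes t: "0 < t" and pre: "(c\<^sup>2 - 1) * t\<^sup>2 \<le> pi\<^sup>2"
  shows "t \<le> pi * geo_sin c t"
proof -
  define x where "x = (1 - c\<^sup>2) * t\<^sup>2 / 4"
  have x: "- ((pi / 2)\<^sup>2) \<le> x" using pre by (simp add: x_def power_divide algebra_simps)
  have "- (pi\<^sup>2) \<le> - ((pi / 2)\<^sup>2)" by (simp add: power_divide)
  then have "sinhc_sqrt (- ((pi / 2)\<^sup>2)) \<le> sinhc_sqrt x"
    using sinhc_sqrt_strict_mono[of "- ((pi / 2)\<^sup>2)" x] x by (cases "x = - ((pi / 2)\<^sup>2)") auto
  then have "2 / pi \<le> sinhc_sqrt x" using sinhc_sqrt_minus_square[of "pi / 2"] by simp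
  then have "t / 2 * (2 / pi) \<le> geo_sin c t"
    unfolding geo_sin_def x_def[symmetric] using t by (intro mult_left_mono) auto
  then show ?thesis by (simp add: field_simps)
qed

lemma cosh_sqrt_pythagoras: "(cosh_sqrt x)\<^sup>2 - x * (sinhc_sqrt x)\<^sup>2 = 1"
proof (cases x rule: real_square_cases)
  case (2 w)
  then show ?thesis by (simp add: cosh_sqrt_square sinhc_sqrt_square power_divide cosh_square_eq)
next
  case (3 w)
  then show ?thesis by (simp add: cosh_sqrt_minus_square sinhc_sqrt_minus_square power_divide)
qed simp

text \<open>The unknowns are replaced by \<open>x = (1 - c\<^sup>2) * t\<^sup>2 / 4\<close>.
  Prescribing the radius \<open>s\<close> forces \<open>t = 2 * s / sinhc_sqrt x\<close> and
  \<open>c = q x / s\<close>, and the angle becomes a continuous function \<open>g\<close> of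
  \<open>x\<close>, to which the intermediate value theorem applies.\<close>

lemma ex_geo:
  assumes s: "0 < s" and a: "0 \<le> a" "a \<le> pi"
  obtains c t where "0 \<le> c" "0 < t" "(c\<^sup>2 - 1) * t\<^sup>2 < (2 * pi)\<^sup>2" "geo_sin c t = s" "geo_angle c t = a"
proof -
  define r where "r = sqrt (1 + s\<^sup>2)"
  have r: "r\<^sup>2 = 1 + s\<^sup>2" "1 \<le> r" "0 < r" by (auto simp: r_def add_pos_nonneg)
  \<comment> \<open>The left end \<open>- (w\<^sup>2)\<close> lies just above
    \<open>- (pi\<^sup>2)\<close>. The bound \<open>d \<le> 1\<close> gives
    \<open>w \<ge> 2\<close>, and \<open>d \<le> s / pi\<close> then makes
    \<open>2 * pi * sinhc_sqrt x1 \<le> s\<close>, so that \<open>g x1\<close> exceeds every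
    admissible angle.\<close>
  define d where "d = min 1 (s / pi)"
  define w where "w = pi - d"
  have d: "0 < d" "d \<le> 1" "d \<le> s / pi" using s by (auto simp: d_def)
  have w: "0 < w" "w < pi" "2 \<le> w" using d pi_gt3 by (auto simp: w_def)
  have arsinh0: "0 < arsinh s" using s by simp
  \<comment> \<open>The right end belongs to \<open>c = 0\<close>, where the angle is 0.\<close>
  define M where "M = (arsinh s)\<^sup>2"
  have M: "cosh_sqrt M = r" "0 < M"
    using s by (auto simp: M_def cosh_sqrt_square cosh_arsinh_real r_def add.commute)
  define x1 where "x1 = - (w\<^sup>2)"
  have x1: "- (pi\<^sup>2) < x1" "x1 < 0" using w by (auto simp: x1_def intro: power_strict_mono)
  have bound: "- 1 \<le> cosh_sqrt x \<and> cosh_sqrt x \<le> r \<and> (x \<le> 0 \<longrightarrow> cosh_sqrt x \<le> 1)" if "x \<le> M" for x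
  proof (cases x rule: real_square_cases)
    case (2 v)
    have "v \<le> arsinh s" by (rule power2_le_imp_le) (use that 2 arsinh0 in \<open>auto simp: M_def\<close>)
    then have "cosh v \<le> cosh (arsinh s)" using 2 arsinh0 by (subst cosh_real_nonneg_le_iff) auto
    then have "cosh v \<le> r" by (simp add: cosh_arsinh_real r_def add.commute)
    moreover have "-1 \<le> cosh v" using cosh_real_ge_1[of v] by linarith
    ultimately show ?thesis using 2 by (simp add: cosh_sqrt_square)
  next
    case (3 v)
    have "cos v \<le> r" using cos_le_one[of v] r(2) by linarith
    then show ?thesis using 3 by (simp add: cosh_sqrt_minus_square)
  qed (use r in auto)
  have Spos: "0 < sinhc_sqrt x" if "x1 \<le> x" for x
  proof -
    have "0 = sinhc_sqrt (- (pi\<^sup>2))" by (simp add: sinhc_sqrt_minus_square)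
    also have "\<dots> < sinhc_sqrt x" by (rule sinhc_sqrt_strict_mono) (use that x1 in auto)
    finally show ?thesis .
  qed
  \<comment> \<open>With \<open>r\<close> the modulus of \<open>geo_z\<close>, this is its imaginary
    part \<open>c * s\<close>.\<close>
  define q where "q = (\<lambda>x. sqrt (r\<^sup>2 - (cosh_sqrt x)\<^sup>2))"
  define g where "g = (\<lambda>x. q x / sinhc_sqrt x - Arg (Complex (cosh_sqrt x) (q x)))"
  have q2: "(q x)\<^sup>2 = r\<^sup>2 - (cosh_sqrt x)\<^sup>2" and q0: "0 \<le> q x" if "x \<le> M" for x
  proof -
    have "\<bar>cosh_sqrt x\<bar> \<le> r" using bound[OF that] r(2) by auto
    then have "\<bar>cosh_sqrt x\<bar>\<^sup>2 \<le> r\<^sup>2" by (rule power_mono) simp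
    then have "(cosh_sqrt x)\<^sup>2 \<le> r\<^sup>2" by simp
    then show "(q x)\<^sup>2 = r\<^sup>2 - (cosh_sqrt x)\<^sup>2" "0 \<le> q x" by (auto simp: q_def)
  qed
  have cont: "continuous_on {x1..M} g"
  proof -
    have c1: "continuous_on {x1..M} cosh_sqrt" "continuous_on {x1..M} sinhc_sqrt"
      using isCont_cosh_sqrt isCont_sinhc_sqrt by (auto intro: continuous_at_imp_continuous_on)
    then have cq: "continuous_on {x1..M} q" unfolding q_def by (intro continuous_intros)
    have "continuous_on {x1..M} (\<lambda>x. complex_of_real (cosh_sqrt x) + \<i> * complex_of_real (q x))"
      by (intro continuous_intros c1 cq)
    then have cc: "continuous_on {x1..M} (\<lambda>x. Complex (cosh_sqrt x) (q x))" by (simp add: Complex_eq)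
    \<comment> \<open>On the cut \<open>cosh_sqrt x\<close> would equal \<open>- r\<close>, which
      lies below its lower bound \<open>- 1\<close>.\<close>
    have "Complex (cosh_sqrt x) (q x) \<notin> \<real>\<^sub>\<le>\<^sub>0" if "x \<in> {x1..M}" for x
    proof
      assume "Complex (cosh_sqrt x) (q x) \<in> \<real>\<^sub>\<le>\<^sub>0"
      then have 1: "cosh_sqrt x \<le> 0" "q x = 0" by (auto simp: complex_nonpos_Reals_iff)
      have "(cosh_sqrt x)\<^sup>2 = r\<^sup>2" using q2[of x] 1(2) that by simp
      then have "cosh_sqrt x = - r" using 1(1) r(3) by (auto simp: power2_eq_iff)
      then have "r \<le> 1" using bound[of x] that by auto
      then have "r\<^sup>2 \<le> 1" using r by (simp add: power_le_one)
      then show False using r(1) s by simp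
    qed
    then show ?thesis unfolding g_def
      using Spos by (intro continuous_intros c1 cq cc) force+
  qed
  have gM: "g M \<le> a"
  proof -
    have "q M = 0" by (simp add: q_def M)
    moreover have "Arg (Complex r 0) = 0" using r by (simp add: Arg_eq_0 complex_is_Real_iff)
    ultimately show ?thesis using a by (simp add: g_def M)
  qed
  have gx1: "a \<le> g x1"
  proof -
    have "s\<^sup>2 \<le> (q x1)\<^sup>2"
    proof -
      have "\<bar>cosh_sqrt x1\<bar> \<le> 1" using bound[of x1] x1 M by auto
      then have "(cosh_sqrt x1)\<^sup>2 \<le> 1" by (simp add: abs_square_le_1)
      then show ?thesis using q2[of x1] x1 M r by simp
    qed
    moreover have "0 \<le> q x1" using q0[of x1] x1 M by simp
    ultimately have sq: "s \<le> q x1" by (rule power2_le_imp_le)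
    have S: "sinhc_sqrt x1 = sin w / w" using w by (simp add: x1_def sinhc_sqrt_minus_square)
    have "sin w = sin d" by (simp add: w_def)
    also have "\<dots> \<le> d" using d by (intro sin_x_le_x) auto
    finally have "sin w / w \<le> d / 2" using w d by (intro frac_le) auto
    also have "\<dots> \<le> s / (2 * pi)" using d by simp
    finally have "2 * pi * sinhc_sqrt x1 \<le> s" unfolding S by (simp add: field_simps)
    then have "2 * pi \<le> s / sinhc_sqrt x1" using Spos[of x1] by (simp add: le_divide_eq)
    also have "\<dots> \<le> q x1 / sinhc_sqrt x1" using sq Spos[of x1] by (intro divide_right_mono) auto
    finally have "2 * pi \<le> q x1 / sinhc_sqrt x1" .
    then show ?thesis using a Arg_bounded[of "Complex (cosh_sqrt x1) (q x1)"] by (simp add: g_def)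
  qed
  obtain x where x: "x1 \<le> x" "x \<le> M" "g x = a"
    using IVT2'[OF gM gx1 _ cont] x1 M by auto
  define c where "c = q x / s"
  define t where "t = 2 * s / sinhc_sqrt x"
  have S: "0 < sinhc_sqrt x" using Spos x by simp
  have "c\<^sup>2 * s\<^sup>2 = (q x)\<^sup>2" using s by (simp add: c_def power_divide)
  then have cs: "(1 - c\<^sup>2) * s\<^sup>2 = x * (sinhc_sqrt x)\<^sup>2"
    using cosh_sqrt_pythagoras[of x] q2[OF x(2)] r(1) unfolding left_diff_distrib by linarith
  have e: "(1 - c\<^sup>2) * t\<^sup>2 / 4 = x"
  proof -
    have "(1 - c\<^sup>2) * t\<^sup>2 / 4 = ((1 - c\<^sup>2) * s\<^sup>2) / (sinhc_sqrt x)\<^sup>2"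
      by (simp add: t_def power_divide power_mult_distrib)
    also note cs
    also have "x * (sinhc_sqrt x)\<^sup>2 / (sinhc_sqrt x)\<^sup>2 = x" using S by simp
    finally show ?thesis .
  qed
  have gc: "geo_cos c t = cosh_sqrt x" unfolding geo_cos_def e ..
  have gs: "geo_sin c t = s" unfolding geo_sin_def e using S by (simp add: t_def)
  show ?thesis
  proof (rule that)
    show "0 \<le> c" using q0[OF x(2)] s by (simp add: c_def)
    show "0 < t" using S s by (simp add: t_def)
    have "(c\<^sup>2 - 1) * t\<^sup>2 = - (4 * x)" using e by (simp add: algebra_simps)
    then show "(c\<^sup>2 - 1) * t\<^sup>2 < (2 * pi)\<^sup>2" using x x1 by (simp add: power_mult_distrib)
    have "geo_z c t = Complex (cosh_sqrt x) (q x)" unfolding geo_z_def gc gs using s by (simp add: c_def)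
    moreover have "c * t / 2 = q x / sinhc_sqrt x" using s S by (simp add: c_def t_def)
    ultimately show "geo_angle c t = a" using x(3) by (simp add: geo_angle_def g_def)
  qed (rule gs)
qed

section \<open>The cut locus\<close>

lemma sr_length_nonneg: "0 \<le> sr_length T \<gamma>"
  unfolding sr_length_def sr_metric_def p_inner_def
  by (intro integral_nonneg_AE AE_I2 real_sqrt_ge_zero sum_nonneg) simp

lemma sr_dist_le:
  assumes "horizontal T \<gamma>"
  shows "sr_dist (\<gamma> 0) (\<gamma> T) \<le> sr_length T \<gamma>"
  unfolding sr_dist_def
proof (rule cInf_lower)
  show "bdd_below {sr_length T' \<delta> |T' \<delta>. horizontal T' \<delta> \<and> \<delta> 0 = \<gamma> 0 \<and> \<delta> T' = \<gamma> T}"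
    by (rule bdd_belowI[of _ 0]) (use sr_length_nonneg in blast)
qed (use assms in blast)

lemma sr_Exp_0 [simp]: "sr_Exp \<theta> c 0 = mat 1"
  by (rule mat2_eqI) (simp_all add: sr_Exp_parts)

lemma sr_dist_sr_Exp_le: "0 \<le> t \<Longrightarrow> sr_dist (mat 1) (sr_Exp \<theta> c t) \<le> t"
  using sr_dist_le[OF sr_Exp_horizontal[of t \<theta> c]] by (simp add: sr_Exp_length)

lemma geo_uminus:
  "geo_sin (- c) t = geo_sin c t" "geo_z (- c) t = cnj (geo_z c t)"
  by (simp_all add: geo_sin_def geo_z_def geo_cos_def complex_eq_iff)

text \<open>In the applications \<open>e\<close> is \<open>c\<close> or \<open>- c\<close>: the
  lower bound sees only the modulus of the argument, so it serves both senses of rotation.\<close>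

lemma sr_dist_eq_geo:
  assumes c: "0 \<le> c" and t: "0 < t" and pre: "(c\<^sup>2 - 1) * t\<^sup>2 \<le> (2 * pi)\<^sup>2"
    and q: "q = sr_Exp \<theta> e t"
    and B: "cmod (conj_part q) = geo_sin c t" and A: "\<bar>Arg (lin_part q)\<bar> = geo_angle c t"
  shows "sr_dist (mat 1) q = t"
proof (rule antisym)
  show "sr_dist (mat 1) q \<le> t" unfolding q by (rule sr_dist_sr_Exp_le) (use t in simp)
  show "t \<le> sr_dist (mat 1) q"
    unfolding sr_dist_def
  proof (rule cInf_greatest)
    have "horizontal t (sr_Exp \<theta> e)" using t by (intro sr_Exp_horizontal) simp
    then show "{sr_length T \<gamma> |T \<gamma>. horizontal T \<gamma> \<and> \<gamma> 0 = mat 1 \<and> \<gamma> T = q} \<noteq> {}"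
      using q sr_Exp_0 by blast
    fix x assume "x \<in> {sr_length T \<gamma> |T \<gamma>. horizontal T \<gamma> \<and> \<gamma> 0 = mat 1 \<and> \<gamma> T = q}"
    then obtain T \<gamma> where "horizontal T \<gamma>" "\<gamma> 0 = mat 1" "\<gamma> T = q" "x = sr_length T \<gamma>" by blast
    then show "t \<le> x" using sr_length_ge_geo[of T \<gamma> c t] c t pre B A by simp
  qed
qed

lemma cis_Arg_times_cmod: "z = of_real (cmod z) * cis (Arg z)"
  using rcis_cmod_Arg[of z] by (simp add: rcis_def)

text \<open>The radius fixes the modulus of the linear part because the determinant is 1, and
  \<theta> can match any argument of the conjugate part. Only the argument of the linear part
  remains as a condition.\<close>

lemma ex_sr_Exp:
  assumes c: "q \<in> SL2" and B: "cmod (conj_part q) = geo_sin c t"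
    and A: "cis (Arg (lin_part q)) = cis (- geo_angle c t)"
  shows "\<exists>\<theta>. q = sr_Exp \<theta> c t"
proof -
  define \<theta> where "\<theta> = Arg (conj_part q) - c * t / 2"
  have "(cmod (lin_part q))\<^sup>2 = (cmod (geo_z c t))\<^sup>2"
    using c by (simp add: SL2_parts B cmod_geo_z)
  then have m: "cmod (lin_part q) = cmod (geo_z c t)" by simp
  have "lin_part q = of_real (cmod (lin_part q)) * cis (Arg (lin_part q))" by (rule cis_Arg_times_cmod)
  also have "\<dots> = (of_real (cmod (geo_z c t)) * cis (Arg (geo_z c t))) * cis (- (c * t / 2))"
    unfolding A m by (simp add: geo_angle_def cis_mult mult.assoc)
  also have "\<dots> = geo_z c t * cis (- (c * t / 2))" by (simp add: cis_Arg_times_cmod[symmetric])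
  finally have 1: "lin_part q = geo_z c t * cis (- (c * t / 2))" .
  have 2: "conj_part q = of_real (geo_sin c t) * cis (\<theta> + c * t / 2)"
    using cis_Arg_times_cmod[of "conj_part q"] unfolding B by (simp add: \<theta>_def)
  have "q = sr_Exp \<theta> c t"
    by (rule mat2_eqI) (simp_all only: sr_Exp_parts 1 2)
  then show ?thesis by blast
qed

text \<open>Changing the sign of \<open>c\<close> conjugates \<open>geo_z\<close> and so reverses
  the angle; off the branch cut the principal argument respects this.\<close>

lemma ex_sr_Exp_uminus:
  assumes c: "q \<in> SL2" and B: "cmod (conj_part q) = geo_sin c t" and z: "geo_z c t \<notin> \<real>\<^sub>\<le>\<^sub>0"
    and A: "cis (Arg (lin_part q)) = cis (geo_angle c t)"
  shows "\<exists>\<theta>. q = sr_Exp \<theta> (- c) t"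
proof (rule ex_sr_Exp[OF c])
  have "Arg (cnj (geo_z c t)) = - Arg (geo_z c t)"
    using z by (auto simp: Arg_cnj Arg_eq_0 complex_nonpos_Reals_iff complex_is_Real_iff not_le)
  then have "- geo_angle (- c) t = geo_angle c t" by (simp add: geo_angle_def geo_uminus)
  then show "cis (Arg (lin_part q)) = cis (- geo_angle (- c) t)" using A by simp
qed (simp add: B geo_uminus)

text \<open>The sign of \<open>c\<close> is chosen according to the sign of the argument of the
  linear part. If this argument is \<open>pi\<close>, both signs work because
  \<open>cis pi = cis (- pi)\<close>.\<close>

lemma minimizing_geodesic:
  assumes q: "q \<in> SL2" and B: "conj_part q \<noteq> 0"
    and c: "0 \<le> c" and t: "0 < t" and pre: "(c\<^sup>2 - 1) * t\<^sup>2 < (2 * pi)\<^sup>2"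
    and s: "geo_sin c t = cmod (conj_part q)" and a: "geo_angle c t = \<bar>Arg (lin_part q)\<bar>"
  shows "sr_dist (mat 1) q = t"
    and "Arg (lin_part q) = pi \<Longrightarrow> \<exists>\<theta>. q = sr_Exp \<theta> c t" and "Arg (lin_part q) = pi \<Longrightarrow> \<exists>\<theta>. q = sr_Exp \<theta> (- c) t"
proof -
  have nz: "geo_z c t \<notin> \<real>\<^sub>\<le>\<^sub>0" using geo_z_not_nonpos[OF less_imp_le[OF t] c pre] .
  have "\<exists>\<theta> e. q = sr_Exp \<theta> e t"
  proof (cases "Arg (lin_part q) \<le> 0")
    case True
    then have "cis (Arg (lin_part q)) = cis (- geo_angle c t)" by (simp add: a)
    then show ?thesis using ex_sr_Exp[OF q s[symmetric]] by blast
  next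
    case False
    then have "cis (Arg (lin_part q)) = cis (geo_angle c t)" by (simp add: a)
    then show ?thesis using ex_sr_Exp_uminus[OF q s[symmetric] nz] by blast
  qed
  then show "sr_dist (mat 1) q = t"
    using sr_dist_eq_geo[OF c t less_imp_le[OF pre] _ s[symmetric] a[symmetric]] by blast
  assume pi: "Arg (lin_part q) = pi"
  then show "\<exists>\<theta>. q = sr_Exp \<theta> c t"
    using ex_sr_Exp[OF q s[symmetric]] a by (simp add: complex_eq_iff)
  show "\<exists>\<theta>. q = sr_Exp \<theta> (- c) t"
    using ex_sr_Exp_uminus[OF q s[symmetric] nz] a pi by simp
qed

text \<open>The long geodesic is compared with a minimizer of length \<tau> to the same point. If
  \<tau> is at most half a period, \<open>le_pi_geo_sin\<close> gives
  \<open>\<tau> \<le> pi / n\<close>. If \<open>n = k\<close>, then \<tau> is less than the common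
  period. Otherwise the strict lower bound is applied to the long geodesic itself, which attains its
  maximal radius at time \<open>pi / n\<close>.\<close>

lemma not_optimal_after_period:
  assumes q: "q = sr_Exp \<theta> c t" and t: "0 < t" and B: "conj_part q \<noteq> 0"
    and post: "(2 * pi)\<^sup>2 \<le> (c\<^sup>2 - 1) * t\<^sup>2"
  shows "sr_dist (mat 1) q < t"
proof -
  have c1: "0 < c\<^sup>2 - 1"
  proof (rule ccontr)
    assume "\<not> 0 < c\<^sup>2 - 1"
    then have "(c\<^sup>2 - 1) * t\<^sup>2 \<le> 0" by (intro mult_nonpos_nonneg) auto
    then have "(2 * pi)\<^sup>2 \<le> 0" using post by (rule order_trans[rotated])
    then show False by simp
  qed
  define n where "n = sqrt (c\<^sup>2 - 1)"
  have n: "0 < n" "c\<^sup>2 = 1 + n\<^sup>2" using c1 by (auto simp: n_def)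
  have n0: "n \<noteq> 0" using n by simp
  have "(2 * pi)\<^sup>2 \<le> (n * t)\<^sup>2" using post unfolding n(2) by (simp add: power_mult_distrib)
  then have "2 * pi \<le> n * t" by (rule power2_le_imp_le) (use n t in simp)
  then have tn: "2 * pi / n \<le> t" using n(1) by (simp add: divide_le_eq mult.commute)
  have Bx: "cmod (conj_part (sr_Exp \<theta> c x)) = \<bar>sin (n * x / 2)\<bar> / n" for x
    using n(1) by (simp add: sr_Exp_parts norm_mult norm_divide geo_elliptic[OF n(2) n0])
  have Bn: "cmod (conj_part (sr_Exp \<theta> c x)) \<le> 1 / n" for x
    unfolding Bx using n(1) by (intro divide_right_mono) auto
  have "t \<noteq> 2 * pi / n"
  proof
    assume "t = 2 * pi / n"
    then have "cmod (conj_part q) = 0" unfolding q Bx using n(1) by simp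
    then show False using B by simp
  qed
  then have tn': "2 * pi / n < t" using tn by simp
  have q2: "q \<in> SL2" unfolding q by (rule sr_Exp_SL2)
  obtain e \<tau> where e: "0 \<le> e" and \<tau>: "0 < \<tau>" and pre: "(e\<^sup>2 - 1) * \<tau>\<^sup>2 < (2 * pi)\<^sup>2"
    and s: "geo_sin e \<tau> = cmod (conj_part q)" and a: "geo_angle e \<tau> = \<bar>Arg (lin_part q)\<bar>"
  proof (rule ex_geo[of "cmod (conj_part q)" "\<bar>Arg (lin_part q)\<bar>"])
    show "\<bar>Arg (lin_part q)\<bar> \<le> pi" using Arg_bounded[of "lin_part q"] by auto
  qed (use B in auto)
  have d: "sr_dist (mat 1) q = \<tau>" by (rule minimizing_geodesic(1)[OF q2 B e \<tau> pre s a])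
  have "\<tau> < t"
  proof (cases "(e\<^sup>2 - 1) * \<tau>\<^sup>2 \<le> pi\<^sup>2")
    case True
    have "\<tau> \<le> pi * geo_sin e \<tau>" by (rule le_pi_geo_sin[OF \<tau> True])
    also have "\<dots> \<le> pi * (1 / n)" unfolding s q by (rule mult_left_mono[OF Bn]) simp
    also have "\<dots> < 2 * pi / n" using n(1) by (simp add: divide_strict_right_mono)
    finally show ?thesis using tn' by simp
  next
    case False
    then have "0 < (e\<^sup>2 - 1) * \<tau>\<^sup>2" by (meson le_less_trans not_le zero_le_power2)
    then have e1: "0 < e\<^sup>2 - 1" using \<tau> by (simp add: zero_less_mult_iff)
    define k where "k = sqrt (e\<^sup>2 - 1)"
    have k: "0 < k" "e\<^sup>2 = 1 + k\<^sup>2" using e1 by (auto simp: k_def)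
    have "pi\<^sup>2 \<le> (k * \<tau>)\<^sup>2" "(k * \<tau>)\<^sup>2 < (2 * pi)\<^sup>2"
      using False pre unfolding k(2) by (auto simp: power_mult_distrib)
    then have "pi \<le> k * \<tau>" "k * \<tau> < 2 * pi"
      using k(1) \<tau> power2_le_imp_le[of pi "k * \<tau>"] power2_less_imp_less[of "k * \<tau>" "2 * pi"] by auto
    then have \<tau>k: "pi / k \<le> \<tau>" "\<tau> < 2 * pi / k"
      using k(1) by (auto simp: divide_le_eq less_divide_eq mult.commute)
    show ?thesis
    proof (cases "n = k")
      case True
      then show ?thesis using \<tau>k tn' by simp
    next
      case False
      have "pi / n \<le> 2 * pi / n" using n(1) by (simp add: divide_right_mono)
      then have "pi / n \<in> {0..t}" using n(1) tn' by auto
      moreover have "cmod (conj_part (sr_Exp \<theta> c (pi / n))) = 1 / n"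
        unfolding Bx using n(1) by simp
      moreover have "horizontal t (sr_Exp \<theta> c)" by (rule sr_Exp_horizontal) (use t in simp)
      moreover have "\<bar>c\<bar>\<^sup>2 = 1 + n\<^sup>2" using n(2) by simp
      ultimately have "\<tau> < sr_length t (sr_Exp \<theta> c)"
        using sr_length_ge_after_half_period(2)[of t "sr_Exp \<theta> c" n "\<bar>c\<bar>" "pi / n" k e \<tau>]
          Bn n(1) k e \<tau>k s a False unfolding q[symmetric] by simp
      then show ?thesis using sr_Exp_length[of t \<theta> c] t by simp
    qed
  qed
  then show ?thesis using d by simp
qed

lemma cis_eq_imp_rcong: "cis x = cis y \<Longrightarrow> [x = y] (rmod (2 * pi))"
proof -
  assume "cis x = cis y"
  then have "exp (\<i> * x) = exp (\<i> * y)" by (simp add: cis_conv_exp)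
  then obtain n :: int where "\<i> * x = \<i> * y + (of_int (2 * n) * pi) * \<i>" by (auto simp: exp_eq)
  then have "Im (\<i> * complex_of_real x) = Im (\<i> * complex_of_real y + (of_int (2 * n) * pi) * \<i>)" by simp
  then have "x = y + of_int n * (2 * pi)" by simp
  then show ?thesis using rcong_add[OF rcong_refl[of y "2 * pi"] rcong_mult_of_int_0_left_left[of n "2 * pi"]]
    by (simp add: rcong_sym_iff)
qed

section \<open>The two strata in complex coordinates\<close>

lemma K_loc_iff: "q \<in> K_loc \<longleftrightarrow> conj_part q = 0 \<and> cmod (lin_part q) = 1 \<and> q \<noteq> mat 1"
proof -
  have "q \<in> mexp ` k_space \<longleftrightarrow> conj_part q = 0 \<and> cmod (lin_part q) = 1"
  proof
    assume "conj_part q = 0 \<and> cmod (lin_part q) = 1"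
    then have "q = mexp ((2 * Arg (lin_part q)) *\<^sub>R sl2_k)"
      using cis_Arg_times_cmod[of "lin_part q"] by (intro mat2_eqI) (simp_all add: mexp_k)
    then show "q \<in> mexp ` k_space" by (auto simp: k_space_eq)
  qed (auto simp: k_space_eq mexp_k)
  then show ?thesis by (auto simp: K_loc_def)
qed

text \<open>The factor \<open>mexp ((2 * pi) *\<^sub>R sl2_k)\<close> is minus the identity, and the
  exponential of an element of \<open>p_space\<close> has real linear part \<open>cosh r\<close> and
  a conjugate part of modulus \<open>sinh r\<close>. Conversely \<open>arsinh\<close> recovers
  \<open>r\<close>, as in the polar decomposition of \<open>- q\<close>.\<close>

lemma K_sym_iff: "q \<in> K_sym \<longleftrightarrow> q \<in> SL2 \<and> Im (lin_part q) = 0 \<and> Re (lin_part q) < 0"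
proof -
  have k: "lin_part (mexp ((2 * pi) *\<^sub>R sl2_k)) = -1" "conj_part (mexp ((2 * pi) *\<^sub>R sl2_k)) = 0"
    using mexp_k[of "2 * pi"] by (simp_all add: complex_eq_iff)
  have p: "lin_part (mexp X) = of_real (cosh r)"
    "conj_part (mexp X) = (if r = 0 then 0 else of_real (sinh r / r) * conj_part X)"
    if "lin_part X = 0" "r = cmod (conj_part X)" for X r
    using mexp_sl2[of X] that by (auto simp: cosh_sqrt_square sinhc_sqrt_square)
  show ?thesis
  proof
    assume "q \<in> K_sym"
    then obtain X where X: "lin_part X = 0" and q: "q = mexp ((2 * pi) *\<^sub>R sl2_k) ** mexp X"
      by (auto simp: K_sym_def p_space_iff)
    define r where "r = cmod (conj_part X)"
    have l: "lin_part q = - of_real (cosh r)" and co: "conj_part q = - conj_part (mexp X)"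
      unfolding q lin_part_mult conj_part_mult k p(1)[OF X r_def] by auto
    have "cmod (conj_part q) = sinh r"
      unfolding co p(2)[OF X r_def] by (auto simp: norm_mult norm_divide r_def)
    then have "q \<in> SL2" by (simp add: SL2_parts l norm_minus_cancel cosh_square_eq)
    then show "q \<in> SL2 \<and> Im (lin_part q) = 0 \<and> Re (lin_part q) < 0" by (simp add: l)
  next
    assume q: "q \<in> SL2 \<and> Im (lin_part q) = 0 \<and> Re (lin_part q) < 0"
    define b where "b = conj_part q"
    define r where "r = arsinh (cmod b)"
    define X where "X = mat_of_parts 0 (if b = 0 then 0 else of_real (r / cmod b) * (- b))"
    have lX: "lin_part X = 0" by (simp add: X_def)
    have r0: "0 \<le> r" and rz: "r = 0 \<longleftrightarrow> b = 0" by (auto simp: r_def simp flip: not_less)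
    have rX: "r = cmod (conj_part X)" using r0 rz by (auto simp: X_def norm_mult norm_divide)
    have "(cmod (lin_part q))\<^sup>2 = 1 + (cmod b)\<^sup>2" using q by (simp add: SL2_parts b_def)
    then have "cmod (lin_part q) = cosh r"
      by (simp add: r_def cosh_arsinh_real real_sqrt_unique add.commute)
    moreover have "cmod (lin_part q) = - Re (lin_part q)" using q by (simp add: cmod_def)
    ultimately have l: "lin_part q = - of_real (cosh r)" using q by (simp add: complex_eq_iff)
    have co: "conj_part (mexp X) = - b"
      unfolding p(2)[OF lX rX] using rz by (auto simp: X_def r_def)
    have "q = mexp ((2 * pi) *\<^sub>R sl2_k) ** mexp X"
      by (rule mat2_eqI) (simp_all add: lin_part_mult conj_part_mult k p(1)[OF lX rX] co l b_def)
    then show "q \<in> K_sym" using lX by (auto simp: K_sym_def p_space_iff)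
  qed
qed

section \<open>The inclusions between the cut locus and the two strata\<close>

lemma cut_locus_subset: "cut_locus \<subseteq> K_sym \<union> K_loc"
proof
  fix q assume "q \<in> cut_locus"
  then obtain \<theta>1 c1 \<theta>2 c2 t where ne: "\<not> ([\<theta>1 = \<theta>2] (rmod (2 * pi)) \<and> c1 = c2)" and t: "0 < t"
    and q1: "q = sr_Exp \<theta>1 c1 t" and q2: "q = sr_Exp \<theta>2 c2 t" and d: "sr_dist (mat 1) q = t"
    unfolding cut_locus_def optimal_upto_def by blast
  have q: "q \<in> SL2" unfolding q1 by (rule sr_Exp_SL2)
  show "q \<in> K_sym \<union> K_loc"
  proof (cases "conj_part q = 0")
    case True
    have "q \<noteq> mat 1" using sr_dist_sr_Exp_le[of 0 0 0] d t by auto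
    moreover have "(cmod (lin_part q))\<^sup>2 = 1" using q True by (simp add: SL2_parts)
    ultimately show ?thesis using True by (simp add: K_loc_iff power2_eq_1_iff) (smt (verit) norm_ge_zero)
  next
    case False
    \<comment> \<open>Off the rotations an optimal geodesic ends before its period, so time and
      radius determine \<open>c\<close> up to sign.\<close>
    have pre: "(c\<^sup>2 - 1) * t\<^sup>2 < (2 * pi)\<^sup>2" if "q = sr_Exp \<theta> c t" for \<theta> c
      using not_optimal_after_period[OF that t False] d by (meson less_irrefl not_le)
    have gs: "cmod (conj_part q) = geo_sin c t" if "q = sr_Exp \<theta> c t" for \<theta> c
      using geo_sin_pos[OF t pre[OF that]] unfolding that by (simp add: sr_Exp_parts norm_mult)
    have "geo_sin c1 t = geo_sin c2 t" using gs[OF q1] gs[OF q2] by simp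
    then have "c1\<^sup>2 = c2\<^sup>2" by (rule geo_sin_inj[OF t pre[OF q1] pre[OF q2]])
    then have "c1 = c2 \<or> c1 = - c2" by (simp add: power2_eq_iff)
    then consider "c1 = c2" | "c1 \<noteq> 0" "c2 = - c1" by fastforce
    then show ?thesis
    proof cases
      case 1
      have "of_real (geo_sin c1 t) * cis (\<theta>1 + c1 * t / 2) = of_real (geo_sin c1 t) * cis (\<theta>2 + c1 * t / 2)"
        using q1 q2 1 sr_Exp_parts(2) by metis
      moreover have "geo_sin c1 t \<noteq> 0" using gs[OF q1] False by auto
      ultimately have "cis (\<theta>1 + c1 * t / 2) = cis (\<theta>2 + c1 * t / 2)" by simp
      then have "[\<theta>1 + c1 * t / 2 = \<theta>2 + c1 * t / 2] (rmod (2 * pi))" by (rule cis_eq_imp_rcong)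
      then show ?thesis using ne 1 by simp
    next
      case 2
      \<comment> \<open>Opposite parameters give conjugate linear parts, so meeting forces a real
        linear part.\<close>
      have "lin_part q = cnj (lin_part q)"
        using sr_Exp_parts(1)[of \<theta>1 c1 t] sr_Exp_parts(1)[of \<theta>2 c2 t] q1 q2 2
        by (simp add: geo_uminus cis_cnj)
      then have im: "Im (lin_part q) = 0" by (simp add: complex_eq_iff)
      have "lin_part q \<noteq> 0" using q by (auto simp: SL2_parts add_nonneg_eq_0_iff)
      then have "Re (lin_part q) \<noteq> 0" using im by (simp add: complex_eq_iff)
      moreover have "\<not> 0 < Re (lin_part q)"
      proof
        assume "0 < Re (lin_part q)"
        then have ar: "Arg (lin_part q) = 0" using im by (simp add: Arg_eq_0 complex_is_Real_iff)
        \<comment> \<open>For a positive linear part the geodesic with \<open>c = 0\<close> reaches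
          the same radius with angle 0 and minimizes. Equality of its length with \<open>t\<close>
          would force \<open>c1 = 0\<close>.\<close>
        define \<tau> where "\<tau> = 2 * arsinh (cmod (conj_part q))"
        have \<tau>: "0 < \<tau>" using False by (simp add: \<tau>_def)
        have s: "geo_sin 0 \<tau> = cmod (conj_part q)" by (simp add: geo_hyperbolic[of 0 1] \<tau>_def)
        have a: "geo_angle 0 \<tau> = \<bar>Arg (lin_part q)\<bar>"
          by (simp add: ar geo_angle_def geo_z_def geo_hyperbolic[of 0 1] Arg_eq_0 complex_is_Real_iff)
        have pre0: "((0::real)\<^sup>2 - 1) * x\<^sup>2 < (2 * pi)\<^sup>2" for x
          by (rule le_less_trans[of _ 0]) simp_all
        have "\<tau> = t" using minimizing_geodesic(1)[OF q False order_refl \<tau> pre0 s a] d by simp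
        then have "geo_sin c1 t = geo_sin 0 t" using s gs[OF q1] by simp
        then have "c1\<^sup>2 = 0\<^sup>2" by (rule geo_sin_inj[OF t pre[OF q1] pre0])
        then show False using 2 by simp
      qed
      ultimately show ?thesis using im q by (simp add: K_sym_iff)
    qed
  qed
qed

lemma K_loc_subset: "K_loc \<subseteq> cut_locus"
proof
  fix q assume "q \<in> K_loc"
  then have B: "conj_part q = 0" and l: "cmod (lin_part q) = 1" and "q \<noteq> mat 1" by (auto simp: K_loc_iff)
  define a where "a = \<bar>Arg (lin_part q)\<bar>"
  have q: "q \<in> SL2" using B l by (simp add: SL2_parts)
  have "a \<noteq> 0"
  proof
    assume "a = 0"
    then have "lin_part q = 1" using cis_Arg_times_cmod[of "lin_part q"] l by (simp add: a_def)
    then have "q = mat 1" using B by (intro mat2_eqI) simp_all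
    then show False using \<open>q \<noteq> mat 1\<close> by simp
  qed
  then have a: "0 < a" by (simp add: a_def)
  \<comment> \<open>Here \<open>m\<close> stands for \<open>c / n\<close>: the angle
    \<open>(c / n - 1) * pi\<close> after a full period must equal \<open>a\<close>, and
    \<open>n\<close> then comes from \<open>c\<^sup>2 = 1 + n\<^sup>2\<close>.\<close>
  define m where "m = 1 + a / pi"
  have m: "1 < m" using a by (simp add: m_def)
  then have m2: "0 < m\<^sup>2 - 1" by simp
  define n where "n = 1 / sqrt (m\<^sup>2 - 1)"
  define c where "c = m * n"
  define t where "t = 2 * pi / n"
  have n: "0 < n" using m2 by (simp add: n_def)
  have "n\<^sup>2 * (m\<^sup>2 - 1) = 1" using m2 by (simp add: n_def power_divide)
  then have c: "c\<^sup>2 = 1 + n\<^sup>2" by (simp add: c_def power_mult_distrib algebra_simps)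
  have c0: "0 \<le> c" using m n by (simp add: c_def)
  have t: "0 < t" using n by (simp add: t_def)
  have s: "geo_sin c t = 0" and ang: "geo_angle c t = a"
  proof -
    have "pi / n \<ge> 0" using n by simp
    from geo_reflect[OF n c c0 order_refl this]
    show "geo_sin c t = 0" "geo_angle c t = a" using n by (simp_all add: t_def c_def m_def)
  qed
  have pre: "(c\<^sup>2 - 1) * t\<^sup>2 \<le> (2 * pi)\<^sup>2" using n by (simp add: c t_def power_divide)
  have z: "geo_z c t = -1" using n by (simp add: geo_z_def s geo_elliptic[OF c] complex_eq_iff) (simp add: t_def)
  \<comment> \<open>After a full period the conjugate part vanishes, so the end point is independent
    of \<theta>. The sign of \<open>e\<close> gives the sense of rotation.\<close>
  have *: "q = sr_Exp \<theta> e t" if e: "e = (if Arg (lin_part q) \<le> 0 then c else - c)" for \<theta> e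
  proof (rule mat2_eqI)
    have "Arg (-1) = pi" by (simp add: Arg_eq_pi)
    then have ct: "c * t / 2 = a + pi" using ang by (simp add: geo_angle_def z)
    have "lin_part q = cis (Arg (lin_part q))" using cis_Arg_times_cmod[of "lin_part q"] l by simp
    also have "\<dots> = - cis (- (e * t / 2))"
    proof (cases "Arg (lin_part q) \<le> 0")
      case True
      then have ea: "e = c" "a = - Arg (lin_part q)" by (simp_all add: e a_def)
      have "- (e * t / 2) = Arg (lin_part q) - pi" unfolding ea(1) ct ea(2) by simp
      then show ?thesis by (simp add: complex_eq_iff cos_diff sin_diff)
    next
      case False
      then have ea: "e = - c" "a = Arg (lin_part q)" by (simp_all add: e a_def)
      have "- (e * t / 2) = c * t / 2" unfolding ea(1) by simp
      then have "- (e * t / 2) = Arg (lin_part q) + pi" unfolding ct ea(2) .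
      then show ?thesis by (simp add: complex_eq_iff)
    qed
    finally have l': "lin_part q = - cis (- (e * t / 2))" .
    have "geo_z e t = -1" "geo_sin e t = 0" unfolding e by (simp_all add: z s geo_uminus)
    then show "lin_part q = lin_part (sr_Exp \<theta> e t)" "conj_part q = conj_part (sr_Exp \<theta> e t)"
      unfolding sr_Exp_parts l' B by simp_all
  qed
  define e where "e = (if Arg (lin_part q) \<le> 0 then c else - c)"
  have d: "sr_dist (mat 1) q = t"
    by (rule sr_dist_eq_geo[OF c0 t pre *[OF refl]]) (simp_all add: B s ang a_def)
  \<comment> \<open>Two different initial directions, 0 and \<open>pi\<close>, serve as witnesses
    for the two minimizers.\<close>
  have "\<not> [0 = pi] (rmod (2 * pi))"
  proof
    assume "[0 = pi] (rmod (2 * pi))"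
    moreover have "pi rmod (2 * pi) = pi" by (rule rmod_unique[of _ _ _ 0]) auto
    ultimately show False by (simp add: rcong_def)
  qed
  then show "q \<in> cut_locus"
    unfolding cut_locus_def optimal_upto_def using *[OF e_def, of 0] *[OF e_def, of pi] d t
    by (intro CollectI exI[of _ 0] exI[of _ e] exI[of _ pi] exI[of _ t]) simp
qed

lemma K_sym_subset: "K_sym \<subseteq> cut_locus"
proof
  fix q assume "q \<in> K_sym"
  then have q: "q \<in> SL2" and neg: "Im (lin_part q) = 0" "Re (lin_part q) < 0" by (auto simp: K_sym_iff)
  show "q \<in> cut_locus"
  \<comment> \<open>With vanishing conjugate part the point is minus the identity, which already
    belongs to \<open>K_loc\<close>.\<close>
  proof (cases "conj_part q = 0")
    case True
    then have "(cmod (lin_part q))\<^sup>2 = 1" using q by (simp add: SL2_parts)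
    then have "cmod (lin_part q) = 1" by (metis norm_ge_zero power2_eq_imp_eq one_power2 zero_le_one)
    moreover have "q \<noteq> mat 1" using neg by auto
    ultimately show ?thesis using True K_loc_subset K_loc_iff by blast
  next
    case False
    have ar: "Arg (lin_part q) = pi" using neg by (simp add: Arg_eq_pi)
    obtain c t where ct: "0 \<le> c" "0 < t" "(c\<^sup>2 - 1) * t\<^sup>2 < (2 * pi)\<^sup>2"
      and s: "geo_sin c t = cmod (conj_part q)" and "geo_angle c t = pi"
      using ex_geo[of "cmod (conj_part q)" pi] False by auto
    then have a: "geo_angle c t = \<bar>Arg (lin_part q)\<bar>" by (simp add: ar)
    note min = minimizing_geodesic[OF q False ct s a]
    obtain \<theta>1 \<theta>2 where 1: "q = sr_Exp \<theta>1 c t" and 2: "q = sr_Exp \<theta>2 (- c) t"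
      using min(2,3)[OF ar] by blast
    \<comment> \<open>A geodesic with \<open>c = 0\<close> has angle 0 throughout, whereas the angle
      here is \<open>pi\<close>; hence \<open>c\<close> and \<open>- c\<close> are
      different.\<close>
    have "c \<noteq> 0"
    proof
      assume "c = 0"
      then have "geo_angle c t = 0"
        by (simp add: geo_angle_def geo_z_def geo_hyperbolic[of 0 1] Arg_eq_0 complex_is_Real_iff)
      then show False using \<open>geo_angle c t = pi\<close> by simp
    qed
    then have "c \<noteq> - c" by simp
    then show ?thesis
      unfolding cut_locus_def optimal_upto_def using 1 2 min(1) ct(2)
      by (intro CollectI exI[of _ \<theta>1] exI[of _ c] exI[of _ \<theta>2] exI[of _ "- c"] exI[of _ t]) simp
  qed
qed

theorem theorem5:
  shows "cut_locus = K_sym \<union> K_loc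
    \<and> K_sym = {g \<in> SL2. g = transpose g \<and> trace g < 0}
    \<and> K_loc = {vector [vector [cos \<alpha>, - sin \<alpha>], vector [sin \<alpha>, cos \<alpha>]] | \<alpha>::real.
                 \<not> [\<alpha> = 0] (rmod (2 * pi))}"
proof (intro conjI)
  show "cut_locus = K_sym \<union> K_loc"
    using cut_locus_subset K_sym_subset K_loc_subset by blast
  have "g = transpose g \<and> trace g < 0 \<longleftrightarrow> Im (lin_part g) = 0 \<and> Re (lin_part g) < 0" for g :: "real^2^2"
  proof -
    have "g = transpose g \<longleftrightarrow> g $ 1 $ 2 = g $ 2 $ 1"
      unfolding transpose_def vec_eq_iff forall_2 by auto
    then show ?thesis by (auto simp: lin_part_def trace_def sum_2)
  qed
  then show "K_sym = {g \<in> SL2. g = transpose g \<and> trace g < 0}"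
    unfolding set_eq_iff mem_Collect_eq K_sym_iff by blast
  define R :: "real \<Rightarrow> real^2^2" where "R = (\<lambda>\<alpha>. vector [vector [cos \<alpha>, - sin \<alpha>], vector [sin \<alpha>, cos \<alpha>]])"
  have R: "lin_part (R \<alpha>) = cis \<alpha>" "conj_part (R \<alpha>) = 0" for \<alpha>
    by (simp_all add: R_def lin_part_def conj_part_def complex_eq_iff)
  have R1: "R \<alpha> = mat 1 \<longleftrightarrow> [\<alpha> = 0] (rmod (2 * pi))" for \<alpha>
  proof
    assume "R \<alpha> = mat 1"
    then have "cis \<alpha> = cis 0" using R(1)[of \<alpha>] by simp
    then show "[\<alpha> = 0] (rmod (2 * pi))" by (rule cis_eq_imp_rcong)
  next
    assume "[\<alpha> = 0] (rmod (2 * pi))"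
    then have "\<alpha> = 2 * pi * of_int \<lfloor>\<alpha> / (2 * pi)\<rfloor>" by (simp add: rcong_def rmod_def)
    then have "cis \<alpha> = 1" using cis_multiple_2pi[of "of_int \<lfloor>\<alpha> / (2 * pi)\<rfloor>"] by (metis Ints_of_int)
    then show "R \<alpha> = mat 1" by (intro mat2_eqI) (simp_all add: R)
  qed
  have "q \<in> K_loc \<longleftrightarrow> (\<exists>\<alpha>. q = R \<alpha> \<and> \<not> [\<alpha> = 0] (rmod (2 * pi)))" for q
  proof
    assume q: "q \<in> K_loc"
    have "q = R (Arg (lin_part q))"
      using q cis_Arg_times_cmod[of "lin_part q"] by (intro mat2_eqI) (simp_all add: K_loc_iff R)
    then show "\<exists>\<alpha>. q = R \<alpha> \<and> \<not> [\<alpha> = 0] (rmod (2 * pi))"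
      using q R1 by (metis K_loc_iff)
  qed (auto simp: K_loc_iff R R1)
  then show "K_loc = {vector [vector [cos \<alpha>, - sin \<alpha>], vector [sin \<alpha>, cos \<alpha>]] | \<alpha>::real.
                 \<not> [\<alpha> = 0] (rmod (2 * pi))}"
    unfolding R_def by blast
qed

end
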